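(* Let $\omega_0$ and $\omega_1$ be germs at $0$ of $\mathbb C$-analytic singular symplectic forms on $\mathbb C^{2n}$ with a common structurally smooth Martinet hypersurface $\Sigma_2$ at $0$, let $\iota:\Sigma_2\hookrightarrow\mathbb C^{2n}$ be the inclusion, and suppose $\operatorname{rank}(\iota^{*}\omega_0|_{0})=\operatorname{rank}(\iota^{*}\omega_1|_0)\le 2n-4$. If $\iota^{*}\omega_0=\iota^{*}\omega_1$ and $\ker(\omega_0^{n-1}|_0)=\ker(\omega_1^{n-1}|_0)$, then there exists a $\mathbb C$-analytic diffeomorphism-germ $\Psi:(\mathbb C^{2n},0)\to(\mathbb C^{2n},0)$ such that $\Psi^{*}\omega_1=\omega_0$.
   Context: A closed ($\mathbb C$-analytic) differential $2$-form-germ $\omega$ at $0$ on $\mathbb C^{2n}$ is called a singular symplectic form-germ if its Martinet hypersurface $\Sigma_2(\omega)=\{p:\omega^n|_p=0\}$ is nowhere dense, where $\omega^n=\omega\wedge\cdots\wedge\omega$ ($n$ times). Write $\omega^n=f\,\Omega$ with $\Omega$ the germ at $0$ of a volume form and $f$ a function-germ, so $\Sigma_2(\omega)=\{f=0\}$. The Martinet hypersurface is called structurally smooth at $0$ if $f(0)=0$ and $df|_0\neq 0$. "Common Martinet hypersurface" means $\Sigma_2(\omega_0)=\Sigma_2(\omega_1)=\Sigma_2$. For such $\omega$, $\ker(\omega^{n-1}|_0)=\{v\in T_0\mathbb C^{2n}: v\rfloor(\omega^{n-1}|_0)=0\}$, where $v\rfloor$ denotes interior product. The rank of a $2$-form at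 a point is its rank as a skew-symmetric bilinear form. *)

theory Defs
  imports "HOL-Analysis.Analysis" "HOL-Complex_Analysis.Complex_Analysis"
    "HOL-Combinatorics.Permutations" "HOL-Library.Function_Algebras"
begin

section \<open>Analytic functions and maps of several complex variables\<close>

text \<open>The several-variable analogue of the library's \<^const>\<open>analytic_on\<close>: complex differentiability
  in a neighbourhood of every point. Complex differentiability is Frechet differentiability with
  a complex-linear derivative.\<close>

definition analytic_fun_on :: "(complex^'m \<Rightarrow> complex) \<Rightarrow> (complex^'m) set \<Rightarrow> bool"
    (infix "analytic'_fun'_on" 50) where
  "f analytic_fun_on S \<longleftrightarrow>
     (\<forall>p\<in>S. \<exists>e>0. \<forall>q\<in>ball p e. \<exists>f'. (f has_derivative f') (at q) \<and> Vector_Spaces.linear (*s) (*) f')"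

definition analytic_map_on :: "(complex^'m \<Rightarrow> complex^'k) \<Rightarrow> (complex^'m) set \<Rightarrow> bool"
    (infix "analytic'_map'_on" 50) where
  "F analytic_map_on S \<longleftrightarrow> (\<forall>i. (\<lambda>p. F p $ i) analytic_fun_on S)"

definition diffeo_germ :: "(complex^'m \<Rightarrow> complex^'m) \<Rightarrow> bool" where
  "diffeo_germ \<Psi> \<longleftrightarrow> \<Psi> 0 = 0 \<and>
     (\<exists>U V \<Phi>. open U \<and> open V \<and> 0 \<in> U \<and> \<Psi> ` U = V \<and>
        \<Psi> analytic_map_on U \<and> \<Phi> analytic_map_on V \<and> (\<forall>p\<in>U. \<Phi> (\<Psi> p) = p))"

section \<open>Exterior algebra\<close>

text \<open>An exterior \<open>k\<close>-form is encoded as a function of an infinite sequence of vectors which only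
  depends on the entries with index below \<open>k\<close>.\<close>

type_synonym 'm form = "(nat \<Rightarrow> complex^'m) \<Rightarrow> complex"

definition alternating_form :: "nat \<Rightarrow> 'm::finite form \<Rightarrow> bool" where
  "alternating_form k \<alpha> \<longleftrightarrow>
     (\<forall>v w. (\<forall>i<k. v i = w i) \<longrightarrow> \<alpha> v = \<alpha> w) \<and>
     (\<forall>v. \<forall>i<k. Vector_Spaces.linear (*s) (*) (\<lambda>x. \<alpha> (v(i := x)))) \<and>
     (\<forall>v i j. i < j \<and> j < k \<and> v i = v j \<longrightarrow> \<alpha> v = 0)"

definition wedge :: "nat \<Rightarrow> nat \<Rightarrow> 'm::finite form \<Rightarrow> 'm form \<Rightarrow> 'm form" where
  "wedge k l \<alpha> \<beta> = (\<lambda>v. (\<Sum>\<sigma> | \<sigma> permutes {..<k+l}.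
      of_int (sign \<sigma>) * \<alpha> (\<lambda>i. v (\<sigma> i)) * \<beta> (\<lambda>i. v (\<sigma> (k + i)))) / (fact k * fact l))"

text \<open>\<open>wedge_power \<alpha> j\<close> is the \<open>j\<close>-fold wedge power of a \<open>2\<close>-form \<open>\<alpha>\<close>, a \<open>2j\<close>-form.\<close>

primrec wedge_power :: "'m::finite form \<Rightarrow> nat \<Rightarrow> 'm form" where
  "wedge_power \<alpha> 0 = (\<lambda>v. 1)"
| "wedge_power \<alpha> (Suc j) = wedge 2 (2 * j) \<alpha> (wedge_power \<alpha> j)"

text \<open>Interior product of a vector with a form of positive degree.\<close>

definition iprod :: "complex^'m \<Rightarrow> 'm::finite form \<Rightarrow> 'm form" where
  "iprod x \<alpha> = (\<lambda>v. \<alpha> (case_nat x v))"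

definition form_ker :: "'m::finite form \<Rightarrow> (complex^'m) set" where
  "form_ker \<alpha> = {x. iprod x \<alpha> = (\<lambda>v. 0)}"

text \<open>Forms on a subspace \<open>T\<close> are encoded by extending them by \<open>0\<close> to arguments outside \<open>T\<close>.\<close>

definition restrict_form :: "nat \<Rightarrow> (complex^'m) set \<Rightarrow> 'm::finite form \<Rightarrow> 'm form" where
  "restrict_form k T \<alpha> = (\<lambda>v. if \<forall>i<k. v i \<in> T then \<alpha> v else 0)"

text \<open>The rank of a bilinear form \<open>\<beta>\<close> on \<open>T\<close> is the rank of the linear map from \<open>T\<close> to its dual that
  sends \<open>x\<close> to \<open>\<beta>(x, _)\<close>, i.e. the complex dimension of its image.\<close>

definition form_rank :: "(complex^'m) set \<Rightarrow> 'm::finite form \<Rightarrow> nat" where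
  "form_rank T \<beta> =
     vector_space.dim (\<lambda>(c::complex) (\<alpha>::'m form) v. c * \<alpha> v) ((\<lambda>x. iprod x \<beta>) ` T)"

section \<open>Differential forms\<close>

type_synonym 'm diff_form = "complex^'m \<Rightarrow> 'm form"

definition analytic_diff_form_on :: "nat \<Rightarrow> 'm::finite diff_form \<Rightarrow> (complex^'m) set \<Rightarrow> bool" where
  "analytic_diff_form_on k \<omega> U \<longleftrightarrow>
     (\<forall>p\<in>U. alternating_form k (\<omega> p)) \<and> (\<forall>v. (\<lambda>p. \<omega> p v) analytic_fun_on U)"

text \<open>Exterior derivative of a \<open>k\<close>-form; the \<open>i\<close>-th summand differentiates, in direction \<open>v i\<close>, the
  value of \<open>\<omega>\<close> on the sequence \<open>v\<close> with its \<open>i\<close>-th entry omitted.\<close>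

definition ext_deriv :: "nat \<Rightarrow> 'm::finite diff_form \<Rightarrow> 'm diff_form" where
  "ext_deriv k \<omega> = (\<lambda>p v. \<Sum>i\<le>k. (-1) ^ i *
      frechet_derivative (\<lambda>q. \<omega> q (\<lambda>j. if j < i then v j else v (Suc j))) (at p) (v i))"

definition pullback :: "(complex^'m \<Rightarrow> complex^'m) \<Rightarrow> 'm::finite diff_form \<Rightarrow> 'm diff_form" where
  "pullback \<Psi> \<omega> = (\<lambda>p v. \<omega> (\<Psi> p) (\<lambda>i. frechet_derivative \<Psi> (at p) (v i)))"

text \<open>For \<open>p\<close> in a complex submanifold \<open>S\<close>, the tangent space at \<open>p\<close> consists of the velocities of
  the germs of analytic curves in \<open>S\<close> through \<open>p\<close>.\<close>

definition tangent_space :: "(complex^'m) set \<Rightarrow> complex^'m \<Rightarrow> (complex^'m) set" where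
  "tangent_space S p = {v. \<exists>\<gamma> :: complex \<Rightarrow> complex^'m.
      (\<forall>i. (\<lambda>t. \<gamma> t $ i) analytic_on {0}) \<and> \<gamma> 0 = p \<and> (\<forall>\<^sub>F t in nhds 0. \<gamma> t \<in> S) \<and>
      v = (\<chi> i. deriv (\<lambda>t. \<gamma> t $ i) 0)}"

text \<open>Value at a point of \<open>S\<close> of the pullback of a \<open>k\<close>-form under the inclusion of \<open>S\<close>.\<close>

definition incl_pullback ::
    "nat \<Rightarrow> (complex^'m) set \<Rightarrow> 'm::finite diff_form \<Rightarrow> complex^'m \<Rightarrow> 'm form" where
  "incl_pullback k S \<omega> p = restrict_form k (tangent_space S p) (\<omega> p)"

section \<open>Singular symplectic form-germs\<close>

text \<open>Germs at \<open>0\<close> are given by representatives; every notion below is invariant under changing the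
  representative away from a neighbourhood of \<open>0\<close>.\<close>

definition martinet :: "nat \<Rightarrow> 'm::finite diff_form \<Rightarrow> (complex^'m) set" where
  "martinet n \<omega> = {p. wedge_power (\<omega> p) n = (\<lambda>v. 0)}"

definition singular_symplectic_germ :: "nat \<Rightarrow> 'm::finite diff_form \<Rightarrow> bool" where
  "singular_symplectic_germ n \<omega> \<longleftrightarrow>
     (\<exists>U. open U \<and> 0 \<in> U \<and> analytic_diff_form_on 2 \<omega> U \<and>
        (\<forall>p\<in>U. ext_deriv 2 \<omega> p = (\<lambda>v. 0)) \<and>
        interior (closure (martinet n \<omega> \<inter> U)) = {})"

definition structurally_smooth :: "nat \<Rightarrow> 'm::finite diff_form \<Rightarrow> bool" where
  "structurally_smooth n \<omega> \<longleftrightarrow>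
     (\<exists>U \<Omega> f. open U \<and> 0 \<in> U \<and>
        analytic_diff_form_on (2 * n) \<Omega> U \<and> (\<forall>p\<in>U. \<Omega> p \<noteq> (\<lambda>v. 0)) \<and>
        f analytic_fun_on U \<and>
        (\<forall>p\<in>U. wedge_power (\<omega> p) n = (\<lambda>v. f p * \<Omega> p v)) \<and>
        f 0 = 0 \<and> frechet_derivative f (at 0) \<noteq> (\<lambda>v. 0))"

end

(* Moser's method relative to the hypersurface Sigma = {g = 0}. Join the two forms by
   omega_s = omega_0 + c(s) (omega_1 - omega_0), where c is a path in the complex plane from 0 to 1.
   Both forms have the same two-dimensional kernel K at 0, and since their n-th powers vanish only to
   first order, some derivative of omega_i restricted to K is nonzero; c avoids the discrete set of
   parameters for which omega_s would be more degenerate than omega_0. As omega_1 - omega_0 is closed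
   and vanishes on Sigma, the relative Poincare lemma gives omega_1 - omega_0 = d(g beta). The forms
   omega_s have a Pfaffian-like function that is divisible by g with invertible quotient, so Cramer's
   rule solves X_s _| omega_s = - c'(s) g beta by a holomorphic vector field. It vanishes at 0 because
   beta annihilates K there, and its time-one flow is the required germ. *)
theory Submission
  imports Defs
begin

text \<open>Along Sigma the determinant of omega_s vanishes to second order, while the right-hand
  side of Moser's equation carries only one factor g, so Cramer's rule for omega_s itself would
  leave a pole. The matrix is therefore bordered by xi_1 wedge xi_2, with xi_1, xi_2 dual to a basis
  of K. The border fills the kernel, the bordered matrix is invertible near 0, and the Pfaffian
  turns into the scalar 1 + xi_1(y_2), where y_2 is the preimage of xi_2; this has a computable
  derivative at 0. Divisibility by g requires each omega_s, not only the two ends, to degenerate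
  along Sigma. Where the Pfaffian is 0 the kernel is at least two-dimensional and meets the tangent
  hyperplane. So omega_0 and omega_1 both have kernel vectors tangent to Sigma, and as they agree on
  tangent vectors, a combination of these vectors lies in the kernel of omega_s. The quotient at 0
  is the derivative of omega_s on K in a direction transverse to Sigma. It is affine in c and can
  vanish between two nonzero end values, already on the real segment; hence the detour through
  complex c.\<close>

no_notation fps_nth (infixl "$" 75)

section \<open>Functions of several complex variables\<close>

text \<open>Only pointwise differentiability is recorded; on an open set it amounts to
  \<open>analytic_fun_on\<close>. Continuity and holomorphy of the derivative are consequences of
  Cauchy's formula, proved in \<open>hol_fder_cont\<close> and \<open>hol_fder\<close>.\<close>

definition cdiff :: "(complex^'m \<Rightarrow> complex) \<Rightarrow> complex^'m \<Rightarrow> bool" where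
  "cdiff f p \<longleftrightarrow> (\<exists>f'. (f has_derivative f') (at p) \<and> Vector_Spaces.linear (*s) (*) f')"

abbreviation fder :: "(complex^'m \<Rightarrow> complex) \<Rightarrow> complex^'m \<Rightarrow> complex^'m \<Rightarrow> complex" where
  "fder f p \<equiv> frechet_derivative f (at p)"

lemma vec_vs: "Vector_Spaces.vector_space ((*s) :: complex \<Rightarrow> complex^'m \<Rightarrow> complex^'m)"
  by (rule vec.vector_space_axioms)

lemma complex_vs: "Vector_Spaces.vector_space ((*) :: complex \<Rightarrow> complex \<Rightarrow> complex)"
  by unfold_locales (auto simp: algebra_simps)

lemma clinearI:
  fixes f :: "complex^'m \<Rightarrow> complex"
  assumes "\<And>x y. f (x + y) = f x + f y" "\<And>c x. f (c *s x) = c * f x"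
  shows "Vector_Spaces.linear (*s) (*) f"
  unfolding Vector_Spaces.linear_def module_hom_def module_hom_axioms_def
  using assms vec_vs complex_vs vec.module_axioms
  by (auto simp: module_def algebra_simps)

lemma clinear_add: "Vector_Spaces.linear (*s) (*) f \<Longrightarrow> f (x + y) = f x + f y"
  and clinear_scale: "Vector_Spaces.linear (*s) (*) f \<Longrightarrow> f (c *s x) = c * f x"
  for f :: "complex^'m \<Rightarrow> complex"
  unfolding Vector_Spaces.linear_def module_hom_def module_hom_axioms_def by auto

lemma clinear_0: "Vector_Spaces.linear (*s) (*) f \<Longrightarrow> f 0 = (0::complex)" for f :: "complex^'m \<Rightarrow> complex"
  using clinear_scale[of f 0 0] by simp

lemma clinear_sum: "Vector_Spaces.linear (*s) (*) f \<Longrightarrow> f (sum g A) = (\<Sum>i\<in>A. f (g i))"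
  for f :: "complex^'m \<Rightarrow> complex"
  by (induction A rule: infinite_finite_induct) (auto simp: clinear_0 clinear_add)

lemma vec_expand: "v = (\<Sum>i\<in>UNIV. v $ i *s axis i 1)" for v :: "complex^'m"
  by (vector axis_def) (auto simp: if_distrib cong: if_cong)

lemma clinear_expand: "Vector_Spaces.linear (*s) (*) f \<Longrightarrow> f v = (\<Sum>i\<in>UNIV. v $ i * f (axis i 1))"
  for f :: "complex^'m \<Rightarrow> complex"
  by (subst vec_expand[of v]) (simp add: clinear_sum clinear_scale)

lemma norm_cscale: "norm (c *s v) = cmod c * norm v" for v :: "complex^'m"
  by (simp add: norm_vec_def norm_mult L2_set_right_distrib)

lemma bounded_linear_cscale_left: "bounded_linear (\<lambda>z. z *s v)" for v :: "complex^'m"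
  by (rule bounded_linear_intro[where K = "norm v"])
     (auto simp: vec_eq_iff algebra_simps norm_cscale)

lemma continuous_on_cscale [continuous_intros]:
  "continuous_on S f \<Longrightarrow> continuous_on S g \<Longrightarrow> continuous_on S (\<lambda>x. f x *s (g x :: complex^'m))"
  unfolding vector_scalar_mult_def by (intro continuous_intros)

lemma cdiff_has_derivative: "cdiff f p \<Longrightarrow> (f has_derivative fder f p) (at p)"
  unfolding cdiff_def using frechet_derivative_at by metis

lemma cdiff_clinear: "cdiff f p \<Longrightarrow> Vector_Spaces.linear (*s) (*) (fder f p)"
  unfolding cdiff_def using frechet_derivative_at by metis

lemma cdiffI: "(f has_derivative f') (at p) \<Longrightarrow> Vector_Spaces.linear (*s) (*) f' \<Longrightarrow> cdiff f p"
  unfolding cdiff_def by blast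

lemma fder_eq: "(f has_derivative f') (at p) \<Longrightarrow> fder f p = f'"
  using frechet_derivative_at by metis

lemma cdiff_isCont: "cdiff f p \<Longrightarrow> isCont f p"
  using cdiff_has_derivative has_derivative_continuous by blast

text \<open>The slice along a complex line is a one-variable function with a complex derivative.
  Through it the one-variable Cauchy theory becomes available in every direction.\<close>

lemma slice_derivative:
  assumes "cdiff f (p + z *s v)"
  shows "((\<lambda>z. f (p + z *s v)) has_field_derivative fder f (p + z *s v) v) (at z)"
proof -
  have "((\<lambda>z. p + z *s v) has_derivative (\<lambda>h. h *s v)) (at z)"
    by (auto intro!: derivative_eq_intros bounded_linear_imp_has_derivative bounded_linear_cscale_left)
  then have "((\<lambda>z. f (p + z *s v)) has_derivative (\<lambda>h. fder f (p + z *s v) (h *s v))) (at z)"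
    using has_derivative_compose[of "\<lambda>z. p + z *s v"] cdiff_has_derivative[OF assms] by blast
  moreover have "(\<lambda>h. fder f (p + z *s v) (h *s v)) = (*) (fder f (p + z *s v) v)"
    using clinear_scale[OF cdiff_clinear[OF assms]] by (auto simp: mult.commute)
  ultimately show ?thesis by (simp add: has_field_derivative_def)
qed

text \<open>Cauchy's formula for the derivative at 0 of the slice, on the circle z = r exp(2 pi i
  theta): the factor dz = 2 pi i z dtheta cancels the constant and one of the two powers of z. A
  derivative becomes an integral of values of \<open>f\<close>, so it inherits continuity, parameter
  dependence and limits from \<open>f\<close>.\<close>

lemma cauchy_fder:
  assumes cd: "\<And>z. cmod z \<le> r \<Longrightarrow> cdiff f (p + z *s v)" and "0 < r"
  shows "((\<lambda>\<theta>. f (p + (of_real r * exp (2 * of_real pi * \<i> * of_real \<theta>)) *s v)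
     / (of_real r * exp (2 * of_real pi * \<i> * of_real \<theta>))) has_integral fder f p v) {0..1}"
proof -
  let ?g = "\<lambda>z. f (p + z *s v)"
  have d: "(?g has_field_derivative fder f (p + z *s v) v) (at z)" if "z \<in> cball 0 r" for z
    using slice_derivative[OF cd[of z]] that by simp
  have c: "continuous_on (cball 0 r) ?g"
    using d by (meson DERIV_isCont continuous_at_imp_continuous_on)
  have h: "?g holomorphic_on ball 0 r"
    by (rule holomorphic_onI, rule field_differentiable_at_within, unfold field_differentiable_def)
       (rule exI, rule d, simp)
  note C = Cauchy_derivative_integral_circlepath[OF c h, of 0]
  have eq: "fder f p v = 1 / (2 * of_real pi * \<i>) * contour_integral (circlepath 0 r) (\<lambda>u. ?g u / (u - 0)\<^sup>2)"
    using C(2) d[of 0] assms(2) DERIV_unique by fastforce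
  have "((\<lambda>u. ?g u / (u - 0)\<^sup>2) has_contour_integral (2 * of_real pi * \<i> * fder f p v)) (circlepath 0 r)"
    using has_contour_integral_integral[OF C(1)] assms(2) eq by (auto simp: )
  then have "((\<lambda>x. (?g (circlepath 0 r x) / (circlepath 0 r x)\<^sup>2) * (2 * pi * \<i> * r * exp (2 * of_real pi * \<i> * x)))
       has_integral (2 * of_real pi * \<i> * fder f p v)) {0..1}"
    unfolding has_contour_integral_def
    by (rule has_integral_eq[rotated]) (simp add: vector_derivative_circlepath01)
  then have "((\<lambda>x. (1 / (2 * of_real pi * \<i>)) * ((?g (circlepath 0 r x) / (circlepath 0 r x)\<^sup>2) * (2 * pi * \<i> * r * exp (2 * of_real pi * \<i> * x))))
       has_integral ((1 / (2 * of_real pi * \<i>)) * (2 * of_real pi * \<i> * fder f p v))) {0..1}"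
    by (rule has_integral_mult_right)
  then show ?thesis
    using assms(2) by (simp add: circlepath power2_eq_square)
qed

text \<open>The remainder is controlled by a bound for \<open>f\<close> alone, with no reference to
  its derivatives. This uniformity is what lets derivatives pass through integrals
  (\<open>hol_integral\<close>) and limits (\<open>hol_uniform_limit\<close>).\<close>

lemma taylor_estimate:
  assumes cd: "\<And>q. q \<in> ball p r \<Longrightarrow> cdiff f q" and M: "\<And>q. q \<in> ball p r \<Longrightarrow> cmod (f q) \<le> M"
    and r: "0 < r" and w: "norm w < r / 4"
  shows "cmod (f (p + w) - f p - fder f p w) \<le> 32 * M / r\<^sup>2 * (norm w)\<^sup>2"
proof (cases "w = 0")
  case True
  then show ?thesis using clinear_0[OF cdiff_clinear[OF cd[of p]]] r by simp
next
  case False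
  define v where "v = of_real (1 / norm w) *s w"
  have nv: "norm v = 1" using False by (simp add: v_def norm_cscale norm_divide)
  have wv: "w = of_real (norm w) *s v" using False by (simp add: v_def)
  let ?g = "\<lambda>z. f (p + z *s v)"
  have inb: "p + z *s v \<in> ball p r" if "z \<in> ball 0 r" for z
    using that nv by (simp add: dist_norm norm_cscale)
  have d: "(?g has_field_derivative fder f (p + z *s v) v) (at z)" if "z \<in> ball 0 r" for z
    using slice_derivative[OF cd[OF inb[OF that]]] .
  have h: "?g holomorphic_on ball 0 r"
    by (rule holomorphic_onI, rule field_differentiable_at_within, unfold field_differentiable_def)
       (rule exI, rule d, simp)
  have hk: "(deriv ^^ k) ?g holomorphic_on ball 0 r" for k
    using h by (intro holomorphic_higher_deriv) auto
  \<comment> \<open>Circles of radius r/4 about points of the half-size disc stay in the domain;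
    Cauchy's inequality gives 2! M / (r/4)^2, whence the constant 32.\<close>
  have B: "cmod ((deriv ^^ 2) ?g x) \<le> 32 * M / r\<^sup>2" if x: "x \<in> ball 0 (r/2)" for x
  proof -
    have sub: "cball x (r/4) \<subseteq> ball 0 r"
      using x r by (auto simp: dist_norm) (smt (verit) norm_triangle_ineq2 norm_minus_commute)
    have "cmod ((deriv ^^ 2) ?g x) \<le> fact 2 * M / (r/4)^2"
    proof (rule Cauchy_inequality)
      show "?g holomorphic_on ball x (r/4)" using h sub holomorphic_on_subset ball_subset_cball by meson
      show "continuous_on (cball x (r/4)) ?g"
        using holomorphic_on_imp_continuous_on[OF h] sub continuous_on_subset by blast
      show "0 < r / 4" using r by simp
      fix y assume "cmod (x - y) = r / 4"
      then have "y \<in> ball 0 r" using sub by (auto simp: dist_norm)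
      then show "cmod (?g y) \<le> M" using M inb by blast
    qed
    then show ?thesis by (simp add: power2_eq_square field_simps)
  qed
  have "cmod ((deriv ^^ 0) ?g (norm w) - (\<Sum>i\<le>1. (deriv ^^ i) ?g 0 * (of_real (norm w) - 0) ^ i / (fact i)))
     \<le> 32 * M / r\<^sup>2 * cmod (of_real (norm w) - 0)^(Suc 1) / fact 1"
  proof (rule complex_Taylor[where S = "ball 0 (r/2)" and f = "\<lambda>i. (deriv ^^ i) ?g"])
    fix i x assume "x \<in> ball (0::complex) (r / 2)"
    then have "x \<in> ball 0 r" using r by auto
    then show "((deriv ^^ i) ?g has_field_derivative (deriv ^^ Suc i) ?g x) (at x within ball 0 (r/2))"
      using has_field_derivative_at_within[OF holomorphic_derivI[OF hk open_ball]] by simp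
  next
    fix x assume "x \<in> ball (0::complex) (r / 2)"
    then show "cmod ((deriv ^^ Suc 1) ?g x) \<le> 32 * M / r\<^sup>2" using B by (simp add: numeral_2_eq_2)
  qed (use w r in auto)
  moreover have "deriv ?g 0 = fder f p v"
    using DERIV_imp_deriv[OF d[of 0]] r by simp
  moreover have "fder f p w = of_real (norm w) * fder f p v"
    using clinear_scale[OF cdiff_clinear[OF cd[of p]]] r by (subst wv) simp
  ultimately show ?thesis
    using wv by (simp add: power2_eq_square mult.commute algebra_simps)
qed

lemma has_derivative_quadratic:
  fixes f :: "'a::euclidean_space \<Rightarrow> 'b::real_normed_vector"
  assumes "bounded_linear L" "0 < r" "\<And>w. norm w < r \<Longrightarrow> norm (f (p + w) - f p - L w) \<le> C * (norm w)\<^sup>2"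
  shows "(f has_derivative L) (at p)"
  unfolding has_derivative_at
proof (intro conjI assms)
  have "((\<lambda>h. C * norm h) \<longlongrightarrow> 0) (at (0::'a))"
    by (intro tendsto_mult_right_zero tendsto_norm_zero tendsto_ident_at)
  moreover have "\<forall>\<^sub>F h in at 0. norm (norm (f (p + h) - f p - L h) / norm h) \<le> C * norm h"
  proof -
    have "\<forall>\<^sub>F h in at (0::'a). norm h < r"
      using assms(2) by (auto simp: eventually_at intro!: exI[of _ r])
    moreover have "\<forall>\<^sub>F h in at (0::'a). h \<noteq> 0" by (simp add: eventually_at_filter)
    ultimately show ?thesis
    proof eventually_elim
      case (elim h)
      then show ?case using assms(3)[of h] by (simp add: divide_simps power2_eq_square mult.assoc)
    qed
  qed
  ultimately show "((\<lambda>h. norm (f (p + h) - f p - L h) / norm h) \<longlongrightarrow> 0) (at 0)"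
    by (rule Lim_null_comparison[rotated])
qed

lemma has_derivative_vec_comp:
  fixes G :: "'a::real_normed_vector \<Rightarrow> complex^'m"
  assumes "\<And>i. ((\<lambda>p. G p $ i) has_derivative G' i) F"
  shows "(G has_derivative (\<lambda>v. \<chi> i. G' i v)) F"
proof -
  have *: "(\<lambda>p. G p) = (\<lambda>p. \<Sum>i\<in>UNIV. (G p $ i) *s axis i 1)" by (rule ext, rule vec_expand)
  have **: "(\<lambda>v. \<chi> i. G' i v) = (\<lambda>v. \<Sum>i\<in>UNIV. G' i v *s axis i 1)"
    by (rule ext, subst vec_expand) simp
  show ?thesis unfolding ** by (subst *)
     (intro has_derivative_sum bounded_linear.has_derivative[OF bounded_linear_cscale_left] assms)
qed

lemma has_derivative_vec_nth:
  fixes G :: "'a::real_normed_vector \<Rightarrow> complex^'m"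
  shows "(G has_derivative G') F \<Longrightarrow> ((\<lambda>p. G p $ i) has_derivative (\<lambda>v. G' v $ i)) F"
  by (rule bounded_linear.has_derivative[OF bounded_linear_vec_nth])

section \<open>Differentiation rules for \<open>cdiff\<close> and \<open>fder\<close>\<close>

lemma cdiff_fder_const: "cdiff (\<lambda>p. c) p" "fder (\<lambda>p. c) p = (\<lambda>v. 0)"
  by (auto intro!: cdiffI[where f' = "\<lambda>v. 0"] clinearI)

lemma cdiff_fder_nth:
  fixes p :: "complex^'m"
  shows "cdiff (\<lambda>p. p $ i) p" "fder (\<lambda>p. p $ i) p = (\<lambda>v. v $ i)"
proof -
  have "((\<lambda>p. p $ i) has_derivative (\<lambda>v. v $ i)) (at p)"
    by (rule has_derivative_vec_nth[OF has_derivative_ident])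
  then show "cdiff (\<lambda>p. p $ i) p" "fder (\<lambda>p. p $ i) p = (\<lambda>v. v $ i)"
    by (auto intro!: cdiffI[where f' = "\<lambda>v. v $ i"] clinearI fder_eq)
qed

lemma cdiff_fder_add:
  assumes "cdiff f p" "cdiff g p"
  shows "cdiff (\<lambda>p. f p + g p) p" "fder (\<lambda>p. f p + g p) p = (\<lambda>v. fder f p v + fder g p v)"
proof -
  have "((\<lambda>p. f p + g p) has_derivative (\<lambda>v. fder f p v + fder g p v)) (at p)"
    by (intro has_derivative_add cdiff_has_derivative assms)
  then show "cdiff (\<lambda>p. f p + g p) p" "fder (\<lambda>p. f p + g p) p = (\<lambda>v. fder f p v + fder g p v)"
    by (auto intro!: cdiffI[where f' = "\<lambda>v. fder f p v + fder g p v"] clinearI fder_eq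
       simp: assms[THEN cdiff_clinear, THEN clinear_add] assms[THEN cdiff_clinear, THEN clinear_scale] algebra_simps)
qed

lemma cdiff_fder_mult:
  assumes "cdiff f p" "cdiff g p"
  shows "cdiff (\<lambda>p. f p * g p) p" "fder (\<lambda>p. f p * g p) p = (\<lambda>v. f p * fder g p v + fder f p v * g p)"
proof -
  have "((\<lambda>p. f p * g p) has_derivative (\<lambda>v. f p * fder g p v + fder f p v * g p)) (at p)"
    by (intro has_derivative_mult cdiff_has_derivative assms)
  then show "cdiff (\<lambda>p. f p * g p) p" "fder (\<lambda>p. f p * g p) p = (\<lambda>v. f p * fder g p v + fder f p v * g p)"
    by (auto intro!: cdiffI[where f' = "\<lambda>v. f p * fder g p v + fder f p v * g p"] clinearI fder_eq
       simp: assms[THEN cdiff_clinear, THEN clinear_add] assms[THEN cdiff_clinear, THEN clinear_scale] algebra_simps)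
qed

lemma cdiff_fder_minus:
  assumes "cdiff f p"
  shows "cdiff (\<lambda>p. - f p) p" "fder (\<lambda>p. - f p) p = (\<lambda>v. - fder f p v)"
  using cdiff_fder_mult[OF cdiff_fder_const(1)[of "-1"] assms] by (auto simp: cdiff_fder_const)

lemma cdiff_fder_diff:
  assumes "cdiff f p" "cdiff g p"
  shows "cdiff (\<lambda>p. f p - g p) p" "fder (\<lambda>p. f p - g p) p = (\<lambda>v. fder f p v - fder g p v)"
  using cdiff_fder_add[OF assms(1) cdiff_fder_minus(1)[OF assms(2)]] cdiff_fder_minus(2)[OF assms(2)] by auto

lemma cdiff_fder_sum:
  assumes "\<And>i. i \<in> I \<Longrightarrow> cdiff (f i) p"
  shows "cdiff (\<lambda>p. \<Sum>i\<in>I. f i p) p \<and> fder (\<lambda>p. \<Sum>i\<in>I. f i p) p = (\<lambda>v. \<Sum>i\<in>I. fder (f i) p v)"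
  using assms
proof (induction I rule: infinite_finite_induct)
  case (insert x F)
  then show ?case using cdiff_fder_add[of "f x" p "\<lambda>p. \<Sum>i\<in>F. f i p"] by simp
qed (simp_all add: cdiff_fder_const)

lemma cdiff_inverse:
  assumes "cdiff f p" "f p \<noteq> 0"
  shows "cdiff (\<lambda>p. inverse (f p)) p"
proof -
  have "((\<lambda>p. inverse (f p)) has_derivative (\<lambda>v. - (inverse (f p) * fder f p v * inverse (f p)))) (at p)"
    by (rule Deriv.has_derivative_inverse[OF assms(2) cdiff_has_derivative[OF assms(1)]])
  then show ?thesis
    by (auto intro!: cdiffI[where f' = "\<lambda>v. - (inverse (f p) * fder f p v * inverse (f p))"] clinearI
       simp: clinear_add[OF cdiff_clinear[OF assms(1)]] clinear_scale[OF cdiff_clinear[OF assms(1)]] algebra_simps)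
qed

lemma cdiff_fder_compose:
  fixes G :: "complex^'m \<Rightarrow> complex^'k"
  assumes f: "cdiff f (G p)" and G: "\<And>i. cdiff (\<lambda>p. G p $ i) p"
  shows "cdiff (\<lambda>p. f (G p)) p" "fder (\<lambda>p. f (G p)) p = (\<lambda>v. fder f (G p) (\<chi> i. fder (\<lambda>p. G p $ i) p v))"
proof -
  let ?L = "\<lambda>v. fder f (G p) (\<chi> i. fder (\<lambda>p. G p $ i) p v)"
  have "(G has_derivative (\<lambda>v. \<chi> i. fder (\<lambda>p. G p $ i) p v)) (at p)"
    by (intro has_derivative_vec_comp cdiff_has_derivative G)
  then have *: "((\<lambda>p. f (G p)) has_derivative ?L) (at p)"
    using has_derivative_compose cdiff_has_derivative[OF f] by blast
  have 1: "(\<chi> i. fder (\<lambda>p. G p $ i) p (x + y)) = (\<chi> i. fder (\<lambda>p. G p $ i) p x) + (\<chi> i. fder (\<lambda>p. G p $ i) p y)" for x y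
    by (simp add: vec_eq_iff clinear_add[OF cdiff_clinear[OF G]])
  have 2: "(\<chi> i. fder (\<lambda>p. G p $ i) p (c *s x)) = c *s (\<chi> i. fder (\<lambda>p. G p $ i) p x)" for c x
    by (simp add: vec_eq_iff clinear_scale[OF cdiff_clinear[OF G]])
  have "Vector_Spaces.linear (*s) (*) ?L"
    by (rule clinearI)
       (simp_all only: 1 2 clinear_add[OF cdiff_clinear[OF f]] clinear_scale[OF cdiff_clinear[OF f]])
  with * show "cdiff (\<lambda>p. f (G p)) p" "fder (\<lambda>p. f (G p)) p = ?L"
    by (auto intro!: cdiffI fder_eq)
qed

lemma analytic_fun_on_open: "open U \<Longrightarrow> f analytic_fun_on U \<longleftrightarrow> (\<forall>p\<in>U. cdiff f p)"
  unfolding analytic_fun_on_def cdiff_def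
  by (meson centre_in_ball openE subsetD)

section \<open>Holomorphic families depending continuously on a parameter\<close>

lemma continuous_on_Pair1 [continuous_intros]: "continuous_on S (Pair t)"
  using continuous_on_Pair[OF continuous_on_const continuous_on_id, of S t] by simp

text \<open>Parameters range over an arbitrary topological space, with joint continuity only: this covers
  at once single functions, time-dependent ones, and integrands.\<close>

definition hol :: "'t::t2_space set \<Rightarrow> (complex^'m) set \<Rightarrow> ('t \<Rightarrow> complex^'m \<Rightarrow> complex) \<Rightarrow> bool" where
  "hol T U u \<longleftrightarrow> continuous_on (T \<times> U) (\<lambda>x. u (fst x) (snd x)) \<and> (\<forall>t\<in>T. \<forall>p\<in>U. cdiff (u t) p)"

lemma hol_cdiff: "hol T U u \<Longrightarrow> t \<in> T \<Longrightarrow> p \<in> U \<Longrightarrow> cdiff (u t) p"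
  and hol_cont: "hol T U u \<Longrightarrow> continuous_on (T \<times> U) (\<lambda>x. u (fst x) (snd x))"
  by (auto simp: hol_def)

lemma hol_cont2:
  assumes "hol T U u" "continuous_on S f" "continuous_on S g" "\<And>x. x \<in> S \<Longrightarrow> f x \<in> T \<and> g x \<in> U"
  shows "continuous_on S (\<lambda>x. u (f x) (g x))"
proof -
  have "continuous_on S (\<lambda>x. (\<lambda>x. u (fst x) (snd x)) (f x, g x))"
    by (rule continuous_on_compose2[OF hol_cont[OF assms(1)]]) (use assms in \<open>auto intro!: continuous_intros\<close>)
  then show ?thesis by simp
qed

lemma hol_subset: "hol T U u \<Longrightarrow> T' \<subseteq> T \<Longrightarrow> U' \<subseteq> U \<Longrightarrow> hol T' U' u"
  unfolding hol_def by (meson Sigma_mono continuous_on_subset subset_iff)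

lemma hol_indep: "(\<And>p. p \<in> U \<Longrightarrow> cdiff f p) \<Longrightarrow> hol T U (\<lambda>t. f)"
  unfolding hol_def
  by (auto intro!: continuous_on_compose2[OF continuous_at_imp_continuous_on, of U f _ snd] cdiff_isCont continuous_intros)

lemma hol_param: "continuous_on T c \<Longrightarrow> hol T U (\<lambda>t p. c t)"
  unfolding hol_def
  by (auto intro!: continuous_on_compose2[of T c _ fst] continuous_intros cdiff_fder_const)

lemma hol_const: "hol T U (\<lambda>t p. c)"
  by (intro hol_param continuous_intros)

lemma hol_nth: "hol T U (\<lambda>t p :: complex^'m. p $ i)"
  by (intro hol_indep cdiff_fder_nth)

lemma hol_add: "hol T U u \<Longrightarrow> hol T U v \<Longrightarrow> hol T U (\<lambda>t p. u t p + v t p)"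
  unfolding hol_def by (auto intro!: continuous_intros cdiff_fder_add)

lemma hol_diff: "hol T U u \<Longrightarrow> hol T U v \<Longrightarrow> hol T U (\<lambda>t p. u t p - v t p)"
  unfolding hol_def by (auto intro!: continuous_intros cdiff_fder_diff)

lemma hol_minus: "hol T U u \<Longrightarrow> hol T U (\<lambda>t p. - u t p)"
  unfolding hol_def by (auto intro!: continuous_intros cdiff_fder_minus)

lemma hol_mult: "hol T U u \<Longrightarrow> hol T U v \<Longrightarrow> hol T U (\<lambda>t p. u t p * v t p)"
  unfolding hol_def by (auto intro!: continuous_intros cdiff_fder_mult)

lemma hol_inverse: "hol T U u \<Longrightarrow> (\<And>t p. t \<in> T \<Longrightarrow> p \<in> U \<Longrightarrow> u t p \<noteq> 0) \<Longrightarrow> hol T U (\<lambda>t p. inverse (u t p))"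
  unfolding hol_def by (auto intro!: continuous_intros cdiff_inverse)

lemma hol_divide: "hol T U u \<Longrightarrow> hol T U v \<Longrightarrow> (\<And>t p. t \<in> T \<Longrightarrow> p \<in> U \<Longrightarrow> v t p \<noteq> 0) \<Longrightarrow> hol T U (\<lambda>t p. u t p / v t p)"
  unfolding divide_inverse by (intro hol_mult hol_inverse)

lemma hol_sum: "(\<And>i. i \<in> I \<Longrightarrow> hol T U (u i)) \<Longrightarrow> hol T U (\<lambda>t p. \<Sum>i\<in>I. u i t p)"
  by (induction I rule: infinite_finite_induct) (auto intro: hol_const hol_add)

lemma hol_prod: "(\<And>i. i \<in> I \<Longrightarrow> hol T U (u i)) \<Longrightarrow> hol T U (\<lambda>t p. \<Prod>i\<in>I. u i t p)"
  by (induction I rule: infinite_finite_induct) (auto intro: hol_const hol_mult)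

lemmas hol_intros = hol_const hol_nth hol_add hol_diff hol_minus hol_mult hol_sum hol_prod

lemma hol_compose:
  fixes G :: "'t::t2_space \<Rightarrow> complex^'m \<Rightarrow> complex^'k"
  assumes u: "hol T' U' u" and \<phi>: "continuous_on T \<phi>" "\<And>t. t \<in> T \<Longrightarrow> \<phi> t \<in> T'"
    and G: "\<And>i. hol T U (\<lambda>t p. G t p $ i)" "\<And>t p. t \<in> T \<Longrightarrow> p \<in> U \<Longrightarrow> G t p \<in> U'"
  shows "hol T U (\<lambda>t p. u (\<phi> t) (G t p))"
  unfolding hol_def
proof (intro conjI ballI)
  have "continuous_on (T \<times> U) (\<lambda>x. \<chi> i. G (fst x) (snd x) $ i)"
    by (intro continuous_on_vec_lambda hol_cont G)
  then have "continuous_on (T \<times> U) (\<lambda>x. G (fst x) (snd x))" by simp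
  moreover have "continuous_on (T \<times> U) (\<lambda>x. \<phi> (fst x))"
    by (rule continuous_on_compose2[OF \<phi>(1)]) (auto intro!: continuous_intros)
  ultimately show "continuous_on (T \<times> U) (\<lambda>x. u (\<phi> (fst x)) (G (fst x) (snd x)))"
    using assms by (intro hol_cont2[OF u]) auto
next
  fix t p assume "t \<in> T" "p \<in> U"
  then show "cdiff (\<lambda>p. u (\<phi> t) (G t p)) p"
    by (intro cdiff_fder_compose(1)[OF hol_cdiff[OF u \<phi>(2) G(2)] hol_cdiff[OF G(1)]])
qed

text \<open>Localisation takes place in the second factor alone: the circles in Cauchy's formula
  have a radius chosen near each point of \<open>U\<close>, uniformly over all of
  \<open>T\<close>.\<close>

lemma hol_cont_local:
  fixes T :: "'t::t2_space set" and U :: "(complex^'m) set" and f :: "'t \<times> (complex^'m) \<Rightarrow> complex"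
  assumes "\<And>p0. p0 \<in> U \<Longrightarrow> \<exists>V. open V \<and> p0 \<in> V \<and> continuous_on (T \<times> (V \<inter> U)) f"
  shows "continuous_on (T \<times> U) f"
  unfolding continuous_on_eq_continuous_within
proof
  fix x assume x: "x \<in> T \<times> U"
  then obtain V where V: "open V" "snd x \<in> V" "continuous_on (T \<times> (V \<inter> U)) f" using assms by force
  have xi: "x \<in> T \<times> (V \<inter> U)" using V x by (simp add: mem_Times_iff)
  have *: "at x within T \<times> U = at x within T \<times> (V \<inter> U)"
    by (rule at_within_nhd[of x "UNIV \<times> V"]) (use V x in \<open>auto intro: open_Times simp: mem_Times_iff\<close>)
  show "continuous (at x within T \<times> U) f"
    unfolding * by (rule bspec[OF V(3)[unfolded continuous_on_eq_continuous_within] xi])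
qed

text \<open>Near each point the derivative is a Cauchy integral over a circle of fixed radius, and
  the integral of a jointly continuous integrand is continuous in its parameters.\<close>

lemma hol_fder_cont:
  assumes U: "open U" and u: "hol T U u"
  shows "continuous_on (T \<times> U) (\<lambda>x. fder (u (fst x)) (snd x) v)"
proof (rule hol_cont_local)
  fix p0 assume "p0 \<in> U"
  then obtain e where e: "e > 0" "ball p0 (2 * e) \<subseteq> U"
    using U open_contains_ball by (metis field_sum_of_halves half_gt_zero mult_2)
  \<comment> \<open>Discs of this radius in direction \<open>v\<close> have extent at most
    \<open>e\<close>; the summand 1 covers v = 0.\<close>
  define r where "r = e / (norm v + 1)"
  have pos: "norm v + 1 > 0" using norm_ge_zero[of v] by linarith
  have r: "r > 0" using e pos by (simp add: r_def)
  have rv: "r * norm v \<le> e" using e pos by (simp add: r_def divide_simps)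
  have inU: "p + z *s v \<in> U" if "p \<in> ball p0 e" "cmod z \<le> r" for p z
  proof -
    have "cmod z * norm v \<le> r * norm v" using that by (intro mult_right_mono) auto
    then have "norm (z *s v) \<le> e" using rv by (simp add: norm_cscale)
    then have "dist p0 (p + z *s v) < 2 * e"
      using that norm_triangle_ineq4[of "p0 - p" "z *s v"] by (simp add: dist_norm algebra_simps)
    then show ?thesis using e by auto
  qed
  let ?\<epsilon> = "\<lambda>\<theta>::real. of_real r * exp (2 * of_real pi * \<i> * of_real \<theta>) :: complex"
  let ?I = "\<lambda>x \<theta>. u (fst x) (snd x + ?\<epsilon> \<theta> *s v) / ?\<epsilon> \<theta>"
  have c\<epsilon>: "cmod (?\<epsilon> \<theta>) = r" for \<theta> using r by (simp add: norm_mult norm_exp_eq_Re)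
  have "continuous_on ((T \<times> ball p0 e) \<times> cbox 0 1) (\<lambda>(x, \<theta>). ?I x \<theta>)"
    unfolding split_def
  proof (rule continuous_on_divide)
    show "continuous_on ((T \<times> ball p0 e) \<times> cbox 0 1) (\<lambda>x. u (fst (fst x)) (snd (fst x) + ?\<epsilon> (snd x) *s v))"
      by (rule hol_cont2[OF u]) (auto intro!: continuous_intros inU simp: c\<epsilon>)
  qed (use r in \<open>auto intro!: continuous_intros\<close>)
  then have "continuous_on (T \<times> ball p0 e) (\<lambda>x. integral (cbox 0 1) (?I x))"
    by (rule integral_continuous_on_param)
  moreover have "integral (cbox 0 1) (?I x) = fder (u (fst x)) (snd x) v" if "x \<in> T \<times> ball p0 e" for x
    using that r
    by (auto intro!: integral_unique cauchy_fder hol_cdiff[OF u] inU simp: box_real)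
  ultimately have "continuous_on (T \<times> ball p0 e) (\<lambda>x. fder (u (fst x)) (snd x) v)"
    by (rule continuous_on_eq)
  then show "\<exists>V. open V \<and> p0 \<in> V \<and> continuous_on (T \<times> (V \<inter> U)) (\<lambda>x. fder (u (fst x)) (snd x) v)"
    using e by (intro exI[of _ "ball p0 e"]) (auto intro: continuous_on_subset)
qed

lemma clinear_imp_bounded_linear:
  fixes f :: "complex^'m \<Rightarrow> complex"
  assumes "Vector_Spaces.linear (*s) (*) f" shows "bounded_linear f"
proof -
  have "f (r *\<^sub>R x) = r *\<^sub>R f x" for r x
  proof -
    have "r *\<^sub>R x = complex_of_real r *s x" by (simp add: vec_eq_iff complex_eq_iff)
    then show ?thesis using clinear_scale[OF assms] by (simp add: scaleR_conv_of_real)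
  qed
  then have "linear f" using clinear_add[OF assms] by (intro linearI) auto
  then show ?thesis by (simp add: linear_conv_bounded_linear)
qed

text \<open>Differentiation under the integral sign by integrating Taylor's formula: on a compact
  product the integrand has one bound \<open>M\<close>, so the remainder is O(|w|^2) uniformly in
  the integration variable. The extra parameter \<open>t\<close> makes the result applicable to
  Picard iterates, where time is the parameter.\<close>

lemma hol_integral:
  fixes u :: "'t::t2_space \<Rightarrow> real \<Rightarrow> complex^'m \<Rightarrow> complex"
  assumes U: "open U" and u: "hol (T \<times> {0..1}) U (\<lambda>x. u (fst x) (snd x))"
  shows "hol T U (\<lambda>t p. integral {0..1} (\<lambda>\<theta>. u t \<theta> p))"
    and "\<And>t p v. t \<in> T \<Longrightarrow> p \<in> U \<Longrightarrow>
      fder (\<lambda>p. integral {0..1} (\<lambda>\<theta>. u t \<theta> p)) p v = integral {0..1} (\<lambda>\<theta>. fder (u t \<theta>) p v)"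
proof -
  have ci: "continuous_on {0..1} (\<lambda>\<theta>. u t \<theta> p)" if "t \<in> T" "p \<in> U" for t p
    using that hol_cont2[OF u, of "{0..1}" "\<lambda>\<theta>. (t, \<theta>)" "\<lambda>_. p"] by (auto intro!: continuous_intros)
  have cd: "continuous_on {0..1} (\<lambda>\<theta>. fder (u t \<theta>) p v)" if "t \<in> T" "p \<in> U" for t p v
  proof -
    have "continuous_on {0..1} (\<lambda>\<theta>. (\<lambda>x. fder (u (fst (fst x)) (snd (fst x))) (snd x) v) ((t, \<theta>), p))"
      by (rule continuous_on_compose2[OF hol_fder_cont[OF U u]]) (use that in \<open>auto intro!: continuous_intros\<close>)
    then show ?thesis by simp
  qed
  define L where "L t p v = integral {0..1} (\<lambda>\<theta>. fder (u t \<theta>) p v)" for t p v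
  have lin: "Vector_Spaces.linear (*s) (*) (L t p)" if tp: "t \<in> T" "p \<in> U" for t p
  proof -
    have l: "Vector_Spaces.linear (*s) (*) (fder (u t \<theta>) p)" if "\<theta> \<in> {0..1}" for \<theta>
      using cdiff_clinear[OF hol_cdiff[OF u, of "(t, \<theta>)" p]] tp that by auto
    have a: "L t p (x + y) = L t p x + L t p y" for x y
      unfolding L_def
      by (subst integral_add[symmetric]) (auto intro!: integrable_continuous_interval cd tp integral_cong clinear_add l)
    have b: "L t p (c *s x) = c * L t p x" for c x
      unfolding L_def
      by (subst integral_mult_right[symmetric]) (rule integral_cong, rule clinear_scale[OF l])
    show ?thesis by (rule clinearI[OF a b])
  qed
  have der: "((\<lambda>p. integral {0..1} (\<lambda>\<theta>. u t \<theta> p)) has_derivative L t p) (at p)" if tp: "t \<in> T" "p \<in> U" for t p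
  proof -
    obtain e where e: "e > 0" "cball p e \<subseteq> U"
      using U tp open_contains_cball by blast
    have "continuous_on (({t} \<times> {0..1}) \<times> cball p e) (\<lambda>x. u (fst (fst x)) (snd (fst x)) (snd x))"
      by (rule continuous_on_subset[OF hol_cont[OF u]]) (use e tp in auto)
    then have "compact ((\<lambda>x. u (fst (fst x)) (snd (fst x)) (snd x)) ` (({t} \<times> {0..1}) \<times> cball p e))"
      by (intro compact_continuous_image compact_Times) auto
    then obtain M where M: "\<forall>y \<in> (\<lambda>x. u (fst (fst x)) (snd (fst x)) (snd x)) ` (({t} \<times> {0..1}) \<times> cball p e). cmod y \<le> M"
      by (rule exE[OF bounded_iff[THEN iffD1, OF compact_imp_bounded]])
    have M: "cmod (u t \<theta> q) \<le> M" if "\<theta> \<in> {0..1}" "q \<in> cball p e" for \<theta> q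
      using that by (intro bspec[OF M] image_eqI[of _ _ "((t, \<theta>), q)"]) auto
    show ?thesis
    proof (rule has_derivative_quadratic)
      show "bounded_linear (L t p)" using lin tp clinear_imp_bounded_linear by blast
      show "0 < e / 4" using e by simp
      fix w :: "complex^'m" assume w: "norm w < e / 4"
      then have pw: "p + w \<in> U" using e by (auto simp: dist_norm subset_iff)
      have "integral {0..1} (\<lambda>\<theta>. u t \<theta> (p + w)) - integral {0..1} (\<lambda>\<theta>. u t \<theta> p) - L t p w
        = integral {0..1} (\<lambda>\<theta>. u t \<theta> (p + w) - u t \<theta> p - fder (u t \<theta>) p w)"
        unfolding L_def using tp pw
        by (subst integral_diff integral_diff, auto intro!: integrable_continuous_interval ci cd continuous_intros)+
      moreover have "norm (integral {0..1} (\<lambda>\<theta>. u t \<theta> (p + w) - u t \<theta> p - fder (u t \<theta>) p w))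
         \<le> 32 * M / e\<^sup>2 * (norm w)\<^sup>2 * (1 - 0)"
      proof (rule integral_bound)
        fix \<theta> :: real assume "\<theta> \<in> {0..1}"
        then show "norm (u t \<theta> (p + w) - u t \<theta> p - fder (u t \<theta>) p w) \<le> 32 * M / e\<^sup>2 * (norm w)\<^sup>2"
          using tp e w M hol_cdiff[OF u, of "(t,\<theta>)"] by (intro taylor_estimate) (auto simp: subset_iff)
      qed (use tp pw in \<open>auto intro!: ci cd continuous_intros\<close>)
      ultimately show "norm (integral {0..1} (\<lambda>\<theta>. u t \<theta> (p + w)) - integral {0..1} (\<lambda>\<theta>. u t \<theta> p) - L t p w)
          \<le> 32 * M / e\<^sup>2 * (norm w)\<^sup>2"
        by simp
    qed
  qed
  have "continuous_on ((T \<times> U) \<times> cbox 0 1) (\<lambda>x. (\<lambda>x. u (fst x) (snd x)) (fst (fst x), snd x) (snd (fst x)))"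
    by (rule hol_cont2[OF u]) (auto intro!: continuous_intros simp: box_real)
  then have "continuous_on ((T \<times> U) \<times> cbox 0 1) (\<lambda>(x, \<theta>). u (fst x) \<theta> (snd x))"
    by (simp add: split_def)
  then have "continuous_on (T \<times> U) (\<lambda>x. integral (cbox 0 1) (\<lambda>\<theta>. u (fst x) \<theta> (snd x)))"
    by (rule integral_continuous_on_param)
  then show "hol T U (\<lambda>t p. integral {0..1} (\<lambda>\<theta>. u t \<theta> p))"
    unfolding hol_def by (intro conjI ballI cdiffI[OF der lin]) (simp_all add: box_real)
  show "\<And>t p v. t \<in> T \<Longrightarrow> p \<in> U \<Longrightarrow>
      fder (\<lambda>p. integral {0..1} (\<lambda>\<theta>. u t \<theta> p)) p v = integral {0..1} (\<lambda>\<theta>. fder (u t \<theta>) p v)"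
    using fder_eq[OF der] by (simp add: L_def)
qed

lemma cdiff_cong_open:
  assumes "cdiff f p" "open V" "p \<in> V" "\<And>q. q \<in> V \<Longrightarrow> f q = g q"
  shows "cdiff g p" "fder g p = fder f p"
proof -
  have "(g has_derivative fder f p) (at p)"
    using has_derivative_transform_within_open[OF cdiff_has_derivative[OF assms(1)] assms(2,3)] assms(4) by auto
  then show "cdiff g p" "fder g p = fder f p" using cdiff_clinear[OF assms(1)] by (auto intro!: cdiffI fder_eq)
qed

lemma hol_cong:
  assumes "open U" "hol T U u" "\<And>t p. t \<in> T \<Longrightarrow> p \<in> U \<Longrightarrow> u t p = v t p"
  shows "hol T U v"
  unfolding hol_def
proof (intro conjI ballI)
  show "continuous_on (T \<times> U) (\<lambda>x. v (fst x) (snd x))"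
    by (rule continuous_on_eq[OF hol_cont[OF assms(2)]]) (auto simp: assms(3))
  show "cdiff (v t) p" if "t \<in> T" "p \<in> U" for t p
    by (rule cdiff_cong_open(1)[OF hol_cdiff[OF assms(2) that] assms(1) that(2) assms(3)[OF that(1)]])
qed

text \<open>The integrand of the Cauchy integral is holomorphic in the base point, so
  \<open>hol_integral\<close> applies to the derivative itself.\<close>

lemma hol_fder:
  assumes U: "open U" and u: "hol T U u"
  shows "hol T U (\<lambda>t p. fder (u t) p v)"
  unfolding hol_def
proof (intro conjI ballI hol_fder_cont assms)
  fix t p0 assume t: "t \<in> T" and "p0 \<in> U"
  then obtain e where e: "e > 0" "ball p0 (2 * e) \<subseteq> U"
    using U open_contains_ball by (metis field_sum_of_halves half_gt_zero mult_2)
  define r where "r = e / (norm v + 1)"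
  have pos: "norm v + 1 > 0" using norm_ge_zero[of v] by linarith
  have r: "r > 0" using e pos by (simp add: r_def)
  have rv: "r * norm v \<le> e" using e pos by (simp add: r_def divide_simps)
  have inU: "p + z *s v \<in> U" if "p \<in> ball p0 e" "cmod z \<le> r" for p z
  proof -
    have "cmod z * norm v \<le> r * norm v" using that by (intro mult_right_mono) auto
    then have "norm (z *s v) \<le> e" using rv by (simp add: norm_cscale)
    then have "dist p0 (p + z *s v) < 2 * e"
      using that norm_triangle_ineq4[of "p0 - p" "z *s v"] by (simp add: dist_norm algebra_simps)
    then show ?thesis using e by auto
  qed
  let ?\<epsilon> = "\<lambda>\<theta>::real. of_real r * exp (2 * of_real pi * \<i> * of_real \<theta>) :: complex"
  have c\<epsilon>: "cmod (?\<epsilon> \<theta>) = r" for \<theta> using r by (simp add: norm_mult norm_exp_eq_Re)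
  have "hol ({t} \<times> {0..1}) (ball p0 e) (\<lambda>x p. u (fst x) (p + ?\<epsilon> (snd x) *s v) / ?\<epsilon> (snd x))"
  proof (rule hol_divide)
    show "hol ({t} \<times> {0..1}) (ball p0 e) (\<lambda>x p. u (fst x) (p + ?\<epsilon> (snd x) *s v))"
      by (rule hol_compose[OF u])
         (use t in \<open>auto intro!: continuous_intros inU hol_intros hol_param simp: c\<epsilon>\<close>)
  qed (use r in \<open>auto intro!: hol_param continuous_intros\<close>)
  then have "hol {t} (ball p0 e) (\<lambda>t p. integral {0..1} (\<lambda>\<theta>. u t (p + ?\<epsilon> \<theta> *s v) / ?\<epsilon> \<theta>))"
    by (intro hol_integral) auto
  then have "cdiff (\<lambda>p. integral {0..1} (\<lambda>\<theta>. u t (p + ?\<epsilon> \<theta> *s v) / ?\<epsilon> \<theta>)) p0"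
    using e by (auto simp: hol_def)
  moreover have "integral {0..1} (\<lambda>\<theta>. u t (q + ?\<epsilon> \<theta> *s v) / ?\<epsilon> \<theta>) = fder (u t) q v" if "q \<in> ball p0 e" for q
    using that r t by (auto intro!: integral_unique cauchy_fder hol_cdiff[OF u] inU)
  ultimately show "cdiff (\<lambda>p. fder (u t) p v) p0"
    using cdiff_cong_open(1)[of _ p0 "ball p0 e"] e by auto
qed

text \<open>Weierstrass's theorem. The derivatives converge because they are Cauchy integrals of
  uniformly convergent functions, and the uniform remainder bound survives the limit, which
  identifies the limit of the derivatives as the derivative of \<open>l\<close>.\<close>

lemma hol_uniform_limit:
  fixes U :: "(complex^'m) set"
  assumes U: "open U" and u: "\<And>k. hol T U (u k)"
    and lim: "uniform_limit (T \<times> U) (\<lambda>k x. u k (fst x) (snd x)) (\<lambda>x. l (fst x) (snd x)) sequentially"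
  shows "hol T U l"
  unfolding hol_def
proof (intro conjI ballI)
  show cl: "continuous_on (T \<times> U) (\<lambda>x. l (fst x) (snd x))"
    by (rule uniform_limit_theorem[OF always_eventually lim]) (intro allI hol_cont[OF u], simp)
  fix t p assume t: "t \<in> T" and p: "p \<in> U"
  obtain e where e: "e > 0" "cball p e \<subseteq> U"
    using U p open_contains_cball by blast
  have "compact ((\<lambda>q. l t q) ` cball p e)"
    using continuous_on_compose2[OF cl, of "cball p e" "\<lambda>q. (t, q)"] e t
    by (intro compact_continuous_image) (auto intro!: continuous_intros)
  then obtain M0 where "\<forall>y\<in>(\<lambda>q. l t q) ` cball p e. cmod y \<le> M0"
    by (rule exE[OF bounded_iff[THEN iffD1, OF compact_imp_bounded]])
  then have M0: "cmod (l t q) \<le> M0" if "q \<in> cball p e" for q using that by (rule bspec[OF _ imageI])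
  define M where "M = M0 + 1"
  \<comment> \<open>From some index on the approximants are within 1 of the limit, so the single
    bound \<open>M\<close> serves for all of them.\<close>
  have ev: "\<forall>\<^sub>F k in sequentially. \<forall>q\<in>cball p e. cmod (u k t q) \<le> M"
    using uniform_limitD[OF lim zero_less_one]
  proof eventually_elim
    case (elim k)
    show ?case
    proof
      fix q assume q: "q \<in> cball p e"
      then have "dist (u k t q) (l t q) < 1" using elim[rule_format, of "(t, q)"] t e by auto
      then show "cmod (u k t q) \<le> M" using M0[OF q] norm_triangle_ineq2[of "u k t q" "l t q"]
        by (simp add: M_def dist_norm)
    qed
  qed
  have conv: "\<exists>L. (\<lambda>k. fder (u k t) p v) \<longlonglongrightarrow> L" for v
  proof -
    define r where "r = e / (norm v + 1)"
    have pos: "norm v + 1 > 0" using norm_ge_zero[of v] by linarith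
    have r: "r > 0" using e pos by (simp add: r_def)
    have rv: "r * norm v \<le> e" using e pos by (simp add: r_def divide_simps)
    have inU: "p + z *s v \<in> U" if "cmod z \<le> r" for z
    proof -
      have "cmod z * norm v \<le> r * norm v" using that by (intro mult_right_mono) auto
      then have "norm (z *s v) \<le> e" using rv by (simp add: norm_cscale)
      then show ?thesis using e by (auto simp: dist_norm subset_iff)
    qed
    let ?\<epsilon> = "\<lambda>\<theta>::real. of_real r * exp (2 * of_real pi * \<i> * of_real \<theta>) :: complex"
    have c\<epsilon>: "cmod (?\<epsilon> \<theta>) = r" for \<theta> using r by (simp add: norm_mult norm_exp_eq_Re)
    have hi: "((\<lambda>\<theta>. u k t (p + ?\<epsilon> \<theta> *s v) / ?\<epsilon> \<theta>) has_integral fder (u k t) p v) (cbox 0 1)" for k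
      using r t by (auto intro!: cauchy_fder hol_cdiff[OF u] inU simp: box_real)
    have ul: "uniform_limit (cbox 0 1) (\<lambda>k \<theta>. u k t (p + ?\<epsilon> \<theta> *s v) / ?\<epsilon> \<theta>) (\<lambda>\<theta>. l t (p + ?\<epsilon> \<theta> *s v) / ?\<epsilon> \<theta>) sequentially"
    proof (rule uniform_limitI)
      fix d :: real assume "d > 0"
      then have "d * r > 0" using r by simp
      from uniform_limitD[OF lim this]
      show "\<forall>\<^sub>F k in sequentially. \<forall>\<theta>\<in>cbox 0 1. dist (u k t (p + ?\<epsilon> \<theta> *s v) / ?\<epsilon> \<theta>) (l t (p + ?\<epsilon> \<theta> *s v) / ?\<epsilon> \<theta>) < d"
      proof eventually_elim
        case (elim k)
        show ?case
        proof
          fix \<theta> :: real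
          have "dist (u k t (p + ?\<epsilon> \<theta> *s v)) (l t (p + ?\<epsilon> \<theta> *s v)) < d * r"
            using elim[rule_format, of "(t, p + ?\<epsilon> \<theta> *s v)"] t inU c\<epsilon> by auto
          then show "dist (u k t (p + ?\<epsilon> \<theta> *s v) / ?\<epsilon> \<theta>) (l t (p + ?\<epsilon> \<theta> *s v) / ?\<epsilon> \<theta>) < d"
            using r unfolding dist_norm diff_divide_distrib[symmetric] norm_divide c\<epsilon> by (simp add: field_simps)
        qed
      qed
    qed
    obtain I J where IJ: "\<And>k. ((\<lambda>\<theta>. u k t (p + ?\<epsilon> \<theta> *s v) / ?\<epsilon> \<theta>) has_integral I k) (cbox 0 1)" "I \<longlonglongrightarrow> J"
    proof (rule uniform_limit_integral_cbox[OF ul])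
      show "continuous_on (cbox 0 1) (\<lambda>\<theta>. u k t (p + ?\<epsilon> \<theta> *s v) / ?\<epsilon> \<theta>)" for k
        using r t
        by (intro continuous_intros hol_cont2[OF u]) (auto intro!: inU continuous_intros simp: c\<epsilon>)
    qed auto
    have "I = (\<lambda>k. fder (u k t) p v)" by (rule ext, rule has_integral_unique[OF IJ(1) hi])
    with IJ(2) show ?thesis by (intro exI[of _ J]) simp
  qed
  then obtain L where L: "\<And>v. (\<lambda>k. fder (u k t) p v) \<longlonglongrightarrow> L v" by metis
  have cl: "Vector_Spaces.linear (*s) (*) (fder (u k t) p)" for k
    using cdiff_clinear hol_cdiff u t p by blast
  have lin: "Vector_Spaces.linear (*s) (*) L"
  proof (rule clinearI)
    show "L (x + y) = L x + L y" for x y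
      using LIMSEQ_unique[OF L[of "x + y"]] tendsto_add[OF L[of x] L[of y]] by (simp add: clinear_add[OF cl])
    show "L (c *s x) = c * L x" for c x
      using LIMSEQ_unique[OF L[of "c *s x"]] tendsto_mult_left[OF L[of x], of c] by (simp add: clinear_scale[OF cl])
  qed
  have pt: "(\<lambda>k. u k t q) \<longlonglongrightarrow> l t q" if "q \<in> U" for q
    using tendsto_uniform_limitI[OF lim, of "(t, q)"] that t by auto
  have "(l t has_derivative L) (at p)"
  proof (rule has_derivative_quadratic)
    show "bounded_linear L" using lin clinear_imp_bounded_linear by blast
    show "0 < e / 4" using e by simp
    fix w :: "complex^'m" assume w: "norm w < e / 4"
    then have pw: "p + w \<in> U" using e by (auto simp: dist_norm subset_iff)
    have "(\<lambda>k. cmod (u k t (p + w) - u k t p - fder (u k t) p w)) \<longlonglongrightarrow> cmod (l t (p + w) - l t p - L w)"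
      by (intro tendsto_intros pt pw p L)
    moreover have "\<forall>\<^sub>F k in sequentially. cmod (u k t (p + w) - u k t p - fder (u k t) p w) \<le> 32 * M / e\<^sup>2 * (norm w)\<^sup>2"
      using ev
    proof eventually_elim
      case (elim k)
      then show ?case
        using t e w hol_cdiff[OF u] by (intro taylor_estimate) (auto simp: subset_iff)
    qed
    ultimately show "cmod (l t (p + w) - l t p - L w) \<le> 32 * M / e\<^sup>2 * (norm w)\<^sup>2"
      by (rule tendsto_upperbound) simp
  qed
  then show "cdiff (l t) p" using lin cdiffI by blast
qed

section \<open>Flows of time-dependent holomorphic vector fields\<close>

abbreviation vder :: "(complex^'m \<Rightarrow> complex^'k) \<Rightarrow> complex^'m \<Rightarrow> complex^'m \<Rightarrow> complex^'k" where
  "vder F p v \<equiv> \<chi> i. fder (\<lambda>q. F q $ i) p v"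

lemma norm_vec_le_sum: "norm x \<le> (\<Sum>i\<in>UNIV. cmod (x $ i))" for x :: "complex^'m"
  unfolding norm_vec_def by (rule L2_set_le_sum) simp

lemma hol_vec_continuous:
  fixes X :: "'t::t2_space \<Rightarrow> complex^'m \<Rightarrow> complex^'k"
  assumes "\<And>i. hol T U (\<lambda>t p. X t p $ i)" "continuous_on S f" "continuous_on S g"
    "\<And>x. x \<in> S \<Longrightarrow> f x \<in> T \<and> g x \<in> U"
  shows "continuous_on S (\<lambda>x. X (f x) (g x))"
proof -
  have "continuous_on S (\<lambda>x. \<chi> i. X (f x) (g x) $ i)"
    by (intro continuous_on_vec_lambda hol_cont2[OF assms])
  then show ?thesis by simp
qed

lemma hol_vec_has_derivative:
  fixes X :: "'t::t2_space \<Rightarrow> complex^'m \<Rightarrow> complex^'k"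
  assumes "\<And>i. hol T U (\<lambda>t p. X t p $ i)" "t \<in> T" "p \<in> U"
  shows "(X t has_derivative vder (X t) p) (at p)"
  by (intro has_derivative_vec_comp cdiff_has_derivative hol_cdiff[OF assms])

text \<open>Compactness bounds the finitely many partial derivatives. This gives the operator bound
  directly and, since the ball is convex, the Lipschitz constant by the mean value
  inequality.\<close>

lemma hol_vec_lipschitz:
  fixes X :: "'t::t2_space \<Rightarrow> complex^'m \<Rightarrow> complex^'k"
  assumes X: "\<And>i. hol T U (\<lambda>t p. X t p $ i)" and U: "open U" "cball 0 \<rho> \<subseteq> U" and T: "compact T"
  obtains L where "L \<ge> 0"
    "\<And>t p v. t \<in> T \<Longrightarrow> p \<in> cball 0 \<rho> \<Longrightarrow> norm (vder (X t) p v) \<le> L * norm v"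
    "\<And>t p q. t \<in> T \<Longrightarrow> p \<in> cball 0 \<rho> \<Longrightarrow> q \<in> cball 0 \<rho> \<Longrightarrow> norm (X t p - X t q) \<le> L * norm (p - q)"
proof -
  have "\<exists>B. \<forall>t\<in>T. \<forall>p\<in>cball 0 \<rho>. cmod (fder (\<lambda>q. X t q $ i) p (axis j 1)) \<le> B" for i j
  proof -
    have "continuous_on (T \<times> cball 0 \<rho>) (\<lambda>x. fder (\<lambda>q. X (fst x) q $ i) (snd x) (axis j 1))"
      by (rule continuous_on_subset[OF hol_fder_cont[OF U(1) X]]) (use U in auto)
    then have "compact ((\<lambda>x. fder (\<lambda>q. X (fst x) q $ i) (snd x) (axis j 1)) ` (T \<times> cball 0 \<rho>))"
      by (intro compact_continuous_image compact_Times T compact_cball)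
    then obtain B where "\<forall>y \<in> (\<lambda>x. fder (\<lambda>q. X (fst x) q $ i) (snd x) (axis j 1)) ` (T \<times> cball 0 \<rho>). cmod y \<le> B"
      by (rule exE[OF bounded_iff[THEN iffD1, OF compact_imp_bounded]])
    then show ?thesis by (intro exI[of _ B]) auto
  qed
  then obtain B where B: "\<And>i j t p. t \<in> T \<Longrightarrow> p \<in> cball 0 \<rho> \<Longrightarrow> cmod (fder (\<lambda>q. X t q $ i) p (axis j 1)) \<le> B i j"
    by metis
  define L where "L = (\<Sum>i\<in>UNIV. \<Sum>j\<in>UNIV. \<bar>B i j\<bar>)"
  have L0: "L \<ge> 0" unfolding L_def by (intro sum_nonneg) auto
  have der: "norm (vder (X t) p v) \<le> L * norm v" if tp: "t \<in> T" "p \<in> cball 0 \<rho>" for t p v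
  proof -
    have "cmod (fder (\<lambda>q. X t q $ i) p v) \<le> (\<Sum>j\<in>UNIV. \<bar>B i j\<bar>) * norm v" for i
    proof -
      have "cdiff (\<lambda>q. X t q $ i) p" using hol_cdiff[OF X] tp U by blast
      then have "fder (\<lambda>q. X t q $ i) p v = (\<Sum>j\<in>UNIV. v $ j * fder (\<lambda>q. X t q $ i) p (axis j 1))"
        by (rule clinear_expand[OF cdiff_clinear])
      also have "cmod \<dots> \<le> (\<Sum>j\<in>UNIV. norm v * \<bar>B i j\<bar>)"
        by (rule sum_norm_le) (auto simp: norm_mult intro!: mult_mono Finite_Cartesian_Product.norm_nth_le order_trans[OF B[OF tp]])
      finally show ?thesis by (simp add: sum_distrib_left[symmetric] mult.commute)
    qed
    then have "(\<Sum>i\<in>UNIV. cmod (vder (X t) p v $ i)) \<le> (\<Sum>i\<in>UNIV. (\<Sum>j\<in>UNIV. \<bar>B i j\<bar>) * norm v)"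
      by (intro sum_mono) simp
    then show ?thesis using norm_vec_le_sum[of "vder (X t) p v"] by (simp add: L_def sum_distrib_right)
  qed
  have "norm (X t p - X t q) \<le> L * norm (p - q)"
    if t: "t \<in> T" and p: "p \<in> cball 0 \<rho>" and q: "q \<in> cball 0 \<rho>" for t p q
  proof (rule differentiable_bound[OF convex_cball _ _ p q])
    fix x :: "complex^'m" assume x: "x \<in> cball 0 \<rho>"
    show "(X t has_derivative vder (X t) x) (at x within cball 0 \<rho>)"
      by (rule has_derivative_at_withinI, rule hol_vec_has_derivative[OF X t]) (use x U in blast)
    show "onorm (vder (X t) x) \<le> L"
      by (rule onorm_bound[OF L0 der[OF t x]])
  qed
  with L0 der show ?thesis using that by blast
qed

text \<open>The primitive of \<open>c\<close> is written over the fixed interval [0,1] by the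
  substitution sigma = s theta. In this form \<open>s\<close> is a mere parameter, so
  \<open>hol_integral\<close> can differentiate Picard's equation in space, while the time
  derivative is still \<open>c s\<close>.\<close>

lemma scaled_integral_derivative:
  fixes c :: "real \<Rightarrow> 'a::banach"
  assumes c: "continuous_on {0..1} c" and s: "s \<in> {0..1}"
  shows "((\<lambda>s. integral {0..1} (\<lambda>\<theta>. s *\<^sub>R c (s * \<theta>))) has_vector_derivative c s) (at s within {0..1})"
proof -
  have *: "integral {0..1} (\<lambda>\<theta>. t *\<^sub>R c (t * \<theta>)) = integral {0..t} c" if "t \<in> {0..1}" for t
  proof (cases "t = 0")
    case False
    then have t: "t > 0" using that by auto
    have "(c has_integral integral {0..t} c) {0..t}"
      by (intro integrable_integral integrable_continuous_interval continuous_on_subset[OF c]) (use that in auto)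
    from has_integral_stretch_real[OF this False]
    have "((\<lambda>\<theta>. c (t * \<theta>)) has_integral (1 / \<bar>t\<bar>) *\<^sub>R integral {0..t} c) ((\<lambda>x. x / t) ` {0..t})" .
    moreover have "(\<lambda>x. x / t) ` {0..t} = {0..1}"
      using t by (auto simp: divide_simps intro!: image_eqI[of _ _ "_ * t"])
    ultimately have "((\<lambda>\<theta>. t *\<^sub>R c (t * \<theta>)) has_integral t *\<^sub>R ((1 / \<bar>t\<bar>) *\<^sub>R integral {0..t} c)) {0..1}"
      by (intro has_integral_cmul) simp
    then have "((\<lambda>\<theta>. t *\<^sub>R c (t * \<theta>)) has_integral integral {0..t} c) {0..1}" using t by simp
    then show ?thesis by (rule integral_unique)
  qed simp
  show ?thesis
    using integral_has_vector_derivative[OF c s]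
    by (rule has_vector_derivative_transform[OF s, rotated -1]) (rule *)
qed

text \<open>Picard iteration over the whole time interval. As \<open>X\<close> vanishes at the
  origin, every iterate satisfies Gronwall's bound |P s p| <= |p| exp(L s), so trajectories starting
  in a small ball stay in the domain up to time 1. Holomorphy in \<open>p\<close> passes to the
  uniform limit.\<close>

lemma flow_exists:
  fixes X :: "real \<Rightarrow> complex^'m \<Rightarrow> complex^'m"
  assumes R: "R > 0" and X: "\<And>i. hol {0..1} (ball 0 R) (\<lambda>s p. X s p $ i)"
    and X0: "\<And>s. s \<in> {0..1} \<Longrightarrow> X s 0 = 0"
  obtains r and P :: "real \<Rightarrow> complex^'m \<Rightarrow> complex^'m" where "r > 0" "\<And>i. hol {0..1} (ball 0 r) (\<lambda>s p. P s p $ i)"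
    "\<And>s p. s \<in> {0..1} \<Longrightarrow> p \<in> ball 0 r \<Longrightarrow> P s p \<in> ball 0 R"
    "\<And>s. s \<in> {0..1} \<Longrightarrow> P s 0 = 0"
    "\<And>s p. s \<in> {0..1} \<Longrightarrow> p \<in> ball 0 r \<Longrightarrow> P s p = p + integral {0..1} (\<lambda>\<theta>. s *\<^sub>R X (s * \<theta>) (P (s * \<theta>) p))"
proof -
  define \<rho> where "\<rho> = R / 2"
  have \<rho>: "\<rho> > 0" "cball 0 \<rho> \<subseteq> ball (0::complex^'m) R" using R by (auto simp: \<rho>_def)
  obtain L where L: "L \<ge> 0"
    "\<And>t p q. t \<in> {0..1} \<Longrightarrow> p \<in> cball 0 \<rho> \<Longrightarrow> q \<in> cball 0 \<rho> \<Longrightarrow> norm (X t p - X t q) \<le> L * norm (p - q)"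
    using hol_vec_lipschitz[OF X open_ball \<rho>(2) compact_Icc] by metis
  \<comment> \<open>Growth by a factor of at most exp L up to time 1 keeps trajectories in the
    closed ball of radius \<open>\<rho>\<close>.\<close>
  define r where "r = \<rho> / exp L"
  have r: "r > 0" using \<rho> by (simp add: r_def)
  define P :: "nat \<Rightarrow> real \<Rightarrow> complex^'m \<Rightarrow> complex^'m" where
    "P = rec_nat (\<lambda>s p. p) (\<lambda>k Q s p. p + integral {0..1} (\<lambda>\<theta>. s *\<^sub>R X (s * \<theta>) (Q (s * \<theta>) p)))"
  have P0: "P 0 s p = p" and PS: "P (Suc k) s p = p + integral {0..1} (\<lambda>\<theta>. s *\<^sub>R X (s * \<theta>) (P k (s * \<theta>) p))" for k s p
    by (simp_all add: P_def)
  have prod01: "s * \<theta> \<in> {0..1}" if "s \<in> {0..1}" "\<theta> \<in> {0..1}" for s \<theta> :: real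
    using that by (auto intro: mult_le_one)
  have inball: "x \<in> cball 0 \<rho>" if "norm x \<le> norm p * exp (L * s)" "s \<in> {0..1}" "p \<in> ball 0 r" for x p :: "complex^'m" and s
  proof -
    have "norm p * exp (L * s) \<le> r * exp L"
      using that L r by (intro mult_mono) (auto intro: mult_left_le)
    then show ?thesis using that by (simp add: r_def)
  qed
  have cX: "continuous_on {0..1} (\<lambda>\<theta>. s *\<^sub>R X (s * \<theta>) (Q (s * \<theta>) p))"
    if "\<And>i. hol {0..1} (ball 0 r) (\<lambda>s p. Q s p $ i)" "\<And>s p. s \<in> {0..1} \<Longrightarrow> p \<in> ball 0 r \<Longrightarrow> Q s p \<in> cball 0 \<rho>"
      "s \<in> {0..1}" "p \<in> ball 0 r" for Q :: "real \<Rightarrow> complex^'m \<Rightarrow> complex^'m" and s p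
    using that subsetD[OF \<rho>(2) that(2)[OF prod01[OF that(3)] that(4)]] prod01[OF that(3)]
    by (intro continuous_intros hol_vec_continuous[OF X] hol_vec_continuous[OF that(1)]) auto
  have main: "(\<forall>i. hol {0..1} (ball 0 r) (\<lambda>s p. P k s p $ i)) \<and>
     (\<forall>s\<in>{0..1}. \<forall>p\<in>ball 0 r. norm (P k s p) \<le> norm p * exp (L * s))" for k
  proof (induction k)
    case 0
    have "norm p \<le> norm p * exp (L * s)" if "s \<in> {0..1}" for p :: "complex^'m" and s
      using that L by (simp add: mult_le_cancel_left1)
    then show ?case by (simp add: P0 hol_nth)
  next
    case (Suc k)
    then have h: "\<And>i. hol {0..1} (ball 0 r) (\<lambda>s p. P k s p $ i)"
      and b: "\<And>s p. s \<in> {0..1} \<Longrightarrow> p \<in> ball 0 r \<Longrightarrow> norm (P k s p) \<le> norm p * exp (L * s)" by blast+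
    have bb: "P k s p \<in> cball 0 \<rho>" if "s \<in> {0..1}" "p \<in> ball 0 r" for s p
      using inball[OF b] that by blast
    have cont: "continuous_on {0..1} (\<lambda>\<theta>. s *\<^sub>R X (s * \<theta>) (P k (s * \<theta>) p))"
      if "s \<in> {0..1}" "p \<in> ball 0 r" for s p
      by (rule cX[OF h _ that]) (rule bb)
    have "hol {0..1} (ball 0 r) (\<lambda>s p. P (Suc k) s p $ i)" for i
    proof -
      have "hol ({0..1} \<times> {0..1}) (ball 0 r) (\<lambda>x p. of_real (fst x) * X (fst x * snd x) (P k (fst x * snd x) p) $ i)"
      proof (intro hol_mult hol_param hol_compose[OF X])
        show "hol ({0..1} \<times> {0..1}) (ball 0 r) (\<lambda>t p. P k (fst t * snd t) p $ j)" for j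
          by (rule hol_compose[OF h]) (auto intro!: continuous_intros hol_intros prod01 mult_le_one)
        show "continuous_on ({0..1} \<times> {0..1}) (\<lambda>x. complex_of_real (fst x))"
          "continuous_on ({0..1} \<times> {0..1}) (\<lambda>x. fst x * snd x :: real)"
          by (intro continuous_intros)+
        show "fst t * snd t \<in> {0..1}" if "t \<in> {0..1} \<times> {0..1}" for t :: "real \<times> real"
          using that by (intro prod01) auto
        then show "P k (fst t * snd t) p \<in> ball 0 R" if "t \<in> {0..1} \<times> {0..1}" "p \<in> ball 0 r" for t p
          using bb that \<rho>(2) by (meson subsetD)
      qed
      then have "hol {0..1} (ball 0 r) (\<lambda>s p. integral {0..1} (\<lambda>\<theta>. of_real s * X (s * \<theta>) (P k (s * \<theta>) p) $ i))"
        by (rule hol_integral(1)[OF open_ball])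
      then have "hol {0..1} (ball 0 r) (\<lambda>s p. p $ i + integral {0..1} (\<lambda>\<theta>. of_real s * X (s * \<theta>) (P k (s * \<theta>) p) $ i))"
        by (rule hol_add[OF hol_nth])
      moreover have "p $ i + integral {0..1} (\<lambda>\<theta>. of_real s * X (s * \<theta>) (P k (s * \<theta>) p) $ i) = P (Suc k) s p $ i"
        if "s \<in> {0..1}" "p \<in> ball 0 r" for s p
      proof -
        have "integral {0..1} ((\<lambda>x. x $ i) \<circ> (\<lambda>\<theta>. s *\<^sub>R X (s * \<theta>) (P k (s * \<theta>) p))) =
            integral {0..1} (\<lambda>\<theta>. s *\<^sub>R X (s * \<theta>) (P k (s * \<theta>) p)) $ i"
          by (rule integral_linear[OF integrable_continuous_interval[OF cont[OF that]] bounded_linear_vec_nth])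
        then show ?thesis unfolding PS o_def vector_add_component vector_scaleR_component
          by (simp only: scaleR_conv_of_real)
      qed
      ultimately show ?thesis
        by (rule hol_cong[OF open_ball])
    qed
    moreover have "norm (P (Suc k) s p) \<le> norm p * exp (L * s)" if sp: "s \<in> {0..1}" "p \<in> ball 0 r" for s p
    proof -
      \<comment> \<open>The integrand is the derivative of |p| exp(L s theta) in theta, so the
        integral of the bound is exactly the growth claimed.\<close>
      have hi: "((\<lambda>\<theta>. s * L * norm p * exp (L * (s * \<theta>))) has_integral (norm p * exp (L * (s * 1)) - norm p * exp (L * (s * 0)))) {0..1}"
        by (rule fundamental_theorem_of_calculus)
           (auto intro!: derivative_eq_intros simp: has_real_derivative_iff_has_vector_derivative[symmetric])
      have "norm (integral {0..1} (\<lambda>\<theta>. s *\<^sub>R X (s * \<theta>) (P k (s * \<theta>) p)))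
          \<le> integral {0..1} (\<lambda>\<theta>. s * L * norm p * exp (L * (s * \<theta>)))"
      proof (rule integral_norm_bound_integral)
        fix \<theta> :: real assume th: "\<theta> \<in> {0..1}"
        have "norm (X (s * \<theta>) (P k (s * \<theta>) p) - X (s * \<theta>) 0) \<le> L * norm (P k (s * \<theta>) p - 0)"
          using sp th \<rho> by (intro L(2) prod01 bb) auto
        also have "\<dots> \<le> L * (norm p * exp (L * (s * \<theta>)))"
          using b[OF prod01[OF sp(1) th] sp(2)] L(1) by (intro mult_left_mono) auto
        finally have "norm (X (s * \<theta>) (P k (s * \<theta>) p)) \<le> L * (norm p * exp (L * (s * \<theta>)))"
          using X0[OF prod01[OF sp(1) th]] by simp
        then have "s * norm (X (s * \<theta>) (P k (s * \<theta>) p)) \<le> s * (L * (norm p * exp (L * (s * \<theta>))))"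
          using sp by (intro mult_left_mono) auto
        then show "norm (s *\<^sub>R X (s * \<theta>) (P k (s * \<theta>) p)) \<le> s * L * norm p * exp (L * (s * \<theta>))"
          using sp by (simp add: mult.assoc)
      next
        show "(\<lambda>\<theta>. s *\<^sub>R X (s * \<theta>) (P k (s * \<theta>) p)) integrable_on {0..1}"
          by (rule integrable_continuous_interval[OF cont[OF sp]])
        show "(\<lambda>\<theta>. s * L * norm p * exp (L * (s * \<theta>))) integrable_on {0..1}" using hi by blast
      qed
      then show ?thesis
        using integral_unique[OF hi] norm_triangle_ineq[of p "integral {0..1} (\<lambda>\<theta>. s *\<^sub>R X (s * \<theta>) (P k (s * \<theta>) p))"]
        by (simp add: PS)
    qed
    ultimately show ?case by blast
  qed
  then have h: "\<And>k i. hol {0..1} (ball 0 r) (\<lambda>s p. P k s p $ i)"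
    and b: "\<And>k s p. s \<in> {0..1} \<Longrightarrow> p \<in> ball 0 r \<Longrightarrow> norm (P k s p) \<le> norm p * exp (L * s)" by blast+
  have bb: "P k s p \<in> cball 0 \<rho>" if "s \<in> {0..1}" "p \<in> ball 0 r" for k s p
    using inball[OF b] that by blast
  have cP: "continuous_on {0..1} (\<lambda>\<theta>. s *\<^sub>R X (s * \<theta>) (P k (s * \<theta>) p))"
    if "s \<in> {0..1}" "p \<in> ball 0 r" for k s p
    by (rule cX[OF h _ that]) (rule bb)
  \<comment> \<open>Terms of the exponential series: each integration of the Lipschitz bound raises
    the power and the factorial by one. This makes the telescoping series below uniformly
    summable.\<close>
  have diff: "norm (P (Suc k) s p - P k s p) \<le> norm p * (L * s) ^ Suc k / fact (Suc k)"
    if "s \<in> {0..1}" "p \<in> ball 0 r" for k s p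
    using that
  proof (induction k arbitrary: s)
    case 0
    have "norm (integral {0..1} (\<lambda>\<theta>. s *\<^sub>R X (s * \<theta>) (P 0 (s * \<theta>) p))) \<le> s * (L * norm p) * (1 - 0)"
    proof (rule integral_bound)
      fix \<theta> :: real assume th: "\<theta> \<in> {0..1}"
      have "norm (X (s * \<theta>) p - X (s * \<theta>) 0) \<le> L * norm (p - 0)"
        using 0 th \<rho> bb[OF 0, of 0] by (intro L(2) prod01) (auto simp: P0)
      then have "s * norm (X (s * \<theta>) p) \<le> s * (L * norm p)"
        using X0[OF prod01[OF 0(1) th]] 0 by (intro mult_left_mono) auto
      then show "norm (s *\<^sub>R X (s * \<theta>) (P 0 (s * \<theta>) p)) \<le> s * (L * norm p)"
        using 0 by (simp add: P0)
    qed (use cP[OF 0] in auto)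
    then show ?case by (simp add: PS P0 mult_ac)
  next
    case (Suc k)
    have hi: "((\<lambda>\<theta>. s * L * (norm p * (L * (s * \<theta>)) ^ Suc k / fact (Suc k))) has_integral
       (norm p * (L * (s * 1)) ^ Suc (Suc k) / fact (Suc (Suc k)) - norm p * (L * (s * 0)) ^ Suc (Suc k) / fact (Suc (Suc k)))) {0..1}"
    proof (rule fundamental_theorem_of_calculus)
      fix x :: real
      have "((\<lambda>\<theta>. norm p * (L * (s * \<theta>)) ^ Suc (Suc k) / fact (Suc (Suc k))) has_real_derivative
          norm p * (real (Suc (Suc k)) * (L * (s * x)) ^ Suc k * (L * s)) / fact (Suc (Suc k))) (at x within {0..1})"
        by (rule derivative_eq_intros refl)+ (simp_all add: divide_simps mult_ac del: power_Suc fact_Suc of_nat_Suc)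
      also have "norm p * (real (Suc (Suc k)) * (L * (s * x)) ^ Suc k * (L * s)) / fact (Suc (Suc k))
         = s * L * (norm p * (L * (s * x)) ^ Suc k / fact (Suc k))"
        by (simp add: fact_Suc divide_simps del: power_Suc of_nat_Suc)
      finally show "((\<lambda>\<theta>. norm p * (L * (s * \<theta>)) ^ Suc (Suc k) / fact (Suc (Suc k))) has_vector_derivative
          s * L * (norm p * (L * (s * x)) ^ Suc k / fact (Suc k))) (at x within {0..1})"
        by (simp add: has_real_derivative_iff_has_vector_derivative)
    qed simp
    have "norm (integral {0..1} (\<lambda>\<theta>. s *\<^sub>R X (s * \<theta>) (P (Suc k) (s * \<theta>) p) - s *\<^sub>R X (s * \<theta>) (P k (s * \<theta>) p)))
       \<le> integral {0..1} (\<lambda>\<theta>. s * L * (norm p * (L * (s * \<theta>)) ^ Suc k / fact (Suc k)))"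
    proof (rule integral_norm_bound_integral)
      fix \<theta> :: real assume th: "\<theta> \<in> {0..1}"
      have "norm (X (s * \<theta>) (P (Suc k) (s * \<theta>) p) - X (s * \<theta>) (P k (s * \<theta>) p)) \<le> L * norm (P (Suc k) (s * \<theta>) p - P k (s * \<theta>) p)"
        using Suc.prems th by (intro L(2) prod01 bb) auto
      also have "\<dots> \<le> L * (norm p * (L * (s * \<theta>)) ^ Suc k / fact (Suc k))"
        using Suc.IH[OF prod01[OF Suc.prems(1) th] Suc.prems(2)] L(1) by (intro mult_left_mono) auto
      finally have "s * norm (X (s * \<theta>) (P (Suc k) (s * \<theta>) p) - X (s * \<theta>) (P k (s * \<theta>) p)) \<le> s * (L * (norm p * (L * (s * \<theta>)) ^ Suc k / fact (Suc k)))"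
        using Suc.prems by (intro mult_left_mono) auto
      then show "norm (s *\<^sub>R X (s * \<theta>) (P (Suc k) (s * \<theta>) p) - s *\<^sub>R X (s * \<theta>) (P k (s * \<theta>) p)) \<le> s * L * (norm p * (L * (s * \<theta>)) ^ Suc k / fact (Suc k))"
        using Suc.prems unfolding scaleR_diff_right[symmetric] by (simp add: mult.assoc del: power_Suc)
    next
      show "(\<lambda>\<theta>. s *\<^sub>R X (s * \<theta>) (P (Suc k) (s * \<theta>) p) - s *\<^sub>R X (s * \<theta>) (P k (s * \<theta>) p)) integrable_on {0..1}"
        by (intro integrable_continuous_interval continuous_on_diff cP Suc.prems)
      show "(\<lambda>\<theta>. s * L * (norm p * (L * (s * \<theta>)) ^ Suc k / fact (Suc k))) integrable_on {0..1}"
        using hi by blast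
    qed
    moreover have "P (Suc (Suc k)) s p - P (Suc k) s p =
        integral {0..1} (\<lambda>\<theta>. s *\<^sub>R X (s * \<theta>) (P (Suc k) (s * \<theta>) p) - s *\<^sub>R X (s * \<theta>) (P k (s * \<theta>) p))"
      unfolding PS[of "Suc k"] PS[of k s]
      by (subst integral_diff) (auto intro!: integrable_continuous_interval cP[OF Suc.prems])
    ultimately show ?case using integral_unique[OF hi] by simp
  qed
  \<comment> \<open>The limit of the iterates, as a telescoping series to which the M-test
    applies.\<close>
  define l where "l s p = p + (\<Sum>k. P (Suc k) s p - P k s p)" for s p
  have "uniform_limit ({0..1} \<times> ball 0 r) (\<lambda>n x. \<Sum>k<n. P (Suc k) (fst x) (snd x) - P k (fst x) (snd x))
     (\<lambda>x. \<Sum>k. P (Suc k) (fst x) (snd x) - P k (fst x) (snd x)) sequentially"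
  proof (rule Weierstrass_m_test)
    fix k x assume x: "x \<in> {0..1::real} \<times> ball (0::complex^'m) r"
    then have "norm (P (Suc k) (fst x) (snd x) - P k (fst x) (snd x)) \<le> norm (snd x) * (L * fst x) ^ Suc k / fact (Suc k)"
      by (intro diff) auto
    also have "\<dots> \<le> r * L ^ Suc k / fact (Suc k)"
      using x L r by (intro divide_right_mono mult_mono power_mono) (auto intro: mult_left_le)
    finally show "norm (P (Suc k) (fst x) (snd x) - P k (fst x) (snd x)) \<le> r * (L ^ Suc k / fact (Suc k))" by simp
  next
    have "summable (\<lambda>k. L ^ k / fact k)"
      using summable_exp_generic[of L] by (simp add: divide_inverse mult.commute)
    then have "summable (\<lambda>k. L ^ Suc k / fact (Suc k))" by (subst summable_Suc_iff)
    then show "summable (\<lambda>k. r * (L ^ Suc k / fact (Suc k)))" by (rule summable_mult)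
  qed
  then have "uniform_limit ({0..1} \<times> ball 0 r) (\<lambda>n x. snd x + (\<Sum>k<n. P (Suc k) (fst x) (snd x) - P k (fst x) (snd x)))
     (\<lambda>x. l (fst x) (snd x)) sequentially"
    unfolding l_def by (intro uniform_limit_add uniform_limit_const)
  moreover have "snd x + (\<Sum>k<n. P (Suc k) (fst x) (snd x) - P k (fst x) (snd x)) = P n (fst x) (snd x)"
    for n and x :: "real \<times> (complex^'m)"
    by (induction n) (auto simp: P0 algebra_simps)
  ultimately have lim: "uniform_limit ({0..1} \<times> ball 0 r) (\<lambda>n x. P n (fst x) (snd x)) (\<lambda>x. l (fst x) (snd x)) sequentially"
    by simp
  have hl: "hol {0..1} (ball 0 r) (\<lambda>s p. l s p $ i)" for i
    by (rule hol_uniform_limit[OF open_ball h]) (rule bounded_linear.uniform_limit[OF bounded_linear_vec_nth lim])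
  have pt: "(\<lambda>k. P k s p) \<longlonglongrightarrow> l s p" if "s \<in> {0..1}" "p \<in> ball 0 r" for s p
    using tendsto_uniform_limitI[OF lim, of "(s, p)"] that by auto
  have nl: "norm (l s p) \<le> norm p * exp (L * s)" if "s \<in> {0..1}" "p \<in> ball 0 r" for s p
    by (rule tendsto_upperbound[OF tendsto_norm[OF pt[OF that]]]) (use b that in auto)
  have lb: "l s p \<in> cball 0 \<rho>" if "s \<in> {0..1}" "p \<in> ball 0 r" for s p
    using inball[OF nl] that by blast
  have cl: "continuous_on {0..1} (\<lambda>\<theta>. s *\<^sub>R X (s * \<theta>) (l (s * \<theta>) p))"
    if "s \<in> {0..1}" "p \<in> ball 0 r" for s p
    by (rule cX[OF hl _ that]) (rule lb)
  have eq: "l s p = p + integral {0..1} (\<lambda>\<theta>. s *\<^sub>R X (s * \<theta>) (l (s * \<theta>) p))" if sp: "s \<in> {0..1}" "p \<in> ball 0 r" for s p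
  proof (rule LIMSEQ_unique)
    show "(\<lambda>k. P (Suc k) s p) \<longlonglongrightarrow> l s p" using pt[OF sp] by (rule LIMSEQ_Suc)
    have "(\<lambda>k. integral {0..1} (\<lambda>\<theta>. s *\<^sub>R X (s * \<theta>) (P k (s * \<theta>) p))) \<longlonglongrightarrow> integral {0..1} (\<lambda>\<theta>. s *\<^sub>R X (s * \<theta>) (l (s * \<theta>) p))"
    proof (rule metric_LIMSEQ_I)
      fix e :: real assume e: "e > 0"
      \<comment> \<open>The summand 1 keeps the quotient defined when L = 0, and L e / (L + 1) is
        still less than \<open>e\<close>.\<close>
      then have "e / (L + 1) > 0" using L by simp
      from uniform_limitD[OF lim this] obtain N where
        N: "\<And>n x. n \<ge> N \<Longrightarrow> x \<in> {0..1} \<times> ball 0 r \<Longrightarrow> dist (P n (fst x) (snd x)) (l (fst x) (snd x)) < e / (L + 1)"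
        unfolding eventually_sequentially by blast
      show "\<exists>N. \<forall>n\<ge>N. dist (integral {0..1} (\<lambda>\<theta>. s *\<^sub>R X (s * \<theta>) (P n (s * \<theta>) p))) (integral {0..1} (\<lambda>\<theta>. s *\<^sub>R X (s * \<theta>) (l (s * \<theta>) p))) < e"
      proof (intro exI[of _ N] allI impI)
        fix n assume n: "n \<ge> N"
        have "norm (integral {0..1} (\<lambda>\<theta>. s *\<^sub>R X (s * \<theta>) (P n (s * \<theta>) p) - s *\<^sub>R X (s * \<theta>) (l (s * \<theta>) p)))
          \<le> L * (e / (L + 1)) * (1 - 0)"
        proof (rule integral_bound)
          fix \<theta> :: real assume th: "\<theta> \<in> {0..1}"
          have "norm (X (s * \<theta>) (P n (s * \<theta>) p) - X (s * \<theta>) (l (s * \<theta>) p)) \<le> L * norm (P n (s * \<theta>) p - l (s * \<theta>) p)"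
            using sp th by (intro L(2) prod01 bb lb) auto
          also have "\<dots> \<le> L * (e / (L + 1))"
            using N[OF n, of "(s * \<theta>, p)"] prod01[OF sp(1) th] sp L(1) by (intro mult_left_mono) (auto simp: dist_norm)
          finally have "norm (X (s * \<theta>) (P n (s * \<theta>) p) - X (s * \<theta>) (l (s * \<theta>) p)) \<le> L * (e / (L + 1))" .
          then have "s * norm (X (s * \<theta>) (P n (s * \<theta>) p) - X (s * \<theta>) (l (s * \<theta>) p)) \<le> 1 * (L * (e / (L + 1)))"
            using sp by (intro mult_mono) auto
          then show "norm (s *\<^sub>R X (s * \<theta>) (P n (s * \<theta>) p) - s *\<^sub>R X (s * \<theta>) (l (s * \<theta>) p)) \<le> L * (e / (L + 1))"
            using sp unfolding scaleR_diff_right[symmetric] by simp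
        qed (auto intro!: continuous_on_diff cP[OF sp] cl[OF sp])
        also have "L * (e / (L + 1)) * (1 - 0) < e" using L e by (simp add: field_simps)
        finally show "dist (integral {0..1} (\<lambda>\<theta>. s *\<^sub>R X (s * \<theta>) (P n (s * \<theta>) p))) (integral {0..1} (\<lambda>\<theta>. s *\<^sub>R X (s * \<theta>) (l (s * \<theta>) p))) < e"
          unfolding dist_norm
          by (subst integral_diff[symmetric]) (auto intro!: integrable_continuous_interval cP[OF sp] cl[OF sp])
      qed
    qed
    then show "(\<lambda>k. P (Suc k) s p) \<longlonglongrightarrow> p + integral {0..1} (\<lambda>\<theta>. s *\<^sub>R X (s * \<theta>) (l (s * \<theta>) p))"
      unfolding PS by (intro tendsto_add tendsto_const)
  qed
  show ?thesis
  proof (rule that[OF r hl _ _ eq])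
    show "l s p \<in> ball 0 R" if "s \<in> {0..1}" "p \<in> ball 0 r" for s p using lb[OF that] \<rho>(2) by blast
    show "l s 0 = 0" if "s \<in> {0..1}" for s using nl[OF that, of 0] r by simp
  qed
qed

lemma has_vector_derivative_vec:
  fixes a :: "real \<Rightarrow> complex^'m"
  assumes "\<And>i. ((\<lambda>s. a s $ i) has_vector_derivative a' $ i) F"
  shows "(a has_vector_derivative a') F"
proof -
  have "(a has_derivative (\<lambda>h. \<chi> i. h *\<^sub>R a' $ i)) F"
    by (rule has_derivative_vec_comp) (use assms in \<open>simp add: has_vector_derivative_def\<close>)
  moreover have "(\<lambda>h. \<chi> i. h *\<^sub>R a' $ i) = (\<lambda>h. h *\<^sub>R a')" by (simp add: vec_eq_iff fun_eq_iff)
  ultimately show ?thesis by (simp add: has_vector_derivative_def)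
qed

text \<open>Differentiating the integral equation in \<open>p\<close> under the integral sign gives
  an integral equation for the spatial derivative; differentiating that in \<open>s\<close> yields
  the variational equation.\<close>

lemma flow:
  fixes X :: "real \<Rightarrow> complex^'m \<Rightarrow> complex^'m"
  assumes R: "R > 0" and X: "\<And>i. hol {0..1} (ball 0 R) (\<lambda>s p. X s p $ i)"
    and X0: "\<And>s. s \<in> {0..1} \<Longrightarrow> X s 0 = 0"
  obtains r and P :: "real \<Rightarrow> complex^'m \<Rightarrow> complex^'m" where "r > 0"
    "\<And>i. hol {0..1} (ball 0 r) (\<lambda>s p. P s p $ i)"
    "\<And>s p. s \<in> {0..1} \<Longrightarrow> p \<in> ball 0 r \<Longrightarrow> P s p \<in> ball 0 R"
    "\<And>s. s \<in> {0..1} \<Longrightarrow> P s 0 = 0" "\<And>p. p \<in> ball 0 r \<Longrightarrow> P 0 p = p"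
    "\<And>s p. s \<in> {0..1} \<Longrightarrow> p \<in> ball 0 r \<Longrightarrow>
       ((\<lambda>s. P s p) has_vector_derivative X s (P s p)) (at s within {0..1})"
    "\<And>s p v. s \<in> {0..1} \<Longrightarrow> p \<in> ball 0 r \<Longrightarrow>
       ((\<lambda>s. vder (P s) p v) has_vector_derivative vder (X s) (P s p) (vder (P s) p v)) (at s within {0..1})"
proof -
  obtain r and P :: "real \<Rightarrow> complex^'m \<Rightarrow> complex^'m" where r: "r > 0"
    and P: "\<And>i. hol {0..1} (ball 0 r) (\<lambda>s p. P s p $ i)"
    and PR: "\<And>s p. s \<in> {0..1} \<Longrightarrow> p \<in> ball 0 r \<Longrightarrow> P s p \<in> ball 0 R"
    and P0: "\<And>s. s \<in> {0..1} \<Longrightarrow> P s 0 = 0"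
    and eq: "\<And>s p. s \<in> {0..1} \<Longrightarrow> p \<in> ball 0 r \<Longrightarrow> P s p = p + integral {0..1} (\<lambda>\<theta>. s *\<^sub>R X (s * \<theta>) (P (s * \<theta>) p))"
    by (rule flow_exists[OF R X X0], assumption, rule that; assumption)
  have prod01: "s * \<theta> \<in> {0..1}" if "s \<in> {0..1}" "\<theta> \<in> {0..1}" for s \<theta> :: real
    using that by (auto intro: mult_le_one)
  have cX: "continuous_on {0..1} (\<lambda>\<sigma>. X \<sigma> (P \<sigma> p))" if "p \<in> ball 0 r" for p
    by (intro hol_vec_continuous[OF X] hol_vec_continuous[OF P] continuous_intros) (use that PR in auto)
  have der: "((\<lambda>s. P s p) has_vector_derivative X s (P s p)) (at s within {0..1})"
    if s: "s \<in> {0..1}" and p: "p \<in> ball 0 r" for s p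
  proof -
    have "((\<lambda>s. p + integral {0..1} (\<lambda>\<theta>. s *\<^sub>R X (s * \<theta>) (P (s * \<theta>) p))) has_vector_derivative 0 + X s (P s p)) (at s within {0..1})"
      by (intro has_vector_derivative_add has_vector_derivative_const scaled_integral_derivative[OF cX[OF p] s])
    then have "((\<lambda>s. p + integral {0..1} (\<lambda>\<theta>. s *\<^sub>R X (s * \<theta>) (P (s * \<theta>) p))) has_vector_derivative X s (P s p)) (at s within {0..1})"
      by simp
    then show ?thesis
      by (rule has_vector_derivative_transform[OF s, rotated -1]) (rule eq[OF _ p])
  qed
  have hXP: "hol {0..1} (ball 0 r) (\<lambda>s p. X s (P s p) $ i)" for i
    by (rule hol_compose[OF X _ _ P PR]) (auto intro: continuous_intros)
  have vder: "((\<lambda>s. vder (P s) p v) has_vector_derivative vder (X s) (P s p) (vder (P s) p v)) (at s within {0..1})"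
    if s: "s \<in> {0..1}" and p: "p \<in> ball 0 r" for s p v
  proof (rule has_vector_derivative_vec)
    fix i
    \<comment> \<open>Integrand of the differentiated equation. At time \<open>s\<close> the chain
      rule turns it into the derivative of \<open>X s\<close> applied to the derivative of the
      flow.\<close>
    define c where "c \<sigma> = fder (\<lambda>q. X \<sigma> (P \<sigma> q) $ i) p v" for \<sigma>
    have "continuous_on {0..1} (\<lambda>\<sigma>. (\<lambda>x. fder (\<lambda>q. X (fst x) (P (fst x) q) $ i) (snd x) v) (\<sigma>, p))"
      by (rule continuous_on_compose2[OF hol_fder_cont[OF open_ball hXP]])
         (use p in \<open>auto intro!: continuous_intros\<close>)
    then have cc: "continuous_on {0..1} c" unfolding c_def by simp
    have cs: "c s = fder (\<lambda>q. X s q $ i) (P s p) (vder (P s) p v)"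
      unfolding c_def
      using cdiff_fder_compose(2)[OF hol_cdiff[OF X s PR[OF s p]] hol_cdiff[OF P s p], of i] by metis
    have h2: "hol ({0..1} \<times> {0..1}) (ball 0 r) (\<lambda>x p. of_real (fst x) * X (fst x * snd x) (P (fst x * snd x) p) $ i)"
    proof (intro hol_mult hol_param)
      show "continuous_on ({0..1} \<times> {0..1}) (\<lambda>x. complex_of_real (fst x))" by (intro continuous_intros)
      show "hol ({0..1} \<times> {0..1}) (ball 0 r) (\<lambda>x p. X (fst x * snd x) (P (fst x * snd x) p) $ i)"
        by (rule hol_compose[OF hXP]) (auto intro!: continuous_intros prod01 hol_nth mult_le_one)
    qed
    have fd: "fder (\<lambda>q. P t q $ i) p v = v $ i + integral {0..1} (\<lambda>\<theta>. t *\<^sub>R c (t * \<theta>))" if t: "t \<in> {0..1}" for t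
    proof -
      have e: "q $ i + integral {0..1} (\<lambda>\<theta>. of_real t * X (t * \<theta>) (P (t * \<theta>) q) $ i) = P t q $ i"
        if q: "q \<in> ball 0 r" for q
      proof -
        have "continuous_on {0..1} (\<lambda>\<theta>. t *\<^sub>R (\<lambda>\<sigma>. X \<sigma> (P \<sigma> q)) (t * \<theta>))"
          by (intro continuous_intros continuous_on_compose2[OF cX[OF q]]) (use t prod01 in auto)
        then have "integral {0..1} ((\<lambda>x. x $ i) \<circ> (\<lambda>\<theta>. t *\<^sub>R X (t * \<theta>) (P (t * \<theta>) q))) =
            integral {0..1} (\<lambda>\<theta>. t *\<^sub>R X (t * \<theta>) (P (t * \<theta>) q)) $ i"
          by (intro integral_linear integrable_continuous_interval bounded_linear_vec_nth)
        then show ?thesis unfolding eq[OF t q] o_def vector_add_component vector_scaleR_component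
          by (simp only: scaleR_conv_of_real)
      qed
      have h: "cdiff (\<lambda>q. integral {0..1} (\<lambda>\<theta>. of_real t * X (t * \<theta>) (P (t * \<theta>) q) $ i)) p"
        using hol_cdiff[OF hol_integral(1)[OF open_ball h2] t p] by simp
      have "fder (\<lambda>q. P t q $ i) p v = fder (\<lambda>q. q $ i + integral {0..1} (\<lambda>\<theta>. of_real t * X (t * \<theta>) (P (t * \<theta>) q) $ i)) p v"
        using cdiff_cong_open(2)[OF cdiff_fder_add(1)[OF cdiff_fder_nth(1) h] open_ball p e] by metis
      also have "\<dots> = v $ i + fder (\<lambda>q. integral {0..1} (\<lambda>\<theta>. of_real t * X (t * \<theta>) (P (t * \<theta>) q) $ i)) p v"
        by (simp only: cdiff_fder_add(2)[OF cdiff_fder_nth(1) h] cdiff_fder_nth(2))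
      also have "fder (\<lambda>q. integral {0..1} (\<lambda>\<theta>. of_real t * X (t * \<theta>) (P (t * \<theta>) q) $ i)) p v
        = integral {0..1} (\<lambda>\<theta>. fder (\<lambda>q. of_real t * X (t * \<theta>) (P (t * \<theta>) q) $ i) p v)"
        by (rule hol_integral(2)[OF open_ball h2 t p])
      also have "\<dots> = integral {0..1} (\<lambda>\<theta>. t *\<^sub>R c (t * \<theta>))"
      proof (rule integral_cong)
        fix \<theta> :: real assume th: "\<theta> \<in> {0..1}"
        have "cdiff (\<lambda>q. X (t * \<theta>) (P (t * \<theta>) q) $ i) p"
          by (rule hol_cdiff[OF hXP prod01[OF t th] p])
        from cdiff_fder_mult(2)[OF cdiff_fder_const(1) this, of "of_real t"]
        show "fder (\<lambda>q. of_real t * X (t * \<theta>) (P (t * \<theta>) q) $ i) p v = t *\<^sub>R c (t * \<theta>)"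
          by (simp add: cdiff_fder_const c_def scaleR_conv_of_real)
      qed
      finally show ?thesis .
    qed
    have "((\<lambda>s. v $ i + integral {0..1} (\<lambda>\<theta>. s *\<^sub>R c (s * \<theta>))) has_vector_derivative 0 + c s) (at s within {0..1})"
      by (intro has_vector_derivative_add has_vector_derivative_const scaled_integral_derivative[OF cc s])
    then have "((\<lambda>s. v $ i + integral {0..1} (\<lambda>\<theta>. s *\<^sub>R c (s * \<theta>))) has_vector_derivative c s) (at s within {0..1})"
      by simp
    then have "((\<lambda>s. fder (\<lambda>q. P s q $ i) p v) has_vector_derivative c s) (at s within {0..1})"
      by (rule has_vector_derivative_transform[OF s, rotated -1]) (rule fd)
    then show "((\<lambda>s. vder (P s) p v $ i) has_vector_derivative vder (X s) (P s p) (vder (P s) p v) $ i) (at s within {0..1})"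
      by (simp add: cs)
  qed
  have P00: "P 0 p = p" if "p \<in> ball 0 r" for p using eq[OF _ that, of 0] by simp
  show ?thesis by (rule that[OF r P PR P0 P00 der vder])
qed

text \<open>Gronwall's argument backwards in time: the derivative of exp(2 L s) |a s|^2 is
  nonnegative because the inner product of a and a' is at least - L |a|^2. Hence the value at 1
  dominates the value at 0.\<close>

lemma flow_derivative_injective:
  fixes a :: "real \<Rightarrow> complex^'m"
  assumes a: "\<And>s. s \<in> {0..1} \<Longrightarrow> (a has_vector_derivative a' s) (at s within {0..1})"
    and L: "\<And>s. s \<in> {0..1} \<Longrightarrow> norm (a' s) \<le> L * norm (a s)" and a1: "a 1 = 0"
  shows "a 0 = 0"
proof -
  let ?\<phi> = "\<lambda>s. exp (2 * L * s) * (a s \<bullet> a s)"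
  have d: "(?\<phi> has_derivative (\<lambda>h. h * (exp (2 * L * s) * (2 * L * (a s \<bullet> a s) + 2 * (a s \<bullet> a' s))))) (at s within {0..1})"
    if s: "s \<in> {0..1}" for s
    using a[OF s] unfolding has_vector_derivative_def
    by (auto intro!: derivative_eq_intros simp: algebra_simps inner_commute)
  obtain s where s: "s \<in> {0<..<1}"
    and e: "?\<phi> 1 - ?\<phi> 0 = (1 - 0) * (exp (2 * L * s) * (2 * L * (a s \<bullet> a s) + 2 * (a s \<bullet> a' s)))"
    using mvt_simple[of 0 1 ?\<phi> "\<lambda>s h. h * (exp (2 * L * s) * (2 * L * (a s \<bullet> a s) + 2 * (a s \<bullet> a' s)))"] d
    by auto
  have "\<bar>a s \<bullet> a' s\<bar> \<le> norm (a s) * (L * norm (a s))"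
    using Cauchy_Schwarz_ineq2[of "a s" "a' s"] mult_left_mono[OF L[of s] norm_ge_zero[of "a s"]] s
    by (smt (verit) atLeastAtMost_iff greaterThanLessThan_iff)
  then have "2 * L * (a s \<bullet> a s) + 2 * (a s \<bullet> a' s) \<ge> 0"
    by (simp add: dot_square_norm power2_eq_square mult_ac)
  then have "?\<phi> 1 - ?\<phi> 0 \<ge> 0" unfolding e by simp
  then have "a 0 \<bullet> a 0 \<le> 0" using a1 by simp
  then show ?thesis using inner_ge_zero[of "a 0"] inner_eq_zero_iff[of "a 0"] by linarith
qed

lemma cdiff_fder_continuous:
  assumes "open U" "\<And>p. p \<in> U \<Longrightarrow> cdiff f p"
  shows "continuous_on U (\<lambda>p. fder f p v)"
proof -
  have "hol (UNIV :: real set) U (\<lambda>t. f)" by (rule hol_indep) (rule assms)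
  from hol_cont2[OF hol_fder[OF assms(1) this], of U "\<lambda>_. 0" "\<lambda>p. p"]
  show ?thesis by (auto intro: continuous_intros)
qed

text \<open>The real inverse function theorem gives a differentiable inverse whose derivative is the
  inverse of a complex-linear bijection. Such an inverse is again complex-linear, so
  \<open>H\<close> is holomorphic.\<close>

lemma local_inverse:
  fixes G :: "complex^'m \<Rightarrow> complex^'m"
  assumes U: "open U" "x0 \<in> U" and G: "\<And>i p. p \<in> U \<Longrightarrow> cdiff (\<lambda>p. G p $ i) p"
    and inj: "\<And>v. vder G x0 v = 0 \<Longrightarrow> v = 0"
  obtains U' V and H :: "complex^'m \<Rightarrow> complex^'m" where "open U'" "U' \<subseteq> U" "x0 \<in> U'" "open V" "G ` U' = V"
    "\<And>p. p \<in> U' \<Longrightarrow> H (G p) = p" "\<And>q. q \<in> V \<Longrightarrow> H q \<in> U'" "\<And>q. q \<in> V \<Longrightarrow> G (H q) = q"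
    "\<And>i q. q \<in> V \<Longrightarrow> cdiff (\<lambda>q. H q $ i) q"
proof -
  have dG: "(G has_derivative vder G p) (at p)" if "p \<in> U" for p
    by (intro has_derivative_vec_comp cdiff_has_derivative G that)
  define f' where "f' p = Blinfun (vder G p)" for p
  have f': "blinfun_apply (f' p) = vder G p" if "p \<in> U" for p
    unfolding f'_def using has_derivative_bounded_linear[OF dG[OF that]] by (rule bounded_linear_Blinfun_apply)
  have contf: "continuous_on U f'"
  proof (rule continuous_on_blinfun_componentwise)
    fix b :: "complex^'m"
    have "continuous_on U (\<lambda>p. vder G p b)"
      by (intro continuous_on_vec_lambda cdiff_fder_continuous U G)
    then show "continuous_on U (\<lambda>p. blinfun_apply (f' p) b)"
      by (rule continuous_on_eq) (simp add: f')
  qed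
  have lin: "linear (vder G x0)" using dG[OF U(2)] has_derivative_linear by blast
  moreover have "inj (vder G x0)" using linear_injective_0[OF lin] inj by blast
  ultimately obtain g where g: "linear g" "g \<circ> vder G x0 = id"
    using linear_injective_left_inverse by blast
  have inv: "Blinfun g o\<^sub>L f' x0 = id_blinfun"
  proof (rule blinfun_eqI)
    fix x show "blinfun_apply (Blinfun g o\<^sub>L f' x0) x = blinfun_apply id_blinfun x"
      using g by (simp add: f' U bounded_linear_Blinfun_apply linear_conv_bounded_linear o_def fun_eq_iff)
  qed
  have df': "(G has_derivative blinfun_apply (f' p)) (at p)" if "p \<in> U" for p
    unfolding f'[OF that] by (rule dG[OF that])
  obtain U' V H g' where *: "open U'" "U' \<subseteq> U" "x0 \<in> U'" "open V" "G x0 \<in> V" "homeomorphism U' V G H"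
    "\<And>y. y \<in> V \<Longrightarrow> (H has_derivative g' y) (at y)"
    "\<And>y. y \<in> V \<Longrightarrow> g' y = inv (blinfun_apply (f' (H y)))"
    "\<And>y. y \<in> V \<Longrightarrow> bij (blinfun_apply (f' (H y)))"
    by (rule inverse_function_theorem[OF U(1) df' contf U(2) inv], assumption, rule that; assumption)
  note h = *(6)[unfolded homeomorphism_def]
  show ?thesis
  proof (rule that[OF *(1,2,3,4)])
    show "G ` U' = V" "\<And>p. p \<in> U' \<Longrightarrow> H (G p) = p" "\<And>q. q \<in> V \<Longrightarrow> H q \<in> U'" "\<And>q. q \<in> V \<Longrightarrow> G (H q) = q"
      using h by auto
    fix i q assume q: "q \<in> V"
    then have HqU: "H q \<in> U" using h *(2) by auto
    define A where "A = vder G (H q)"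
    have A: "g' q = inv A" "bij A" using *(8,9)[OF q] f'[OF HqU] by (simp_all add: A_def)
    note cl = cdiff_clinear[OF G[OF HqU]]
    have A1: "A (x + y) = A x + A y" for x y by (simp add: A_def vec_eq_iff clinear_add[OF cl])
    have A2: "A (c *s x) = c *s A x" for c x by (simp add: A_def vec_eq_iff clinear_scale[OF cl])
    have i1: "A (inv A x) = x" for x using A(2) by (simp add: bij_is_surj surj_f_inv_f)
    have i2: "inv A (A x) = x" for x using A(2) by (simp add: bij_is_inj)
    have "inv A (x + y) = inv A x + inv A y" for x y using i2[of "inv A x + inv A y"] by (simp add: A1 i1)
    moreover have "inv A (c *s x) = c *s inv A x" for c x using i2[of "c *s inv A x"] by (simp add: A2 i1)
    ultimately have "Vector_Spaces.linear (*s) (*) (\<lambda>v. g' q v $ i)"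
      unfolding A(1) by (intro clinearI) simp_all
    then show "cdiff (\<lambda>q. H q $ i) q"
      by (rule cdiffI[OF has_derivative_vec_nth[OF *(7)[OF q]]])
  qed
qed

section \<open>Wedge powers of a two-form\<close>

text \<open>The sequence x, y, y, ...; a 2-form reads its entries 0 and 1.\<close>

definition bil :: "'m::finite form \<Rightarrow> complex^'m \<Rightarrow> complex^'m \<Rightarrow> complex" where
  "bil \<alpha> x y = \<alpha> (case_nat x (\<lambda>_. y))"

lemma two_form_eq_bil: "alternating_form 2 \<alpha> \<Longrightarrow> \<alpha> v = bil \<alpha> (v 0) (v 1)"
  unfolding alternating_form_def bil_def by (auto simp: less_2_cases_iff)

lemma bil_linear:
  assumes "alternating_form 2 \<alpha>"
  shows "Vector_Spaces.linear (*s) (*) (\<lambda>x. bil \<alpha> x y)" "Vector_Spaces.linear (*s) (*) (bil \<alpha> x)"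
proof -
  have l: "Vector_Spaces.linear (*s) (*) (\<lambda>x. \<alpha> (v(i := x)))" if "i < 2" for v i
    using assms that unfolding alternating_form_def by blast
  have "(\<lambda>x. bil \<alpha> x y) = (\<lambda>x. \<alpha> ((case_nat 0 (\<lambda>_. y))(0 := x)))"
    by (auto simp: two_form_eq_bil[OF assms])
  then show "Vector_Spaces.linear (*s) (*) (\<lambda>x. bil \<alpha> x y)" using l[of 0 "case_nat 0 (\<lambda>_. y)"] by simp
  have "bil \<alpha> x = (\<lambda>y. \<alpha> ((case_nat x (\<lambda>_. 0))(1 := y)))"
    by (auto simp: two_form_eq_bil[OF assms])
  then show "Vector_Spaces.linear (*s) (*) (bil \<alpha> x)" using l[of 1 "case_nat x (\<lambda>_. 0)"] by simp
qed

lemma bil_self: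
  assumes "alternating_form 2 \<alpha>" shows "bil \<alpha> x x = 0"
  using assms unfolding alternating_form_def bil_def
  by (metis (no_types, lifting) One_nat_def less_2_cases_iff nat.case(1) nat.case(2) zero_less_one)

text \<open>The permutation \<open>\<sigma>\<close> transported to the slots from \<open>c\<close>
  on; it describes the inner sum when a wedge product is expanded.\<close>

definition shift_perm :: "nat \<Rightarrow> (nat \<Rightarrow> nat) \<Rightarrow> nat \<Rightarrow> nat" where
  "shift_perm c \<sigma> i = (if i < c then i else c + \<sigma> (i - c))"

text \<open>Block permutation of the consecutive pairs {2l, 2l + 1}, keeping the order inside each
  pair.\<close>

definition pair_perm :: "(nat \<Rightarrow> nat) \<Rightarrow> nat \<Rightarrow> nat" where
  "pair_perm \<pi> i = 2 * \<pi> (i div 2) + i mod 2"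

lemma shift_perm:
  assumes "\<sigma> permutes {..<k}"
  shows "shift_perm c \<sigma> permutes {..<c + k} \<and> sign (shift_perm c \<sigma>) = sign \<sigma>"
  using assms finite_lessThan
proof (induction \<sigma> rule: permutes_induct)
  case id
  have "shift_perm c id = id" by (auto simp: shift_perm_def)
  then show ?case by (metis permutes_id)
next
  case (swap a b p)
  have *: "shift_perm c (Transposition.transpose a b \<circ> p) = Transposition.transpose (c + a) (c + b) \<circ> shift_perm c p"
    by (auto simp: shift_perm_def fun_eq_iff Transposition.transpose_def)
  have t: "Transposition.transpose (c + a) (c + b) permutes {..<c + k}"
    using swap by (intro permutes_swap_id) auto
  have "sign (Transposition.transpose (c + a) (c + b) \<circ> shift_perm c p) = - sign p"
    using swap t by (subst sign_compose) (auto simp: sign_swap_id intro: permutes_imp_permutation[OF finite_lessThan])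
  moreover have "sign (Transposition.transpose a b \<circ> p) = - sign p"
    using swap by (subst sign_compose)
      (auto simp: sign_swap_id intro: permutes_imp_permutation[OF finite_lessThan] permutation_swap_id)
  ultimately show ?case
    using * swap t permutes_compose by metis
qed

text \<open>A transposition of two blocks is a product of two transpositions of entries, so block
  permutations are even.\<close>

lemma pair_perm:
  assumes "\<pi> permutes {..<k}"
  shows "pair_perm \<pi> permutes {..<2 * k} \<and> sign (pair_perm \<pi>) = 1"
  using assms finite_lessThan
proof (induction \<pi> rule: permutes_induct)
  case id
  have "pair_perm id = id" by (auto simp: pair_perm_def)
  then show ?case by (metis permutes_id sign_id)
next
  case (swap a b p)
  let ?t = "Transposition.transpose (2 * a) (2 * b)" and ?t' = "Transposition.transpose (2 * a + 1) (2 * b + 1)"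
  have *: "pair_perm (Transposition.transpose a b \<circ> p) = ?t \<circ> (?t' \<circ> pair_perm p)"
  proof
    fix i :: nat
    have "i mod 2 = 0 \<or> i mod 2 = 1" by auto
    then show "pair_perm (Transposition.transpose a b \<circ> p) i = (?t \<circ> (?t' \<circ> pair_perm p)) i"
      by (auto simp: pair_perm_def Transposition.transpose_def)
  qed
  have t: "?t permutes {..<2 * k}" "?t' permutes {..<2 * k}"
    using swap by (auto intro!: permutes_swap_id)
  have P: "permutation ?t" "permutation ?t'" "permutation (pair_perm p)" "permutation (?t' \<circ> pair_perm p)"
    using swap t permutes_compose by (auto intro!: permutes_imp_permutation[OF finite_lessThan])
  have "sign (?t \<circ> (?t' \<circ> pair_perm p)) = 1"
    using swap P by (simp add: sign_compose sign_swap_id)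
  then show ?case
    using * swap t permutes_compose by metis
qed

text \<open>For each inner permutation, composing the outer one with it only reindexes the outer
  sum. The inner sum therefore contributes the factor (2k)!, which the normalisation in
  \<open>wedge\<close> cancels; the 2! left over in each step accumulates to 2^k.\<close>

lemma wedge_power_expand:
  assumes \<alpha>: "alternating_form 2 \<alpha>"
  shows "wedge_power \<alpha> k v = (\<Sum>\<sigma> | \<sigma> permutes {..<2 * k}. of_int (sign \<sigma>) *
     (\<Prod>l<k. bil \<alpha> (v (\<sigma> (2 * l))) (v (\<sigma> (Suc (2 * l)))))) / 2 ^ k"
proof (induction k arbitrary: v)
  case 0
  then show ?case by (simp add: permutes_empty)
next
  case (Suc k)
  let ?P = "\<lambda>n. {\<sigma>. \<sigma> permutes {..<n}}"
  define T where "T \<rho> = of_int (sign \<rho>) * (\<Prod>l<Suc k. bil \<alpha> (v (\<rho> (2 * l))) (v (\<rho> (Suc (2 * l)))))" for \<rho>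
  have *: "of_int (sign \<sigma>) * \<alpha> (\<lambda>i. v (\<sigma> i)) * wedge_power \<alpha> k (\<lambda>i. v (\<sigma> (2 + i)))
     = (\<Sum>\<tau>\<in>?P (2 * k). T (\<sigma> \<circ> shift_perm 2 \<tau>)) / 2 ^ k" if \<sigma>: "\<sigma> permutes {..<2 + 2 * k}" for \<sigma>
  proof -
    have "of_int (sign \<sigma>) * \<alpha> (\<lambda>i. v (\<sigma> i)) * (of_int (sign \<tau>) *
        (\<Prod>l<k. bil \<alpha> (v (\<sigma> (2 + \<tau> (2 * l)))) (v (\<sigma> (2 + \<tau> (Suc (2 * l))))))) = T (\<sigma> \<circ> shift_perm 2 \<tau>)"
      if \<tau>: "\<tau> \<in> ?P (2 * k)" for \<tau>
    proof -
      have sh: "shift_perm 2 \<tau> permutes {..<2 + 2 * k}" "sign (shift_perm 2 \<tau>) = sign \<tau>"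
        using shift_perm[of \<tau> "2 * k" 2] \<tau> by (simp_all only: mem_Collect_eq)
      then have "sign (\<sigma> \<circ> shift_perm 2 \<tau>) = sign \<sigma> * sign \<tau>"
        using \<sigma> by (simp add: sign_compose permutes_imp_permutation[OF finite_lessThan])
      moreover have "(\<Prod>l<Suc k. bil \<alpha> (v ((\<sigma> \<circ> shift_perm 2 \<tau>) (2 * l))) (v ((\<sigma> \<circ> shift_perm 2 \<tau>) (Suc (2 * l)))))
         = bil \<alpha> (v (\<sigma> 0)) (v (\<sigma> 1)) * (\<Prod>l<k. bil \<alpha> (v (\<sigma> (2 + \<tau> (2 * l)))) (v (\<sigma> (2 + \<tau> (Suc (2 * l))))))"
        by (subst prod.lessThan_Suc_shift) (simp add: shift_perm_def)
      ultimately show ?thesis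
        unfolding T_def by (simp add: two_form_eq_bil[OF \<alpha>] mult_ac)
    qed
    then show ?thesis
      unfolding Suc.IH times_divide_eq_right sum_distrib_left by simp
  qed
  have "wedge_power \<alpha> (Suc k) v = (\<Sum>\<sigma>\<in>?P (2 + 2 * k). (\<Sum>\<tau>\<in>?P (2 * k). T (\<sigma> \<circ> shift_perm 2 \<tau>)) / 2 ^ k) / (fact 2 * fact (2 * k))"
    unfolding wedge_power.simps wedge_def
    by (intro arg_cong2[where f = "(/)"] sum.cong refl) (simp only: mem_Collect_eq *)
  also have "(\<Sum>\<sigma>\<in>?P (2 + 2 * k). (\<Sum>\<tau>\<in>?P (2 * k). T (\<sigma> \<circ> shift_perm 2 \<tau>)) / 2 ^ k)
     = (\<Sum>\<tau>\<in>?P (2 * k). \<Sum>\<sigma>\<in>?P (2 + 2 * k). T (\<sigma> \<circ> shift_perm 2 \<tau>)) / 2 ^ k"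
    by (subst sum.swap) (simp add: sum_divide_distrib)
  also have "(\<Sum>\<tau>\<in>?P (2 * k). \<Sum>\<sigma>\<in>?P (2 + 2 * k). T (\<sigma> \<circ> shift_perm 2 \<tau>)) = (\<Sum>\<tau>\<in>?P (2 * k). \<Sum>\<sigma>\<in>?P (2 + 2 * k). T \<sigma>)"
    by (rule sum.cong[OF refl], rule sum_permutations_compose_right[symmetric])
       (use shift_perm in \<open>simp only: mem_Collect_eq\<close>)
  also have "\<dots> = fact (2 * k) * (\<Sum>\<sigma>\<in>?P (2 * Suc k). T \<sigma>)"
    by (simp add: card_permutations)
  finally show ?case by (simp add: T_def)
qed

text \<open>Gram matrix of a standard symplectic basis in which the entries 2l and 2l + 1 are
  partners. Integer values allow the summands of the wedge power to be compared with 0.\<close>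

definition sympl :: "nat \<Rightarrow> nat \<Rightarrow> int" where
  "sympl i j = (if even i \<and> j = Suc i then 1 else if odd i \<and> i = Suc j then -1 else 0)"

definition swap_pairs :: "nat set \<Rightarrow> nat \<Rightarrow> nat" where
  "swap_pairs N i = (if i div 2 \<in> N then if even i then Suc i else i - 1 else i)"

lemma swap_pairs:
  assumes "finite N" "N \<subseteq> {..<k}"
  shows "swap_pairs N permutes {..<2 * k} \<and> sign (swap_pairs N) = (-1) ^ card N"
  using assms
proof (induction N rule: finite_induct)
  case empty
  have "swap_pairs {} = id" by (auto simp: swap_pairs_def)
  then show ?case by (metis permutes_id sign_id card.empty power_0)
next
  case (insert l N)
  let ?t = "Transposition.transpose (2 * l) (Suc (2 * l))"
  have *: "swap_pairs (insert l N) = ?t \<circ> swap_pairs N"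
  proof
    fix i :: nat
    show "swap_pairs (insert l N) i = (?t \<circ> swap_pairs N) i"
    proof (cases "i div 2 = l")
      case True
      then have "i = 2 * l \<or> i = Suc (2 * l)" by linarith
      then show ?thesis by (rule disjE) (simp_all add: swap_pairs_def insert)
    next
      case False
      then have "swap_pairs N i div 2 \<noteq> l" by (auto simp: swap_pairs_def elim!: oddE)
      then have "?t (swap_pairs N i) = swap_pairs N i" by (auto simp: Transposition.transpose_def)
      then show ?thesis using False by (simp add: swap_pairs_def)
    qed
  qed
  have t: "?t permutes {..<2 * k}" using insert by (auto intro!: permutes_swap_id)
  have sg: "sign (?t \<circ> swap_pairs N) = (-1) ^ card (insert l N)"
    using insert t by (subst sign_compose)
      (auto simp: sign_swap_id intro: permutes_imp_permutation[OF finite_lessThan])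
  have "swap_pairs N permutes {..<2 * k}" using insert by simp
  then show ?case unfolding * using sg permutes_compose[OF _ t] by blast
qed

text \<open>A nonzero product forces \<open>\<sigma>\<close> to carry partners to partners, that is,
  to be a block permutation preceded by swaps inside the pairs of a set \<open>N\<close>. Blocks are
  even, so the sign of \<open>\<sigma>\<close> and the product both equal (-1)^card N.\<close>

lemma sympl_term_nonneg:
  assumes \<sigma>: "\<sigma> permutes {..<2 * k}"
  shows "sign \<sigma> * (\<Prod>l<k. sympl (\<sigma> (2 * l)) (\<sigma> (Suc (2 * l)))) \<ge> 0"
proof (cases "\<forall>l<k. sympl (\<sigma> (2 * l)) (\<sigma> (Suc (2 * l))) \<noteq> 0")
  case False
  then obtain l where "l \<in> {..<k}" "sympl (\<sigma> (2 * l)) (\<sigma> (Suc (2 * l))) = 0" by blast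
  then have "(\<Prod>l<k. sympl (\<sigma> (2 * l)) (\<sigma> (Suc (2 * l)))) = 0"
    by (intro prod_zero) auto
  then show ?thesis by (simp only: mult_zero_right order_refl)
next
  case True
  \<comment> \<open>\<open>N\<close> collects the pairs whose order is reversed, and
    \<open>\<pi>\<close> records the block to which each pair goes, extended by the identity so that
    it permutes the naturals.\<close>
  define N where "N = {l. l < k \<and> odd (\<sigma> (2 * l))}"
  define \<pi> where "\<pi> l = (if l < k then \<sigma> (2 * l) div 2 else l)" for l
  have N: "finite N" "N \<subseteq> {..<k}" by (auto simp: N_def)
  have inj: "\<sigma> i = \<sigma> j \<longleftrightarrow> i = j" for i j using permutes_inj[OF \<sigma>] by (auto simp: inj_def)
  have less: "\<sigma> i < 2 * k \<longleftrightarrow> i < 2 * k" for i using permutes_in_image[OF \<sigma>, of i] by simp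
  have N1: "\<sigma> (2 * l) = Suc (2 * \<pi> l) \<and> \<sigma> (Suc (2 * l)) = 2 * \<pi> l" if "l \<in> N" for l
  proof -
    have l: "l < k" "odd (\<sigma> (2 * l))" using that by (auto simp: N_def)
    have "sympl (\<sigma> (2 * l)) (\<sigma> (Suc (2 * l))) \<noteq> 0" using True l by blast
    then show ?thesis using l by (auto simp: sympl_def \<pi>_def split: if_splits)
  qed
  have N2: "\<sigma> (2 * l) = 2 * \<pi> l \<and> \<sigma> (Suc (2 * l)) = Suc (2 * \<pi> l)" if "l \<notin> N" "l < k" for l
  proof -
    have l: "even (\<sigma> (2 * l))" using that by (auto simp: N_def)
    have "sympl (\<sigma> (2 * l)) (\<sigma> (Suc (2 * l))) \<noteq> 0" using True that by blast
    then show ?thesis using l that by (auto simp: sympl_def \<pi>_def split: if_splits)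
  qed
  have "inj_on \<pi> {..<k}"
  proof (rule inj_onI)
    fix l m :: nat assume lm: "l \<in> {..<k}" "m \<in> {..<k}" "\<pi> l = \<pi> m"
    have "2 * l \<noteq> Suc (2 * m)" "2 * m \<noteq> Suc (2 * l)" by presburger+
    then have "\<sigma> (2 * l) \<noteq> \<sigma> (Suc (2 * m))" "\<sigma> (2 * m) \<noteq> \<sigma> (Suc (2 * l))" using inj by blast+
    moreover have "\<sigma> (2 * l) = \<sigma> (2 * m) \<or> \<sigma> (2 * l) = \<sigma> (Suc (2 * m)) \<or> \<sigma> (2 * m) = \<sigma> (Suc (2 * l))"
      using N1[of l] N1[of m] N2[of l] N2[of m] lm by (cases "l \<in> N"; cases "m \<in> N") simp_all
    ultimately show "l = m" using inj[of "2 * l" "2 * m"] by simp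
  qed
  moreover have "\<pi> ` {..<k} \<subseteq> {..<k}"
  proof (intro image_subsetI)
    fix l assume "l \<in> {..<k}"
    then have "\<sigma> (2 * l) < 2 * k" using less by auto
    then show "\<pi> l \<in> {..<k}" using \<open>l \<in> {..<k}\<close> by (auto simp: \<pi>_def)
  qed
  ultimately have "bij_betw \<pi> {..<k} {..<k}" by (simp add: bij_betw_def endo_inj_surj)
  then have \<pi>: "\<pi> permutes {..<k}" by (rule bij_imp_permutes) (simp add: \<pi>_def)
  have "\<sigma> = pair_perm \<pi> \<circ> swap_pairs N"
  proof
    fix i :: nat
    define l where "l = i div 2"
    have i: "i = 2 * l \<or> i = Suc (2 * l)" unfolding l_def by linarith
    show "\<sigma> i = (pair_perm \<pi> \<circ> swap_pairs N) i"
    proof (cases "l < k")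
      case True
      then show ?thesis
        using i N1[of l] N2[of l] by (cases "l \<in> N") (auto simp: pair_perm_def swap_pairs_def)
    next
      case False
      then have "\<sigma> i = i" "l \<notin> N" "\<pi> l = l"
        using i N permutes_not_in[OF \<sigma>, of i] by (auto simp: \<pi>_def)
      then show ?thesis using i by (auto simp: pair_perm_def swap_pairs_def)
    qed
  qed
  then have "sign \<sigma> = (-1) ^ card N"
    using pair_perm[OF \<pi>] swap_pairs[OF N]
    by (auto simp: sign_compose[OF permutes_imp_permutation[OF finite_lessThan] permutes_imp_permutation[OF finite_lessThan]])
  moreover have "(\<Prod>l<k. sympl (\<sigma> (2 * l)) (\<sigma> (Suc (2 * l)))) = (\<Prod>l<k. if l \<in> N then -1 else 1)"
    by (rule prod.cong) (use N1 N2 in \<open>auto simp: sympl_def\<close>)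
  moreover have "(\<Prod>l<k. if l \<in> N then -1 else (1::int)) = (-1) ^ card N"
    using N by (simp add: prod.If_cases Int_absorb1)
  ultimately show ?thesis by (simp add: power_mult_distrib[symmetric])
qed

text \<open>No cancellation can occur: every summand is nonnegative and the identity contributes
  1.\<close>

lemma wedge_power_sympl_nonzero:
  assumes \<alpha>: "alternating_form 2 \<alpha>"
    and b: "\<And>i j. i < 2 * k \<Longrightarrow> j < 2 * k \<Longrightarrow> bil \<alpha> (b i) (b j) = of_int (sympl i j)"
  shows "wedge_power \<alpha> k b \<noteq> 0"
proof -
  let ?P = "{\<sigma>. \<sigma> permutes {..<2 * k}}"
  let ?T = "\<lambda>\<sigma>. sign \<sigma> * (\<Prod>l<k. sympl (\<sigma> (2 * l)) (\<sigma> (Suc (2 * l))))"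
  have "wedge_power \<alpha> k b = of_int (\<Sum>\<sigma>\<in>?P. ?T \<sigma>) / 2 ^ k"
    unfolding wedge_power_expand[OF \<alpha>] of_int_sum
  proof (intro arg_cong2[where f = "(/)"] sum.cong refl)
    fix \<sigma> assume "\<sigma> \<in> ?P"
    then have "\<sigma> i < 2 * k" if "i < 2 * k" for i using permutes_in_image[of \<sigma> "{..<2 * k}" i] that by simp
    then show "of_int (sign \<sigma>) * (\<Prod>l<k. bil \<alpha> (b (\<sigma> (2 * l))) (b (\<sigma> (Suc (2 * l))))) = of_int (?T \<sigma>)"
      by (auto simp: b intro!: prod.cong)
  qed
  moreover have "?T id \<le> (\<Sum>\<sigma>\<in>?P. ?T \<sigma>)"
  proof (rule member_le_sum)
    show "id \<in> ?P" by (simp only: mem_Collect_eq permutes_id)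
    show "finite ?P" by (rule finite_permutations) simp
    show "0 \<le> ?T \<sigma>" if "\<sigma> \<in> ?P - {id}" for \<sigma> using that sympl_term_nonneg by blast
  qed
  moreover have "?T id = 1" by (simp add: sympl_def)
  ultimately have "wedge_power \<alpha> k b = of_int (\<Sum>\<sigma>\<in>?P. ?T \<sigma>) / 2 ^ k" "(\<Sum>\<sigma>\<in>?P. ?T \<sigma>) \<noteq> 0"
    by linarith+
  then show ?thesis by (simp only: divide_eq_0_iff of_int_eq_0_iff) simp
qed

section \<open>Alternating bilinear forms and partial symplectic bases\<close>

definition alt_bil :: "(complex^'m \<Rightarrow> complex^'m \<Rightarrow> complex) \<Rightarrow> bool" where
  "alt_bil B \<longleftrightarrow> (\<forall>y. Vector_Spaces.linear (*s) (*) (\<lambda>x. B x y)) \<and>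
     (\<forall>x. Vector_Spaces.linear (*s) (*) (B x)) \<and> (\<forall>x. B x x = 0)"

lemma alt_bil_bil: "alternating_form 2 \<alpha> \<Longrightarrow> alt_bil (bil \<alpha>)"
  unfolding alt_bil_def using bil_linear bil_self by blast

lemma alt_bilD:
  assumes "alt_bil B"
  shows "B (x + x') y = B x y + B x' y" "B (c *s x) y = c * B x y" "B x (y + y') = B x y + B x y'"
    "B x (c *s y) = c * B x y" "B x x = 0" "B 0 y = 0" "B x 0 = 0"
    "B (sum f S) y = (\<Sum>i\<in>S. B (f i) y)" "B x (sum f S) = (\<Sum>i\<in>S. B x (f i))"
proof -
  have l: "Vector_Spaces.linear (*s) (*) (\<lambda>x. B x y)" and r: "Vector_Spaces.linear (*s) (*) (B x)" for x y
    using assms by (auto simp: alt_bil_def)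
  show "B (x + x') y = B x y + B x' y" "B (c *s x) y = c * B x y" "B 0 y = 0" "B (sum f S) y = (\<Sum>i\<in>S. B (f i) y)"
    by (fact clinear_add[OF l] clinear_scale[OF l] clinear_0[OF l] clinear_sum[OF l])+
  show "B x (y + y') = B x y + B x y'" "B x (c *s y) = c * B x y" "B x 0 = 0" "B x (sum f S) = (\<Sum>i\<in>S. B x (f i))"
    by (fact clinear_add[OF r] clinear_scale[OF r] clinear_0[OF r] clinear_sum[OF r])+
  show "B x x = 0" using assms by (simp add: alt_bil_def)
qed

lemma alt_bil_diff:
  assumes "alt_bil B"
  shows "B (x - x') y = B x y - B x' y" "B x (y - y') = B x y - B x y'"
proof -
  show "B (x - x') y = B x y - B x' y" using alt_bilD(1)[OF assms, of "x - x'" x' y] by simp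
  show "B x (y - y') = B x y - B x y'" using alt_bilD(3)[OF assms, of x "y - y'" y'] by simp
qed

lemma alt_bil_swap: assumes "alt_bil B" shows "B y x = - B x y"
proof -
  have "0 = B (x + y) (x + y)" by (simp only: alt_bilD(5)[OF assms])
  also have "\<dots> = B x x + B x y + (B y x + B y y)" by (simp only: alt_bilD(1,3)[OF assms] add_ac)
  finally have "B x y + B y x = 0" by (simp add: alt_bilD(5)[OF assms])
  then show ?thesis by (simp add: eq_neg_iff_add_eq_0 add.commute)
qed

definition bil_ker :: "(complex^'m \<Rightarrow> complex^'m \<Rightarrow> complex) \<Rightarrow> (complex^'m) set" where
  "bil_ker B = {x. \<forall>y. B x y = 0}"

definition sympl_family :: "(complex^'m \<Rightarrow> complex^'m \<Rightarrow> complex) \<Rightarrow> (nat \<Rightarrow> complex^'m) \<Rightarrow> nat \<Rightarrow> bool" where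
  "sympl_family B b r \<longleftrightarrow> (\<forall>i<2 * r. \<forall>j<2 * r. B (b i) (b j) = of_int (sympl i j))"

text \<open>Index of the symplectic partner; the subtraction is reached only for odd, hence
  positive, indices.\<close>

definition mate :: "nat \<Rightarrow> nat" where "mate i = (if even i then Suc i else i - 1)"

lemma mate: "i < 2 * r \<Longrightarrow> mate i < 2 * r" "mate (mate i) = i" "mate i = mate j \<longleftrightarrow> i = j"
  by (auto simp: mate_def elim!: evenE oddE) presburger+

lemma sympl_mate: "sympl i j = (if j = mate i then if even i then 1 else -1 else 0)"
  by (auto simp: sympl_def mate_def)

lemma sympl_coeff:
  assumes B: "alt_bil B" and b: "sympl_family B b r" and i: "i < 2 * r"
  shows "B (\<Sum>j<2 * r. c j *s b j) (b (mate i)) = c i * of_int (sympl i (mate i))"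
proof -
  have "B (\<Sum>j<2 * r. c j *s b j) (b (mate i)) = (\<Sum>j<2 * r. c j * of_int (sympl j (mate i)))"
    using b mate(1)[OF i] by (simp add: alt_bilD(8,2)[OF B] sympl_family_def)
  also have "\<dots> = (\<Sum>j<2 * r. if j = i then c i * of_int (sympl i (mate i)) else 0)"
    by (rule sum.cong) (auto simp: sympl_mate mate(3))
  finally show ?thesis using i by simp
qed

text \<open>Projection onto the span of the family: pairing with the partner reads off a coefficient
  up to a sign, and multiplying by that sign corrects it because its square is 1.\<close>

lemma sympl_proj:
  assumes B: "alt_bil B" and b: "sympl_family B b r"
  obtains c where "\<And>j. j < 2 * r \<Longrightarrow> B (x - (\<Sum>i<2 * r. c i *s b i)) (b j) = 0"
proof -
  define c where "c i = B x (b (mate i)) * of_int (sympl i (mate i))" for i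
  have "B (x - (\<Sum>i<2 * r. c i *s b i)) (b j) = 0" if "j < 2 * r" for j
  proof -
    have "B (\<Sum>i<2 * r. c i *s b i) (b (mate (mate j))) = c (mate j) * of_int (sympl (mate j) (mate (mate j)))"
      by (rule sympl_coeff[OF B b mate(1)[OF that]])
    then show ?thesis by (simp add: alt_bil_diff[OF B] mate(2) c_def sympl_mate)
  qed
  then show thesis by (rule that)
qed

lemma sympl_family_independent:
  assumes B: "alt_bil B" and b: "sympl_family B b r"
    and k: "B k = (\<lambda>y. 0)" and e: "(\<Sum>j<2 * r. c j *s b j) + k = 0" and i: "i < 2 * r"
  shows "c i = 0"
proof -
  have "B ((\<Sum>j<2 * r. c j *s b j) + k) (b (mate i)) = 0" unfolding e by (rule alt_bilD(6)[OF B])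
  then have "c i * of_int (sympl i (mate i)) = 0"
    using k by (simp add: alt_bilD(1)[OF B] sympl_coeff[OF B b i])
  then show ?thesis by (simp add: sympl_mate split: if_splits)
qed

lemma sympl_family_inj:
  assumes B: "alt_bil B" and b: "sympl_family B b r"
  shows "inj_on b {..<2 * r}"
proof (rule inj_onI)
  fix i j assume ij: "i \<in> {..<2 * r}" "j \<in> {..<2 * r}" "b i = b j"
  then have "of_int (sympl i (mate i)) = (of_int (sympl j (mate i)) :: complex)"
    using b mate(1) unfolding sympl_family_def by (metis lessThan_iff)
  then show "i = j" by (auto simp: sympl_mate mate(3) split: if_splits)
qed

text \<open>Pairing a vanishing combination with a partner removes the kernel part and isolates one
  coefficient, so the family and the kernel vectors are independent together. The inequality bounds
  the length of symplectic families and starts the dimension count for the kernel.\<close>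

lemma sympl_family_card:
  fixes b :: "nat \<Rightarrow> complex^'m"
  assumes B: "alt_bil B" and b: "sympl_family B b r" and Kb: "vec.independent Kb" "Kb \<subseteq> bil_ker B"
  shows "finite Kb" "b ` {..<2 * r} \<inter> Kb = {}" "2 * r + card Kb \<le> CARD('m)"
proof -
  show fK: "finite Kb" using Kb(1) by (rule vec.finiteI_independent)
  have inj: "inj_on b {..<2 * r}" by (rule sympl_family_inj[OF B b])
  have ker: "B k = (\<lambda>y. 0)" if "k \<in> vec.span Kb" for k
  proof -
    have "k \<in> bil_ker B"
      using that
    proof (induction rule: vec.span_induct)
      case base
      show ?case unfolding vec.subspace_def bil_ker_def by (auto simp: alt_bilD[OF B])
    qed (use Kb(2) in blast)
    then show ?thesis by (auto simp: bil_ker_def)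
  qed
  show disj: "b ` {..<2 * r} \<inter> Kb = {}"
  proof -
    have False if i: "i < 2 * r" "b i \<in> Kb" for i
    proof -
      have "B (b i) (b (mate i)) = 0" using ker[OF vec.span_base[OF i(2)]] by simp
      then show False using b i(1) mate(1)[OF i(1)] by (simp add: sympl_family_def sympl_mate split: if_splits)
    qed
    then show ?thesis by auto
  qed
  have "vec.independent (b ` {..<2 * r} \<union> Kb)"
  proof (rule vec.independent_if_scalars_zero)
    show "finite (b ` {..<2 * r} \<union> Kb)" using fK by simp
    fix f x assume s0: "(\<Sum>x\<in>b ` {..<2 * r} \<union> Kb. f x *s x) = 0" and x: "x \<in> b ` {..<2 * r} \<union> Kb"
    let ?k = "\<Sum>x\<in>Kb. f x *s x"
    have e: "(\<Sum>j<2 * r. f (b j) *s b j) + ?k = 0"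
      using s0 fK disj by (subst (asm) sum.union_disjoint) (auto simp: sum.reindex[OF inj])
    have k: "?k \<in> vec.span Kb" by (intro vec.span_sum vec.span_scale vec.span_base)
    have z: "f (b j) = 0" if "j < 2 * r" for j
      by (rule sympl_family_independent[OF B b ker[OF k] e that])
    then have "?k = 0" using e by simp
    then have "f y = 0" if "y \<in> Kb" for y
      using vec.independentD[OF Kb(1) fK subset_refl _ that] by blast
    with z x show "f x = 0" by auto
  qed
  from vec.independent_card_le_dim[OF subset_UNIV this]
  have "card (b ` {..<2 * r} \<union> Kb) \<le> CARD('m)" by (simp add: card_cart_basis)
  then show "2 * r + card Kb \<le> CARD('m)"
    using fK disj inj by (simp add: card_Un_disjoint card_image)
qed

lemma sympl_family_extend:
  assumes B: "alt_bil B" and b: "sympl_family B b r"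
    and xy: "\<And>j. j < 2 * r \<Longrightarrow> B x (b j) = 0" "\<And>j. j < 2 * r \<Longrightarrow> B y (b j) = 0" "B x y \<noteq> 0"
  shows "sympl_family B (b(2 * r := x, Suc (2 * r) := inverse (B x y) *s y)) (Suc r)"
  unfolding sympl_family_def
proof (intro allI impI)
  have yx: "B (b j) x = 0" "B (b j) y = 0" if "j < 2 * r" for j
    using xy(1,2)[OF that] alt_bil_swap[OF B] by (metis neg_equal_0_iff_equal)+
  have yx': "B y x = - B x y" by (rule alt_bil_swap[OF B])
  fix i j assume "i < 2 * Suc r" "j < 2 * Suc r"
  then have "i < 2 * r \<or> i = 2 * r \<or> i = Suc (2 * r)" and "j < 2 * r \<or> j = 2 * r \<or> j = Suc (2 * r)"
    by auto
  then consider "i < 2 * r" | "i = 2 * r" | "i = Suc (2 * r)" by blast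
  note ci = this
  consider "j < 2 * r" | "j = 2 * r" | "j = Suc (2 * r)"
    using \<open>j < 2 * r \<or> j = 2 * r \<or> j = Suc (2 * r)\<close> by blast
  note cj = this
  show "B ((b(2 * r := x, Suc (2 * r) := inverse (B x y) *s y)) i) ((b(2 * r := x, Suc (2 * r) := inverse (B x y) *s y)) j)
     = of_int (sympl i j)"
    using ci
  proof cases
    case 1
    have m: "mate i < 2 * r" using mate(1)[OF 1] .
    from cj show ?thesis
    proof cases
      case 1
      then show ?thesis using \<open>i < 2 * r\<close> b by (simp add: sympl_family_def)
    qed (use 1 m yx in \<open>simp_all add: sympl_mate alt_bilD[OF B]\<close>)
  next
    case 2
    from cj show ?thesis
      by cases (use 2 xy in \<open>simp_all add: sympl_mate mate_def alt_bilD[OF B]\<close>)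
  next
    case 3
    from cj show ?thesis
      by cases (use 3 xy yx' in \<open>simp_all add: sympl_mate mate_def alt_bilD[OF B]\<close>)
  qed
qed

text \<open>Greedy completion by hyperbolic pairs, which ends because 2r cannot exceed the
  dimension. The given vectors stay at the front, so that a prescribed vector can be made the first
  member of a maximal family, as in \<open>kernel\<close>.\<close>

lemma sympl_family_maximal:
  fixes b :: "nat \<Rightarrow> complex^'m"
  assumes B: "alt_bil B" and b: "sympl_family B b r"
  obtains r' b' where "sympl_family B b' r'" "r \<le> r'" "\<And>i. i < 2 * r \<Longrightarrow> b' i = b i"
    "\<And>x. (\<And>j. j < 2 * r' \<Longrightarrow> B x (b' j) = 0) \<Longrightarrow> x \<in> bil_ker B"
  using b
proof (induction "CARD('m) - 2 * r" arbitrary: r b thesis rule: less_induct)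
  case less
  show ?case
  proof (cases "\<forall>x. (\<forall>j<2 * r. B x (b j) = 0) \<longrightarrow> x \<in> bil_ker B")
    case True
    then show ?thesis by (intro less.prems(1)[OF less.prems(2)]) auto
  next
    case False
    then obtain x z where x: "\<And>j. j < 2 * r \<Longrightarrow> B x (b j) = 0" and z: "B x z \<noteq> 0"
      by (auto simp: bil_ker_def)
    obtain c where c: "\<And>j. j < 2 * r \<Longrightarrow> B (z - (\<Sum>i<2 * r. c i *s b i)) (b j) = 0"
      by (rule sympl_proj[OF B less.prems(2), where x = z]) (rule that)
    \<comment> \<open>Removing the projection makes \<open>z\<close> orthogonal to the family; as
      \<open>x\<close> is orthogonal to it already, the pairing with \<open>x\<close> is
      unchanged.\<close>
    let ?y = "z - (\<Sum>i<2 * r. c i *s b i)"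
    have "B x ?y = B x z"
      using x by (simp add: alt_bil_diff[OF B] alt_bilD[OF B])
    then have xy: "B x ?y \<noteq> 0" using z by simp
    define b'' where "b'' = b(2 * r := x, Suc (2 * r) := inverse (B x ?y) *s ?y)"
    have b'': "sympl_family B b'' (Suc r)"
      unfolding b''_def by (rule sympl_family_extend[OF B less.prems(2) x c xy])
    have "2 * Suc r + card ({} :: (complex^'m) set) \<le> CARD('m)"
      by (rule sympl_family_card(3)[OF B b'']) (auto simp: vec.independent_empty)
    then have lt: "CARD('m) - 2 * Suc r < CARD('m) - 2 * r" by simp
    show ?thesis
    proof (rule less.hyps[OF lt _ b''])
      fix r' b' assume r': "sympl_family B b' r'" "Suc r \<le> r'" "\<And>i. i < 2 * Suc r \<Longrightarrow> b' i = b'' i"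
        "\<And>x. (\<And>j. j < 2 * r' \<Longrightarrow> B x (b' j) = 0) \<Longrightarrow> x \<in> bil_ker B"
      show thesis
        by (rule less.prems(1)[OF r'(1) _ _ r'(4)]) (use r'(2,3) in \<open>auto simp: b''_def\<close>)
    qed
  qed
qed

text \<open>What remains of a vector after projection is orthogonal to the family, hence in the
  kernel by maximality.\<close>

lemma sympl_family_span:
  assumes B: "alt_bil B" and b: "sympl_family B b r"
    and max: "\<And>x. (\<And>j. j < 2 * r \<Longrightarrow> B x (b j) = 0) \<Longrightarrow> x \<in> bil_ker B"
    and Kb: "bil_ker B \<subseteq> vec.span Kb"
  shows "vec.span (b ` {..<2 * r} \<union> Kb) = UNIV"
proof -
  have "x \<in> vec.span (b ` {..<2 * r} \<union> Kb)" for x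
  proof -
    obtain c where c: "\<And>j. j < 2 * r \<Longrightarrow> B (x - (\<Sum>i<2 * r. c i *s b i)) (b j) = 0"
      by (rule sympl_proj[OF B b, where x = x]) (rule that)
    have "x - (\<Sum>i<2 * r. c i *s b i) \<in> vec.span (b ` {..<2 * r} \<union> Kb)"
      using max[OF c] Kb vec.span_mono[of Kb "b ` {..<2 * r} \<union> Kb"] by blast
    moreover have "(\<Sum>i<2 * r. c i *s b i) \<in> vec.span (b ` {..<2 * r} \<union> Kb)"
      by (intro vec.span_sum vec.span_scale vec.span_base) auto
    ultimately have "x - (\<Sum>i<2 * r. c i *s b i) + (\<Sum>i<2 * r. c i *s b i) \<in> vec.span (b ` {..<2 * r} \<union> Kb)"
      by (rule vec.span_add)
    then show ?thesis by simp
  qed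
  then show ?thesis by blast
qed

text \<open>Multilinearity allows the arguments to be replaced, one slot at a time, by elements of a
  spanning set while the value stays nonzero; alternation then makes them distinct.\<close>

lemma alternating_form_nonzero_on_span:
  fixes \<Omega> :: "'m::finite form"
  assumes \<Omega>: "alternating_form k \<Omega>" "\<Omega> v \<noteq> 0" and S: "vec.span S = UNIV"
  obtains u where "\<And>i. i < k \<Longrightarrow> u i \<in> S" "\<Omega> u \<noteq> 0" "inj_on u {..<k}"
proof -
  have "\<exists>u. (\<forall>i<m. u i \<in> S) \<and> \<Omega> u \<noteq> 0" if "m \<le> k" for m
    using that
  proof (induction m)
    case 0
    then show ?case using \<Omega> by auto
  next
    case (Suc m)
    then obtain u where u: "\<forall>i<m. u i \<in> S" "\<Omega> u \<noteq> 0" by auto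
    have lin: "Vector_Spaces.linear (*s) (*) (\<lambda>x. \<Omega> (u(m := x)))"
      using \<Omega>(1) Suc.prems unfolding alternating_form_def by (meson Suc_le_lessD)
    have "\<exists>x\<in>S. \<Omega> (u(m := x)) \<noteq> 0"
    proof (rule ccontr)
      assume n: "\<not> (\<exists>x\<in>S. \<Omega> (u(m := x)) \<noteq> 0)"
      have "u m \<in> vec.span S" using S by simp
      then have "\<Omega> (u(m := u m)) = 0"
      proof (induction rule: vec.span_induct)
        case base
        show ?case unfolding vec.subspace_def
          by (auto simp: clinear_0[OF lin] clinear_add[OF lin] clinear_scale[OF lin])
      qed (use n in blast)
      then show False using u by simp
    qed
    then obtain x where "x \<in> S" "\<Omega> (u(m := x)) \<noteq> 0" by blast
    then show ?case using u by (intro exI[of _ "u(m := x)"] conjI) (simp add: less_Suc_eq, assumption)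
  qed
  then obtain u where u: "\<forall>i<k. u i \<in> S" "\<Omega> u \<noteq> 0" by auto
  have "u i \<noteq> u j" if "i < j" "j < k" for i j
    using \<Omega>(1) u(2) that unfolding alternating_form_def by blast
  then have "inj_on u {..<k}" by (intro inj_onI) (metis lessThan_iff linorder_neqE_nat)
  with u show thesis using that by blast
qed

text \<open>In the expansion every permutation places \<open>x\<close>, the argument with index 0,
  in some factor, and that factor vanishes.\<close>

lemma wedge_power_ker_subset:
  assumes \<alpha>: "alternating_form 2 \<alpha>" and x: "x \<in> bil_ker (bil \<alpha>)" and k: "k > 0"
  shows "x \<in> form_ker (wedge_power \<alpha> k)"
proof -
  note B = alt_bil_bil[OF \<alpha>]
  have x0: "bil \<alpha> x y = 0" "bil \<alpha> y x = 0" for y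
    using x alt_bil_swap[OF B, of x y] by (auto simp: bil_ker_def)
  have "wedge_power \<alpha> k (case_nat x w) = 0" for w
  proof -
    have *: "(\<Prod>l<k. bil \<alpha> (case_nat x w (\<sigma> (2 * l))) (case_nat x w (\<sigma> (Suc (2 * l))))) = 0"
      if \<sigma>: "\<sigma> permutes {..<2 * k}" for \<sigma>
    proof -
      have "0 \<in> \<sigma> ` {..<2 * k}" using k permutes_image[OF \<sigma>] by simp
      then obtain m where m: "m < 2 * k" "\<sigma> m = 0" by auto
      have "m = 2 * (m div 2) \<or> m = Suc (2 * (m div 2))" by linarith
      then have "bil \<alpha> (case_nat x w (\<sigma> (2 * (m div 2)))) (case_nat x w (\<sigma> (Suc (2 * (m div 2))))) = 0"
        using m(2) x0 by (metis nat.case(1))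
      moreover have "m div 2 \<in> {..<k}" using m(1) by auto
      ultimately show ?thesis by (intro prod_zero) blast+
    qed
    have "(\<Sum>\<sigma> | \<sigma> permutes {..<2 * k}. of_int (sign \<sigma>) *
        (\<Prod>l<k. bil \<alpha> (case_nat x w (\<sigma> (2 * l))) (case_nat x w (\<sigma> (Suc (2 * l)))))) = (0 :: complex)"
      by (rule sum.neutral, rule ballI) (simp only: mem_Collect_eq * mult_zero_right)
    then show ?thesis unfolding wedge_power_expand[OF \<alpha>] by (simp only: div_0)
  qed
  then show ?thesis by (simp add: form_ker_def iprod_def)
qed

section \<open>The kernel at the origin when the Martinet hypersurface is smooth\<close>

locale smooth_martinet =
  fixes n :: nat and \<omega> \<Omega> :: "'m::finite diff_form" and f :: "complex^'m \<Rightarrow> complex" and U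
  assumes card: "CARD('m) = 2 * n"
    and U: "open U" "0 \<in> U"
    and alt: "\<And>p. p \<in> U \<Longrightarrow> alternating_form 2 (\<omega> p)"
    and cd: "\<And>v. cdiff (\<lambda>p. \<omega> p v) 0"
    and f: "cdiff f 0" "f 0 = 0" "fder f 0 \<noteq> (\<lambda>v. 0)"
    and \<Omega>: "alternating_form (2 * n) (\<Omega> 0)" "\<Omega> 0 \<noteq> (\<lambda>v. 0)" "\<And>v. cdiff (\<lambda>p. \<Omega> p v) 0"
    and wp: "\<And>p v. p \<in> U \<Longrightarrow> wedge_power (\<omega> p) n v = f p * \<Omega> p v"
begin

abbreviation K where "K \<equiv> bil_ker (bil (\<omega> 0))"

lemma B: "alt_bil (bil (\<omega> 0))"
  by (rule alt_bil_bil[OF alt[OF U(2)]])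

lemma cdiff_bil: "cdiff (\<lambda>p. bil (\<omega> p) x y) 0"
  unfolding bil_def by (rule cd)

text \<open>Since \<open>f\<close> vanishes to first order only, in some summand of the wedge power all but one
  factor are nonzero at the origin.\<close>

lemma one_degenerate_pair:
  assumes u: "\<Omega> 0 u \<noteq> 0"
  obtains \<sigma> l w where "\<sigma> permutes {..<2 * n}" "l < n"
    "fder (\<lambda>p. bil (\<omega> p) (u (\<sigma> (2 * l))) (u (\<sigma> (Suc (2 * l))))) 0 w \<noteq> 0"
    "\<And>m. m < n \<Longrightarrow> m \<noteq> l \<Longrightarrow> bil (\<omega> 0) (u (\<sigma> (2 * m))) (u (\<sigma> (Suc (2 * m)))) \<noteq> 0"
proof -
  obtain w where w: "fder f 0 w \<noteq> 0" using f(3) by auto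
  let ?b = "\<lambda>\<sigma> l p. bil (\<omega> p) (u (\<sigma> (2 * l))) (u (\<sigma> (Suc (2 * l))))"
  let ?P = "{\<sigma>. \<sigma> permutes {..<2 * n}}"
  \<comment> \<open>Leibniz rule applied to the expansion of the wedge power; as f 0 = 0, the same
    derivative is df at 0 times the value of the volume form on \<open>u\<close>.\<close>
  let ?D = "\<lambda>h. (\<Sum>\<sigma>\<in>?P. of_int (sign \<sigma>) * (\<Sum>l<n. fder (?b \<sigma> l) 0 h * (\<Prod>m\<in>{..<n} - {l}. ?b \<sigma> m 0))) / 2 ^ n"
  have "((\<lambda>p. (\<Sum>\<sigma>\<in>?P. of_int (sign \<sigma>) * (\<Prod>l<n. ?b \<sigma> l p)) / 2 ^ n) has_derivative ?D) (at 0)"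
    by (rule bounded_linear.has_derivative[OF bounded_linear_divide], intro has_derivative_sum has_derivative_mult_right has_derivative_prod
        cdiff_has_derivative cdiff_bil)
  then have "((\<lambda>p. f p * \<Omega> p u) has_derivative ?D) (at 0)"
    by (rule has_derivative_transform_within_open[OF _ U])
       (simp add: wp[symmetric] wedge_power_expand[OF alt])
  then have "?D w = fder f 0 w * \<Omega> 0 u"
    using cdiff_fder_mult(2)[OF f(1) \<Omega>(3)[of u]] f(2) fder_eq by (metis (no_types, lifting) add_0 mult_zero_left)
  then have D: "?D w \<noteq> 0" using w u by simp
  have "\<exists>\<sigma>\<in>?P. of_int (sign \<sigma>) * (\<Sum>l<n. fder (?b \<sigma> l) 0 w * (\<Prod>m\<in>{..<n} - {l}. ?b \<sigma> m 0)) \<noteq> 0"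
  proof (rule ccontr)
    assume "\<not> ?thesis"
    then have "?D w = 0" by (simp add: sum.neutral)
    with D show False by blast
  qed
  then obtain \<sigma> where \<sigma>: "\<sigma> permutes {..<2 * n}"
    and s: "(\<Sum>l<n. fder (?b \<sigma> l) 0 w * (\<Prod>m\<in>{..<n} - {l}. ?b \<sigma> m 0)) \<noteq> 0" by auto
  then obtain l where l: "l < n" "fder (?b \<sigma> l) 0 w * (\<Prod>m\<in>{..<n} - {l}. ?b \<sigma> m 0) \<noteq> 0"
    by (metis (no_types, lifting) lessThan_iff sum.neutral)
  have "?b \<sigma> m 0 \<noteq> 0" if "m < n" "m \<noteq> l" for m
  proof
    assume z: "?b \<sigma> m 0 = 0"
    have "(\<Prod>m\<in>{..<n} - {l}. ?b \<sigma> m 0) = 0"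
      by (rule prod_zero[OF _ bexI[of _ m]]) (use z that in auto)
    with l(2) show False by simp
  qed
  then show thesis using that[OF \<sigma> l(1)] l(2) by force
qed

text \<open>A dimension count. \<open>b\<close> and \<open>Kb\<close> together form a basis, and r =
  n would make the n-th power nonzero at 0. In the summand from \<open>one_degenerate_pair\<close> a
  kernel vector can sit only in the exceptional factor, which has two places; so \<open>Kb\<close>
  has at most two elements, and 2 r + card Kb = 2 n with r < n leaves exactly two. The exceptional
  factor then pairs these two vectors, and its derivative is nonzero.\<close>

lemma kernel_basis:
  assumes b: "sympl_family (bil (\<omega> 0)) b r"
    and max: "\<And>x. (\<And>j. j < 2 * r \<Longrightarrow> bil (\<omega> 0) x (b j) = 0) \<Longrightarrow> x \<in> K"
    and Kb: "vec.independent Kb" "Kb \<subseteq> K" "K \<subseteq> vec.span Kb"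
  shows "card Kb = 2" "Suc r = n"
    "\<And>k1 k2. k1 \<in> Kb \<Longrightarrow> k2 \<in> Kb \<Longrightarrow> k1 \<noteq> k2 \<Longrightarrow> \<exists>w. fder (\<lambda>p. bil (\<omega> p) k1 k2) 0 w \<noteq> 0"
proof -
  let ?S = "b ` {..<2 * r} \<union> Kb"
  have fK: "finite Kb" and le: "2 * r + card Kb \<le> 2 * n"
    using sympl_family_card[OF B b Kb(1,2)] card by auto
  have fS: "finite ?S" using fK by simp
  have cS: "card ?S \<le> 2 * r + card Kb"
    using card_Un_le[of "b ` {..<2 * r}" Kb] card_image_le[of "{..<2 * r}" b] by simp
  have span: "vec.span ?S = UNIV" by (rule sympl_family_span[OF B b max Kb(3)])
  have "2 * n \<le> card ?S"
    using vec.dim_le_card[of UNIV ?S] span fS card by (simp add: card_cart_basis)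
  with cS le have eq: "2 * r + card Kb = 2 * n" "card ?S = 2 * n" by auto
  have r: "r < n"
  proof (rule ccontr)
    assume "\<not> r < n"
    then have "r = n" using eq by auto
    then have "wedge_power (\<omega> 0) n b \<noteq> 0"
      using b by (intro wedge_power_sympl_nonzero[OF alt[OF U(2)]]) (auto simp: sympl_family_def)
    then show False using wp[OF U(2)] f(2) by simp
  qed
  obtain v where "\<Omega> 0 v \<noteq> 0" using \<Omega>(2) by auto
  obtain u where u: "\<And>i. i < 2 * n \<Longrightarrow> u i \<in> ?S" "\<Omega> 0 u \<noteq> 0" "inj_on u {..<2 * n}"
    by (rule alternating_form_nonzero_on_span[OF \<Omega>(1) \<open>\<Omega> 0 v \<noteq> 0\<close> span]) (rule that; assumption)
  have "u ` {..<2 * n} = ?S"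
    by (rule card_subset_eq[OF fS]) (use u eq in \<open>auto simp: card_image\<close>)
  \<comment> \<open>The injective \<open>u\<close> has as many entries as the basis has members, so
    each kernel vector occurs among its arguments.\<close>
  then have surj: "\<exists>i<2 * n. u i = x" if "x \<in> Kb" for x using that by (metis UnI2 imageE lessThan_iff)
  obtain \<sigma> l w where \<sigma>: "\<sigma> permutes {..<2 * n}" "l < n"
    and nz: "fder (\<lambda>p. bil (\<omega> p) (u (\<sigma> (2 * l))) (u (\<sigma> (Suc (2 * l))))) 0 w \<noteq> 0"
    and nd: "\<And>m. m < n \<Longrightarrow> m \<noteq> l \<Longrightarrow> bil (\<omega> 0) (u (\<sigma> (2 * m))) (u (\<sigma> (Suc (2 * m)))) \<noteq> 0"
    by (rule one_degenerate_pair[OF u(2)]) (rule that; assumption)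
  have two: "x = u (\<sigma> (2 * l)) \<or> x = u (\<sigma> (Suc (2 * l)))" if x: "x \<in> Kb" for x
  proof -
    obtain i where i: "i < 2 * n" "u i = x" using surj[OF x] by blast
    have "i \<in> \<sigma> ` {..<2 * n}" using i(1) permutes_image[OF \<sigma>(1)] by simp
    then obtain m where m: "m < 2 * n" "\<sigma> m = i" by auto
    have m2: "m = 2 * (m div 2) \<or> m = Suc (2 * (m div 2))" by linarith
    have "bil (\<omega> 0) x y = 0" "bil (\<omega> 0) y x = 0" for y
      using x Kb(2) alt_bil_swap[OF B, of x y] by (auto simp: bil_ker_def)
    then have "bil (\<omega> 0) (u (\<sigma> (2 * (m div 2)))) (u (\<sigma> (Suc (2 * (m div 2))))) = 0"
      using m2 m(2) i(2) by metis
    moreover have "m div 2 < n" using m(1) by auto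
    ultimately have "m div 2 = l" using nd by blast
    then show ?thesis using m2 m(2) i(2) by metis
  qed
  then have "Kb \<subseteq> {u (\<sigma> (2 * l)), u (\<sigma> (Suc (2 * l)))}" by blast
  then have "card Kb \<le> card {u (\<sigma> (2 * l)), u (\<sigma> (Suc (2 * l)))}" by (intro card_mono) auto
  also have "\<dots> \<le> 2" by (simp add: card_insert_if)
  finally show "card Kb = 2" "Suc r = n" using eq r by auto
  fix k1 k2 assume k: "k1 \<in> Kb" "k2 \<in> Kb" "k1 \<noteq> k2"
  from two[OF k(1)] two[OF k(2)] k(3)
  consider "k1 = u (\<sigma> (2 * l))" "k2 = u (\<sigma> (Suc (2 * l)))" | "k2 = u (\<sigma> (2 * l))" "k1 = u (\<sigma> (Suc (2 * l)))"
    by blast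
  then show "\<exists>w. fder (\<lambda>p. bil (\<omega> p) k1 k2) 0 w \<noteq> 0"
  proof cases
    case 1
    then show ?thesis using nz by blast
  next
    case 2
    have "fder (\<lambda>p. bil (\<omega> p) k1 k2) 0 = fder (\<lambda>p. - bil (\<omega> p) k2 k1) 0"
      by (rule cdiff_cong_open(2)[OF cdiff_fder_minus(1)[OF cdiff_bil] U])
         (rule alt_bil_swap[OF alt_bil_bil[OF alt], symmetric])
    then have "fder (\<lambda>p. bil (\<omega> p) k1 k2) 0 w = - fder (\<lambda>p. bil (\<omega> p) k2 k1) 0 w"
      by (simp add: cdiff_fder_minus(2)[OF cdiff_bil])
    then show ?thesis using nz 2 by (intro exI[of _ w]) simp
  qed
qed

text \<open>The nonzero derivative is asserted for every basis of the kernel, because a basis chosen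
  for omega_0 has to serve omega_1 as well. For the last claim, a vector outside the kernel begins a
  maximal symplectic family, which consists of n - 1 pairs by \<open>kernel_basis\<close>, and on it
  the (n - 1)-st power is nonzero.\<close>

lemma kernel:
  obtains k1 k2 where "k1 \<noteq> k2" "vec.independent {k1, k2}" "K = vec.span {k1, k2}"
    and "\<And>k1 k2. k1 \<noteq> k2 \<Longrightarrow> vec.independent {k1, k2} \<Longrightarrow> K = vec.span {k1, k2} \<Longrightarrow>
       \<exists>w. fder (\<lambda>p. bil (\<omega> p) k1 k2) 0 w \<noteq> 0"
    and "n \<ge> 2 \<Longrightarrow> form_ker (wedge_power (\<omega> 0) (n - 1)) = K"
proof -
  have "sympl_family (bil (\<omega> 0)) (\<lambda>_. 0) 0" by (simp add: sympl_family_def)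
  from sympl_family_maximal[OF B this] obtain r b where b: "sympl_family (bil (\<omega> 0)) b r"
    "\<And>x. (\<And>j. j < 2 * r \<Longrightarrow> bil (\<omega> 0) x (b j) = 0) \<Longrightarrow> x \<in> K" by metis
  have sub: "vec.subspace K" unfolding vec.subspace_def bil_ker_def by (auto simp: alt_bilD[OF B])
  obtain Kb where Kb: "Kb \<subseteq> K" "vec.independent Kb" "K \<subseteq> vec.span Kb"
    using vec.basis_exists[of K] by metis
  have sp: "K = vec.span Kb" using Kb(3) vec.span_minimal[OF Kb(1) sub] by blast
  have c: "card Kb = 2" by (rule kernel_basis(1)[OF b Kb(2,1,3)])
  then obtain k1 k2 where k: "Kb = {k1, k2}" "k1 \<noteq> k2" by (auto simp: card_2_iff)
  have nz: "\<exists>w. fder (\<lambda>p. bil (\<omega> p) k1 k2) 0 w \<noteq> 0"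
    if "k1 \<noteq> k2" "vec.independent {k1, k2}" "K = vec.span {k1, k2}" for k1 k2
    by (rule kernel_basis(3)[OF b that(2) _ _ _ _ that(1)]) (use that(3) in \<open>auto intro: vec.span_base\<close>)
  have ker: "form_ker (wedge_power (\<omega> 0) (n - 1)) = K" if n: "n \<ge> 2"
  proof
    show "K \<subseteq> form_ker (wedge_power (\<omega> 0) (n - 1))"
      using wedge_power_ker_subset[OF alt[OF U(2)]] n by auto
    show "form_ker (wedge_power (\<omega> 0) (n - 1)) \<subseteq> K"
    proof (rule ccontr)
      assume "\<not> ?thesis"
      then obtain x where x: "x \<in> form_ker (wedge_power (\<omega> 0) (n - 1))" "x \<notin> K" by blast
      then obtain y where xy: "bil (\<omega> 0) x y \<noteq> 0" by (auto simp: bil_ker_def)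
      \<comment> \<open>A hyperbolic pair starting with \<open>x\<close>: the extension of the empty
        family, with the second vector scaled to have pairing 1 with \<open>x\<close>.\<close>
      define b0 where "b0 = (\<lambda>_. 0)(2 * 0 := x, Suc (2 * 0) := inverse (bil (\<omega> 0) x y) *s y)"
      have "sympl_family (bil (\<omega> 0)) b0 (Suc 0)"
        unfolding b0_def
        by (rule sympl_family_extend[OF B _ _ _ xy]) (auto simp: sympl_family_def)
      from sympl_family_maximal[OF B this] obtain r' b' where b': "sympl_family (bil (\<omega> 0)) b' r'"
        "Suc 0 \<le> r'" "\<And>i. i < 2 * Suc 0 \<Longrightarrow> b' i = b0 i"
        "\<And>x. (\<And>j. j < 2 * r' \<Longrightarrow> bil (\<omega> 0) x (b' j) = 0) \<Longrightarrow> x \<in> K" by metis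
      have "r' = n - 1" using kernel_basis(2)[OF b'(1,4) Kb(2,1,3)] by simp
      then have nz: "wedge_power (\<omega> 0) (n - 1) b' \<noteq> 0"
        using b'(1) by (intro wedge_power_sympl_nonzero[OF alt[OF U(2)]]) (auto simp: sympl_family_def)
      have "b' 0 = x" using b'(3)[of 0] by (simp add: b0_def)
      then have "case_nat x (\<lambda>i. b' (Suc i)) = b'" by (auto simp: fun_eq_iff split: nat.split)
      moreover have "wedge_power (\<omega> 0) (n - 1) (case_nat x (\<lambda>i. b' (Suc i))) = 0"
        using x(1) unfolding form_ker_def iprod_def by (auto dest: fun_cong)
      ultimately show False using nz by simp
    qed
  qed
  show thesis
    by (rule that[OF k(2) _ _ nz ker]) (use Kb(2) sp k in auto)
qed

end

section \<open>Moser's method relative to a hypersurface\<close>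

text \<open>Matrices take the place of forms from here on: their entries are holomorphic functions,
  and their determinants give Cramer's rule.\<close>

definition bf :: "complex^'m^'m \<Rightarrow> complex^'m \<Rightarrow> complex^'m \<Rightarrow> complex" where
  "bf M x y = (\<Sum>i\<in>UNIV. \<Sum>j\<in>UNIV. x $ i * M $ i $ j * y $ j)"

abbreviation dmat :: "(complex^'m \<Rightarrow> complex^'m^'m) \<Rightarrow> complex^'m \<Rightarrow> complex^'m \<Rightarrow> complex^'m^'m" where
  "dmat M p v \<equiv> \<chi> i j. fder (\<lambda>q. M q $ i $ j) p v"

definition skew :: "complex^'m^'m \<Rightarrow> bool" where
  "skew M \<longleftrightarrow> (\<forall>i j. M $ j $ i = - M $ i $ j)"

lemma bf_linear:
  "bf (M + N) x y = bf M x y + bf N x y" "bf (M - N) x y = bf M x y - bf N x y"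
  "bf M (x + x') y = bf M x y + bf M x' y" "bf M (x - x') y = bf M x y - bf M x' y" "bf M (c *s x) y = c * bf M x y"
  "bf M x (y + y') = bf M x y + bf M x y'" "bf M x (y - y') = bf M x y - bf M x y'" "bf M x (c *s y) = c * bf M x y"
  "bf (\<chi> i j. c * M $ i $ j) x y = c * bf M x y"
proof -
  show "bf (M + N) x y = bf M x y + bf N x y" by (simp add: bf_def ring_distribs sum.distrib)
  show "bf (M - N) x y = bf M x y - bf N x y" by (simp add: bf_def ring_distribs sum_subtractf)
  show "bf M (x + x') y = bf M x y + bf M x' y" by (simp add: bf_def ring_distribs sum.distrib)
  show "bf M (x - x') y = bf M x y - bf M x' y" by (simp add: bf_def ring_distribs sum_subtractf)
  show "bf M x (y + y') = bf M x y + bf M x y'" by (simp add: bf_def ring_distribs sum.distrib)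
  show "bf M x (y - y') = bf M x y - bf M x y'" by (simp add: bf_def ring_distribs sum_subtractf)
  show "bf M (c *s x) y = c * bf M x y" by (simp add: bf_def sum_distrib_left mult_ac)
  show "bf M x (c *s y) = c * bf M x y" by (simp add: bf_def sum_distrib_left mult_ac)
  show "bf (\<chi> i j. c * M $ i $ j) x y = c * bf M x y" by (simp add: bf_def sum_distrib_left mult_ac)
qed

lemma bf_skew: assumes "skew M" shows "bf M y x = - bf M x y"
proof -
  have "bf M y x = (\<Sum>i\<in>UNIV. \<Sum>j\<in>UNIV. y $ j * M $ j $ i * x $ i)" unfolding bf_def by (rule sum.swap)
  also have "\<dots> = (\<Sum>i\<in>UNIV. \<Sum>j\<in>UNIV. - (x $ i * M $ i $ j * y $ j))"
  proof (intro sum.cong refl)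
    fix i j
    have "M $ j $ i = - M $ i $ j" using assms unfolding skew_def by blast
    then show "y $ j * M $ j $ i * x $ i = - (x $ i * M $ i $ j * y $ j)" by simp
  qed
  finally show ?thesis by (simp add: bf_def sum_negf)
qed

lemma bf_self: "skew M \<Longrightarrow> bf M x x = 0"
  using bf_skew[of M x x] by simp

lemma skew_dmat:
  assumes "open U" "p \<in> U" "\<And>q i j. q \<in> U \<Longrightarrow> cdiff (\<lambda>q. M q $ i $ j) q" "\<And>q. q \<in> U \<Longrightarrow> skew (M q)"
  shows "skew (dmat M p v)"
  unfolding skew_def
proof (intro allI)
  fix i j
  have "- M q $ i $ j = M q $ j $ i" if "q \<in> U" for q
    using assms(4)[OF that] unfolding skew_def by metis
  then have "fder (\<lambda>q. M q $ j $ i) p = fder (\<lambda>q. - M q $ i $ j) p"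
    by (rule cdiff_cong_open(2)[OF cdiff_fder_minus(1)[OF assms(3)[OF assms(2)]] assms(1,2)])
  then show "dmat M p v $ j $ i = - dmat M p v $ i $ j"
    by (simp add: cdiff_fder_minus(2)[OF assms(3)[OF assms(2)]])
qed

lemma cdiff_bf:
  fixes M :: "complex^'m \<Rightarrow> complex^'n^'n"
  assumes M: "\<And>i j. cdiff (\<lambda>q. M q $ i $ j) p" and X: "\<And>i. cdiff (\<lambda>q. X q $ i) p"
  shows "cdiff (\<lambda>q. bf (M q) (X q) y) p"
    "fder (\<lambda>q. bf (M q) (X q) y) p v = bf (\<chi> i j. fder (\<lambda>q. M q $ i $ j) p v) (X p) y + bf (M p) (vder X p v) y"
proof -
  have c: "cdiff (\<lambda>q. X q $ i * M q $ i $ j * y $ j) p" for i j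
    by (intro cdiff_fder_mult(1) cdiff_fder_const M X)
  have d: "fder (\<lambda>q. X q $ i * M q $ i $ j * y $ j) p v =
      X p $ i * fder (\<lambda>q. M q $ i $ j) p v * y $ j + fder (\<lambda>q. X q $ i) p v * M p $ i $ j * y $ j" for i j
    unfolding cdiff_fder_mult(2)[OF cdiff_fder_mult(1)[OF X M] cdiff_fder_const(1)] cdiff_fder_mult(2)[OF X M]
      cdiff_fder_const(2)
    by (simp add: algebra_simps)
  note s1 = cdiff_fder_sum[of UNIV "\<lambda>j q. X q $ i * M q $ i $ j * y $ j" p for i, OF c]
  note s2 = cdiff_fder_sum[of UNIV "\<lambda>i q. \<Sum>j\<in>UNIV. X q $ i * M q $ i $ j * y $ j" p, OF conjunct1[OF s1]]
  show "cdiff (\<lambda>q. bf (M q) (X q) y) p" unfolding bf_def using s2 by blast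
  have "fder (\<lambda>q. bf (M q) (X q) y) p v = (\<Sum>i\<in>UNIV. \<Sum>j\<in>UNIV. fder (\<lambda>q. X q $ i * M q $ i $ j * y $ j) p v)"
    unfolding bf_def conjunct2[OF s2] conjunct2[OF s1] ..
  then show "fder (\<lambda>q. bf (M q) (X q) y) p v = bf (\<chi> i j. fder (\<lambda>q. M q $ i $ j) p v) (X p) y + bf (M p) (vder X p v) y"
    unfolding d bf_def by (simp add: sum.distrib)
qed

lemma cdiff_bf_const:
  fixes M :: "complex^'m \<Rightarrow> complex^'n^'n"
  assumes "\<And>i j. cdiff (\<lambda>q. M q $ i $ j) p"
  shows "cdiff (\<lambda>q. bf (M q) x y) p"
    "fder (\<lambda>q. bf (M q) x y) p v = bf (\<chi> i j. fder (\<lambda>q. M q $ i $ j) p v) x y"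
proof -
  have z: "(\<chi> i. (0::complex)) = 0" by (simp add: vec_eq_iff)
  have b0: "bf N 0 y = 0" for N :: "complex^'n^'n" by (simp add: bf_def)
  show "cdiff (\<lambda>q. bf (M q) x y) p" by (rule cdiff_bf(1)[OF assms cdiff_fder_const(1)])
  show "fder (\<lambda>q. bf (M q) x y) p v = bf (\<chi> i j. fder (\<lambda>q. M q $ i $ j) p v) x y"
    by (simp only: cdiff_bf(2)[where X = "\<lambda>_. x", OF assms cdiff_fder_const(1)] cdiff_fder_const(2) z b0 add_0_right)
qed

lemma bf_has_vector_derivative:
  assumes M: "\<And>i j. ((\<lambda>s. M s $ i $ j) has_vector_derivative M' $ i $ j) (at s within S)"
    and a: "(a has_vector_derivative a') (at s within S)" and b: "(b has_vector_derivative b') (at s within S)"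
  shows "((\<lambda>s. bf (M s) (a s) (b s)) has_vector_derivative bf M' (a s) (b s) + bf (M s) a' (b s) + bf (M s) (a s) b') (at s within S)"
proof -
  have n: "((\<lambda>s. a s $ i) has_vector_derivative a' $ i) (at s within S)" "((\<lambda>s. b s $ i) has_vector_derivative b' $ i) (at s within S)" for i
    using bounded_linear.has_vector_derivative[OF bounded_linear_vec_nth] a b by blast+
  have "((\<lambda>s. bf (M s) (a s) (b s)) has_vector_derivative
      (\<Sum>i\<in>UNIV. \<Sum>j\<in>UNIV. (a s $ i * M s $ i $ j) * b' $ j + (a s $ i * M' $ i $ j + a' $ i * M s $ i $ j) * b s $ j)) (at s within S)"
    unfolding bf_def by (intro has_vector_derivative_sum has_vector_derivative_mult M n)
  then show ?thesis
    by (rule back_subst[of "\<lambda>x. (_ has_vector_derivative x) _"]) (simp add: bf_def sum.distrib algebra_simps)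
qed

lemma comp_has_vector_derivative:
  assumes "cdiff f (P s)" "(P has_vector_derivative P') (at s within S)"
  shows "((\<lambda>s. f (P s)) has_vector_derivative fder f (P s) P') (at s within S)"
proof -
  have "((\<lambda>s. f (P s)) has_derivative (\<lambda>h. fder f (P s) (h *\<^sub>R P'))) (at s within S)"
    using has_derivative_compose[OF assms(2)[unfolded has_vector_derivative_def] cdiff_has_derivative[OF assms(1)]] .
  then show ?thesis
    unfolding has_vector_derivative_def
    by (simp add: linear_scale[OF has_derivative_linear[OF cdiff_has_derivative[OF assms(1)]]])
qed

text \<open>The last condition is d omega = 0 evaluated on constant vector fields, whose brackets
  vanish.\<close>

definition closed_mat_on :: "(complex^'m) set \<Rightarrow> (complex^'m \<Rightarrow> complex^'m^'m) \<Rightarrow> bool" where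
  "closed_mat_on U M \<longleftrightarrow> (\<forall>p\<in>U. (\<forall>i j. cdiff (\<lambda>q. M q $ i $ j) p) \<and> skew (M p) \<and>
     (\<forall>a b c. bf (dmat M p a) b c - bf (dmat M p b) a c + bf (dmat M p c) a b = 0))"

lemma closed_mat_onD:
  assumes "closed_mat_on U M" "p \<in> U"
  shows "cdiff (\<lambda>q. M q $ i $ j) p" "skew (M p)"
    "bf (dmat M p a) b c - bf (dmat M p b) a c + bf (dmat M p c) a b = 0"
  using assms by (auto simp: closed_mat_on_def)

lemma closed_mat_on_lincomb:
  assumes M: "closed_mat_on U M" and N: "closed_mat_on U N"
  shows "closed_mat_on U (\<lambda>p. \<chi> i j. M p $ i $ j + c * N p $ i $ j)"
    "\<And>p v. p \<in> U \<Longrightarrow> dmat (\<lambda>p. \<chi> i j. M p $ i $ j + c * N p $ i $ j) p v = dmat M p v + (\<chi> i j. c * dmat N p v $ i $ j)"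
proof -
  have d: "cdiff (\<lambda>q. M q $ i $ j + c * N q $ i $ j) p \<and>
      fder (\<lambda>q. M q $ i $ j + c * N q $ i $ j) p = (\<lambda>v. fder (\<lambda>q. M q $ i $ j) p v + c * fder (\<lambda>q. N q $ i $ j) p v)"
    if p: "p \<in> U" for p i j
  proof -
    note m = cdiff_fder_mult[OF cdiff_fder_const(1) closed_mat_onD(1)[OF N p], of c i j]
    show ?thesis using cdiff_fder_add[OF closed_mat_onD(1)[OF M p] m(1), of i j] m(2)
      by (simp add: cdiff_fder_const)
  qed
  show e: "dmat (\<lambda>p. \<chi> i j. M p $ i $ j + c * N p $ i $ j) p v = dmat M p v + (\<chi> i j. c * dmat N p v $ i $ j)"
    if "p \<in> U" for p v
    using d[OF that] by (simp add: vec_eq_iff)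
  show "closed_mat_on U (\<lambda>p. \<chi> i j. M p $ i $ j + c * N p $ i $ j)"
    unfolding closed_mat_on_def
  proof (intro ballI conjI allI)
    fix p assume p: "p \<in> U"
    show "cdiff (\<lambda>q. (\<chi> i j. M q $ i $ j + c * N q $ i $ j) $ i $ j) p" for i j using d[OF p] by simp
    show "skew (\<chi> i j. M p $ i $ j + c * N p $ i $ j)"
      unfolding skew_def
    proof (intro allI)
      fix i j
      have "M p $ j $ i = - M p $ i $ j" "N p $ j $ i = - N p $ i $ j"
        using closed_mat_onD(2)[OF M p] closed_mat_onD(2)[OF N p] unfolding skew_def by blast+
      then show "(\<chi> i j. M p $ i $ j + c * N p $ i $ j) $ j $ i = - (\<chi> i j. M p $ i $ j + c * N p $ i $ j) $ i $ j"
        by simp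
    qed
    fix a b' c'
    let ?L = "\<lambda>p. \<chi> i j. M p $ i $ j + c * N p $ i $ j"
    have "bf (dmat ?L p a) b' c' - bf (dmat ?L p b') a c' + bf (dmat ?L p c') a b' =
       (bf (dmat M p a) b' c' - bf (dmat M p b') a c' + bf (dmat M p c') a b') +
       c * (bf (dmat N p a) b' c' - bf (dmat N p b') a c' + bf (dmat N p c') a b')"
      unfolding e[OF p] bf_linear(1,9) by (simp add: algebra_simps)
    then show "bf (dmat ?L p a) b' c' - bf (dmat ?L p b') a c' + bf (dmat ?L p c') a b' = 0"
      using closed_mat_onD(3)[OF M p] closed_mat_onD(3)[OF N p] by simp
  qed
qed

text \<open>Cartan's formula in coordinates: the sum is the time derivative of the form plus its Lie
  derivative along \<open>X\<close>, and closedness reduces the latter to d of the contraction. With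
  contraction - c eta and d eta = D the two cancel. The contraction identity is differentiated in
  direction \<open>a\<close> at argument \<open>b\<close>, and again with the roles
  exchanged.\<close>

lemma moser_infinitesimal:
  fixes X :: "complex^'m \<Rightarrow> complex^'m"
  assumes U: "open U" "q \<in> U" and A: "closed_mat_on U A" and X: "\<And>i. cdiff (\<lambda>q. X q $ i) q"
    and \<eta>: "\<And>b. cdiff (\<lambda>q. \<eta> q b) q" and AX: "\<And>q b. q \<in> U \<Longrightarrow> bf (A q) (X q) b = - c * \<eta> q b"
    and d\<eta>: "\<And>a b. fder (\<lambda>q. \<eta> q b) q a - fder (\<lambda>q. \<eta> q a) q b = bf D a b"
  shows "c * bf D a b + bf (dmat A q (X q)) a b + bf (A q) (vder X q a) b + bf (A q) a (vder X q b) = 0"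
proof -
  have e: "bf (dmat A q a) (X q) b + bf (A q) (vder X q a) b = - c * fder (\<lambda>q. \<eta> q b) q a" for a b
  proof -
    have "fder (\<lambda>q. bf (A q) (X q) b) q a = fder (\<lambda>q. - c * \<eta> q b) q a"
      using cdiff_cong_open(2)[OF cdiff_bf(1)[OF closed_mat_onD(1)[OF A U(2)] X] U AX] by metis
    also have "\<dots> = - c * fder (\<lambda>q. \<eta> q b) q a"
      using cdiff_fder_mult(2)[OF cdiff_fder_const(1) \<eta>[of b], of "- c"] by (simp add: cdiff_fder_const)
    finally show ?thesis
      by (simp only: cdiff_bf(2)[OF closed_mat_onD(1)[OF A U(2)] X])
  qed
  have s: "bf (A q) a (vder X q b) = - bf (A q) (vder X q b) a" by (rule bf_skew[OF closed_mat_onD(2)[OF A U(2)]])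
  have "c * bf D a b = c * fder (\<lambda>q. \<eta> q b) q a - c * fder (\<lambda>q. \<eta> q a) q b"
    by (simp add: d\<eta>[symmetric] algebra_simps)
  then show ?thesis
    using e[of a b] e[of b a] s closed_mat_onD(3)[OF A U(2), of "X q" a b] by algebra
qed

text \<open>The family slides p - g p * nu, at time 0, along \<open>\<nu>\<close> to
  \<open>p\<close> itself, at time 1. Its velocity is g p * nu, so every integral along it carries a
  factor \<open>g\<close>.\<close>

lemma retraction:
  fixes g :: "complex^'m \<Rightarrow> complex" and \<nu> :: "complex^'m"
  assumes g: "\<And>p. p \<in> V \<Longrightarrow> cdiff g p" and V: "open V"
  defines "F \<equiv> \<lambda>\<theta> p. p - (of_real (1 - \<theta>) * g p) *s \<nu>"
  shows "hol T V (\<lambda>\<theta> p. F \<theta> p $ i)"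
    "p \<in> V \<Longrightarrow> vder (F \<theta>) p a = a - (of_real (1 - \<theta>) * fder g p a) *s \<nu>"
    "((\<lambda>\<theta>. F \<theta> p) has_vector_derivative g p *s \<nu>) (at \<theta> within S)"
    "F 1 p = p" "F 0 p = p - g p *s \<nu>"
proof -
  have e: "F \<theta> p $ i = p $ i - of_real (1 - \<theta>) * g p * \<nu> $ i" for \<theta> p i
    by (simp add: F_def)
  show "hol T V (\<lambda>\<theta> p. F \<theta> p $ i)"
    unfolding e
    by (intro hol_diff hol_nth hol_mult hol_param hol_indep g continuous_intros)
  show "vder (F \<theta>) p a = a - (of_real (1 - \<theta>) * fder g p a) *s \<nu>" if p: "p \<in> V"
  proof -
    have "fder (\<lambda>q. F \<theta> q $ j) p a = a $ j - of_real (1 - \<theta>) * fder g p a * \<nu> $ j" for j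
    proof -
      note c1 = cdiff_fder_mult[OF cdiff_fder_const(1)[of "of_real (1 - \<theta>)"] g[OF p]]
      note c2 = cdiff_fder_mult[OF c1(1) cdiff_fder_const(1)[of "\<nu> $ j"]]
      show ?thesis
        unfolding e cdiff_fder_diff(2)[OF cdiff_fder_nth(1) c2(1)] c2(2) c1(2) cdiff_fder_const(2) cdiff_fder_nth(2)
        by simp
    qed
    then show ?thesis by (simp add: vec_eq_iff)
  qed
  have "((\<lambda>\<theta>. F \<theta> p $ j) has_vector_derivative (g p *s \<nu>) $ j) (at \<theta> within S)" for j
    unfolding e
    by (rule has_vector_derivative_eq_rhs, (rule derivative_intros)+) simp
  then show "((\<lambda>\<theta>. F \<theta> p) has_vector_derivative g p *s \<nu>) (at \<theta> within S)"
    by (rule has_vector_derivative_vec)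
  show "F 1 p = p" "F 0 p = p - g p *s \<nu>" by (simp_all add: F_def)
qed

text \<open>Hadamard's lemma: \<open>h t\<close> vanishes at the starting point of the slide, hence
  is the integral of its derivative along it, and the velocity supplies the factor \<open>g\<close>.
  The explicit quotient is holomorphic with continuous dependence on \<open>t\<close>.\<close>

lemma hadamard:
  fixes h :: "'t::t2_space \<Rightarrow> complex^'m \<Rightarrow> complex"
  assumes h: "hol T U h" and U: "open U" and V: "open V" and g: "\<And>p. p \<in> V \<Longrightarrow> cdiff g p"
    and F: "\<And>\<theta> p. \<theta> \<in> {0..1} \<Longrightarrow> p \<in> V \<Longrightarrow> p - (of_real (1 - \<theta>) * g p) *s \<nu> \<in> U"
    and z: "\<And>t p. t \<in> T \<Longrightarrow> p \<in> V \<Longrightarrow> h t (p - g p *s \<nu>) = 0"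
  defines "k \<equiv> \<lambda>t p. integral {0..1} (\<lambda>\<theta>. fder (h t) (p - (of_real (1 - \<theta>) * g p) *s \<nu>) \<nu>)"
  shows "hol T V k" "\<And>t p. t \<in> T \<Longrightarrow> p \<in> V \<Longrightarrow> h t p = g p * k t p"
proof -
  define F where "F = (\<lambda>(\<theta>::real) p. p - (of_real (1 - \<theta>) * g p) *s \<nu>)"
  have rF: "hol T' V (\<lambda>\<theta> p. F \<theta> p $ i)" "((\<lambda>\<theta>. F \<theta> p) has_vector_derivative g p *s \<nu>) (at \<theta> within S)"
    "F 1 p = p" "F 0 p = p - g p *s \<nu>" for T' i p \<theta> S
    unfolding F_def by (rule retraction[OF g V]; assumption)+
  have FU: "F \<theta> p \<in> U" if "\<theta> \<in> {0..1}" "p \<in> V" for \<theta> p unfolding F_def by (rule F[OF that])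
  have "hol (T \<times> {0..1}) V (\<lambda>x p. F (snd x) p $ i)" for i
    by (rule hol_compose[OF rF(1)[of UNIV]]) (auto intro!: continuous_intros hol_nth)
  then have "hol (T \<times> {0..1}) V (\<lambda>x p. fder (h (fst x)) (F (snd x) p) \<nu>)"
    by (intro hol_compose[OF hol_fder[OF U h]]) (auto intro!: continuous_intros FU)
  then show "hol T V k" unfolding k_def F_def by (rule hol_integral(1)[OF V])
  fix t p assume t: "t \<in> T" and p: "p \<in> V"
  have "((\<lambda>\<theta>. g p * fder (h t) (F \<theta> p) \<nu>) has_integral h t (F 1 p) - h t (F 0 p)) {0..1}"
  proof (rule fundamental_theorem_of_calculus)
    fix \<theta> :: real assume th: "\<theta> \<in> {0..1}"
    note c = hol_cdiff[OF h t FU[OF th p]]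
    have "((\<lambda>\<theta>. h t (F \<theta> p)) has_vector_derivative fder (h t) (F \<theta> p) (g p *s \<nu>)) (at \<theta> within {0..1})"
      by (rule comp_has_vector_derivative[OF c rF(2)])
    then show "((\<lambda>\<theta>. h t (F \<theta> p)) has_vector_derivative g p * fder (h t) (F \<theta> p) \<nu>) (at \<theta> within {0..1})"
      by (simp only: clinear_scale[OF cdiff_clinear[OF c]])
  qed simp
  from integral_unique[OF this] have "g p * k t p = h t (F 1 p) - h t (F 0 p)"
    unfolding integral_mult_right k_def F_def .
  then show "h t p = g p * k t p" unfolding rF(3,4) z[OF t p] by (simp only: diff_zero)
qed

text \<open>Homotopy formula for the sliding maps: the pullback of \<open>\<delta>\<close> vanishes
  at time 0 by assumption and is \<open>\<delta>\<close> at time 1, and the derivative in between is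
  exact because \<open>\<delta>\<close> is closed. The primitive contracts \<open>\<delta>\<close>
  with the velocity g p * nu, hence has the form g * beta.\<close>

lemma relative_poincare:
  fixes \<delta> :: "complex^'m \<Rightarrow> complex^'m^'m"
  assumes \<delta>: "closed_mat_on U \<delta>" and U: "open U" and V: "open V" and g: "\<And>p. p \<in> V \<Longrightarrow> cdiff g p"
    and F: "\<And>\<theta> p. \<theta> \<in> {0..1} \<Longrightarrow> p \<in> V \<Longrightarrow> p - (of_real (1 - \<theta>) * g p) *s \<nu> \<in> U"
    and z: "\<And>p a b. p \<in> V \<Longrightarrow> bf (\<delta> (p - g p *s \<nu>)) (a - fder g p a *s \<nu>) (b - fder g p b *s \<nu>) = 0"
  defines "\<beta> \<equiv> \<lambda>p b. integral {0..1} (\<lambda>\<theta>. bf (\<delta> (p - (of_real (1 - \<theta>) * g p) *s \<nu>)) \<nu> b)"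
  shows "hol T V (\<lambda>(t::real) p. \<beta> p b)"
    "p \<in> V \<Longrightarrow> \<beta> p b = (\<Sum>j\<in>UNIV. b $ j * \<beta> p (axis j 1))"
    "p \<in> V \<Longrightarrow> fder (\<lambda>q. g q * \<beta> q b) p a - fder (\<lambda>q. g q * \<beta> q a) p b = bf (\<delta> p) a b"
proof -
  define F where "F = (\<lambda>(\<theta>::real) p. p - (of_real (1 - \<theta>) * g p) *s \<nu>)"
  have rF: "hol T' V (\<lambda>\<theta> p. F \<theta> p $ i)" "((\<lambda>\<theta>. F \<theta> p) has_vector_derivative g p *s \<nu>) (at \<theta> within S)"
    "F 1 p = p" "F 0 p = p - g p *s \<nu>" for T' i p \<theta> S
    unfolding F_def by (rule retraction[OF g V]; assumption)+
  have vF: "vder (F \<theta>) p a = a - (of_real (1 - \<theta>) * fder g p a) *s \<nu>" if "p \<in> V" for \<theta> p a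
    unfolding F_def by (rule retraction(2)[OF g V that]; assumption)
  have FU: "F \<theta> p \<in> U" if "\<theta> \<in> {0..1}" "p \<in> V" for \<theta> p unfolding F_def by (rule F[OF that])
  have h\<delta>: "hol (UNIV :: real set) U (\<lambda>t p. bf (\<delta> p) \<nu> b)" for b
    by (intro hol_indep cdiff_bf_const(1) closed_mat_onD(1)[OF \<delta>])
  have h2: "hol {0..1} V (\<lambda>\<theta> p. bf (\<delta> (F \<theta> p)) \<nu> b)" for b
    by (rule hol_compose[OF h\<delta>, of _ "\<lambda>_. 0"]) (auto intro!: rF FU)
  have h3: "hol (T' \<times> {0..1}) V (\<lambda>x p. bf (\<delta> (F (snd x) p)) \<nu> b)" for b and T' :: "real set"
    by (rule hol_compose[OF h2]) (auto intro!: continuous_intros hol_nth)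
  have \<beta>: "\<beta> = (\<lambda>p b. integral {0..1} (\<lambda>\<theta>. bf (\<delta> (F \<theta> p)) \<nu> b))" by (simp add: \<beta>_def F_def)
  have hb: "hol T' V (\<lambda>t p. \<beta> p b)" for b and T' :: "real set" unfolding \<beta> by (rule hol_integral(1)[OF V h3])
  show "hol T V (\<lambda>t p. \<beta> p b)" by (rule hb)
  have i1: "((\<lambda>\<theta>. bf (\<delta> (F \<theta> p)) \<nu> b) has_integral \<beta> p b) {0..1}" if p: "p \<in> V" for p b
  proof -
    have "continuous_on {0..1} (\<lambda>\<theta>. bf (\<delta> (F \<theta> p)) \<nu> b)"
      by (rule hol_cont2[OF h2]) (auto intro!: continuous_intros p)
    then show ?thesis unfolding \<beta> by (intro integrable_integral integrable_continuous_interval)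
  qed
  show "\<beta> p b = (\<Sum>j\<in>UNIV. b $ j * \<beta> p (axis j 1))" if p: "p \<in> V"
  proof (rule has_integral_unique[OF i1[OF p]])
    have "bf M \<nu> b = (\<Sum>j\<in>UNIV. b $ j * bf M \<nu> (axis j 1))" for M
      by (rule clinear_expand) (intro clinearI bf_linear)
    then show "((\<lambda>\<theta>. bf (\<delta> (F \<theta> p)) \<nu> b) has_integral (\<Sum>j\<in>UNIV. b $ j * \<beta> p (axis j 1))) {0..1}"
      by (simp only:) (intro has_integral_sum has_integral_mult_right i1 p finite)
  qed
  assume p: "p \<in> V"
  have cb: "cdiff (\<lambda>q. \<beta> q b) p" for b using hol_cdiff[OF hb[of UNIV b] UNIV_I p] .
  \<comment> \<open>Images of \<open>a\<close> and \<open>b\<close> under the derivative of the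
    sliding map.\<close>
  define a' where "a' \<theta> = a - (of_real (1 - \<theta>) * fder g p a) *s \<nu>" for \<theta>
  define b' where "b' \<theta> = b - (of_real (1 - \<theta>) * fder g p b) *s \<nu>" for \<theta>
  have db: "fder (\<lambda>q. \<beta> q b) p a = integral {0..1} (\<lambda>\<theta>. bf (dmat \<delta> (F \<theta> p) (a - (of_real (1 - \<theta>) * fder g p a) *s \<nu>)) \<nu> b)" for a b
  proof -
    have "fder (\<lambda>q. \<beta> q b) p a = integral {0..1} (\<lambda>\<theta>. fder (\<lambda>q. bf (\<delta> (F \<theta> q)) \<nu> b) p a)"
      unfolding \<beta> by (rule hol_integral(2)[OF V h3 UNIV_I p])
    also have "\<dots> = integral {0..1} (\<lambda>\<theta>. bf (dmat \<delta> (F \<theta> p) (a - (of_real (1 - \<theta>) * fder g p a) *s \<nu>)) \<nu> b)"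
    proof (rule integral_cong)
      fix \<theta> :: real assume th: "\<theta> \<in> {0..1}"
      note c = closed_mat_onD(1)[OF \<delta> FU[OF th p]]
      have cF: "cdiff (\<lambda>q. F \<theta> q $ i) p" for i using hol_cdiff[OF rF(1)[of UNIV] UNIV_I p] .
      show "fder (\<lambda>q. bf (\<delta> (F \<theta> q)) \<nu> b) p a = bf (dmat \<delta> (F \<theta> p) (a - (of_real (1 - \<theta>) * fder g p a) *s \<nu>)) \<nu> b"
        using cdiff_fder_compose(2)[where G = "F \<theta>" and f = "\<lambda>q. bf (\<delta> q) \<nu> b", OF cdiff_bf_const(1)[OF c] cF]
        by (simp only: cdiff_bf_const(2)[OF c] vF[OF p])
    qed
    finally show ?thesis .
  qed
  \<comment> \<open>Integrand of d(g beta) on (a, b); the fundamental theorem below recognises it as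
    the derivative in \<open>\<theta>\<close> of the pulled-back form.\<close>
  define I where "I \<theta> = fder g p a * bf (\<delta> (F \<theta> p)) \<nu> b - fder g p b * bf (\<delta> (F \<theta> p)) \<nu> a
     + g p * (bf (dmat \<delta> (F \<theta> p) (a' \<theta>)) \<nu> b - bf (dmat \<delta> (F \<theta> p) (b' \<theta>)) \<nu> a)" for \<theta>
  have c2: "continuous_on {0..1} (\<lambda>\<theta>. bf (dmat \<delta> (F \<theta> p) (a - (of_real (1 - \<theta>) * fder g p a) *s \<nu>)) \<nu> b)" for a b
  proof -
    have h4: "hol {0..1} V (\<lambda>\<theta> p. fder (\<lambda>q. \<delta> q $ i $ j) (F \<theta> p) (axis k 1))" for i j k
    proof -
      have h0: "hol (UNIV :: real set) U (\<lambda>t p. fder (\<lambda>q. \<delta> q $ i $ j) p (axis k 1))"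
        by (intro hol_fder[OF U] hol_indep closed_mat_onD(1)[OF \<delta>])
      show ?thesis by (rule hol_compose[OF h0, of _ "\<lambda>_. 0"]) (auto intro!: rF FU)
    qed
    have "continuous_on {0..1} (\<lambda>\<theta>. fder (\<lambda>q. \<delta> q $ i $ j) (F \<theta> p) (a - (of_real (1 - \<theta>) * fder g p a) *s \<nu>))" for i j
    proof -
      have "continuous_on {0..1} (\<lambda>\<theta>. \<Sum>k\<in>UNIV. (a - (of_real (1 - \<theta>) * fder g p a) *s \<nu>) $ k * fder (\<lambda>q. \<delta> q $ i $ j) (F \<theta> p) (axis k 1))"
        by (intro continuous_on_sum continuous_on_mult hol_cont2[OF h4] continuous_intros) (auto intro: p)
      then show ?thesis
        by (rule continuous_on_eq) (rule clinear_expand[OF cdiff_clinear[OF closed_mat_onD(1)[OF \<delta> FU[OF _ p]]], symmetric])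
    qed
    then show ?thesis unfolding bf_def by (auto intro!: continuous_intros)
  qed
  have "fder (\<lambda>q. g q * \<beta> q b) p a - fder (\<lambda>q. g q * \<beta> q a) p b = integral {0..1} I"
  proof -
    have i2: "((\<lambda>\<theta>. bf (dmat \<delta> (F \<theta> p) (a - (of_real (1 - \<theta>) * fder g p a) *s \<nu>)) \<nu> b) has_integral
        fder (\<lambda>q. \<beta> q b) p a) {0..1}" for a b
      unfolding db by (rule integrable_integral[OF integrable_continuous_interval[OF c2]])
    have "(I has_integral fder g p a * \<beta> p b - fder g p b * \<beta> p a + g p * (fder (\<lambda>q. \<beta> q b) p a - fder (\<lambda>q. \<beta> q a) p b)) {0..1}"
      unfolding I_def a'_def b'_def by (intro has_integral_add has_integral_diff has_integral_mult_right i1[OF p] i2)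
    then show ?thesis
      unfolding cdiff_fder_mult(2)[OF g[OF p] cb] by (simp add: integral_unique ring_distribs)
  qed
  moreover have "(I has_integral bf (\<delta> (F 1 p)) (a' 1) (b' 1) - bf (\<delta> (F 0 p)) (a' 0) (b' 0)) {0..1}"
  proof (rule fundamental_theorem_of_calculus)
    fix \<theta> :: real assume th: "\<theta> \<in> {0..1}"
    note Fp = FU[OF th p]
    have da: "(a' has_vector_derivative fder g p a *s \<nu>) (at \<theta> within {0..1})" and dbb: "(b' has_vector_derivative fder g p b *s \<nu>) (at \<theta> within {0..1})"
    proof -
      have "((\<lambda>\<theta>. c - (of_real (1 - \<theta>) * d) *s \<nu>) has_vector_derivative d *s \<nu>) (at \<theta> within {0..1})" for c d
      proof (rule has_vector_derivative_vec)
        fix i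
        show "((\<lambda>\<theta>. (c - (of_real (1 - \<theta>) * d) *s \<nu>) $ i) has_vector_derivative (d *s \<nu>) $ i) (at \<theta> within {0..1})"
          unfolding vector_minus_component vector_smult_component
          by (rule has_vector_derivative_eq_rhs, (rule derivative_intros)+) simp
      qed
      then show "(a' has_vector_derivative fder g p a *s \<nu>) (at \<theta> within {0..1})" "(b' has_vector_derivative fder g p b *s \<nu>) (at \<theta> within {0..1})"
        unfolding a'_def b'_def by blast+
    qed
    have dM: "((\<lambda>\<theta>. \<delta> (F \<theta> p) $ i $ j) has_vector_derivative dmat \<delta> (F \<theta> p) (g p *s \<nu>) $ i $ j) (at \<theta> within {0..1})" for i j
      using comp_has_vector_derivative[where f = "\<lambda>q. \<delta> q $ i $ j", OF closed_mat_onD(1)[OF \<delta> Fp] rF(2)] by simp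
    have sk: "skew (\<delta> (F \<theta> p))" by (rule closed_mat_onD(2)[OF \<delta> Fp])
    have skd: "skew (dmat \<delta> (F \<theta> p) v)" for v
      by (rule skew_dmat[OF U Fp closed_mat_onD(1)[OF \<delta>] closed_mat_onD(2)[OF \<delta>]])
    have gn: "dmat \<delta> (F \<theta> p) (g p *s \<nu>) = (\<chi> i j. g p * dmat \<delta> (F \<theta> p) \<nu> $ i $ j)"
      by (simp add: vec_eq_iff clinear_scale[OF cdiff_clinear[OF closed_mat_onD(1)[OF \<delta> Fp]]])
    \<comment> \<open>\<open>a'\<close> and \<open>b'\<close> differ from \<open>a\<close> and
      \<open>b\<close> by multiples of \<open>\<nu>\<close>, which disappear when an alternating
      form has \<open>\<nu>\<close> as its other argument.\<close>
    have s1: "bf (\<delta> (F \<theta> p)) (a' \<theta>) \<nu> = - bf (\<delta> (F \<theta> p)) \<nu> a"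
      using bf_skew[OF sk, of "a' \<theta>" \<nu>] by (simp add: a'_def bf_linear bf_self[OF sk])
    have s2: "bf (\<delta> (F \<theta> p)) \<nu> (b' \<theta>) = bf (\<delta> (F \<theta> p)) \<nu> b"
      by (simp add: b'_def bf_linear bf_self[OF sk])
    have s3: "bf (dmat \<delta> (F \<theta> p) v) \<nu> (a' \<theta>) = bf (dmat \<delta> (F \<theta> p) v) \<nu> a" "bf (dmat \<delta> (F \<theta> p) v) \<nu> (b' \<theta>) = bf (dmat \<delta> (F \<theta> p) v) \<nu> b" for v
      by (simp_all only: a'_def b'_def bf_linear bf_self[OF skd] mult_zero_right diff_zero)
    have "((\<lambda>\<theta>. bf (\<delta> (F \<theta> p)) (a' \<theta>) (b' \<theta>)) has_vector_derivative
       bf (dmat \<delta> (F \<theta> p) (g p *s \<nu>)) (a' \<theta>) (b' \<theta>) + bf (\<delta> (F \<theta> p)) (fder g p a *s \<nu>) (b' \<theta>) + bf (\<delta> (F \<theta> p)) (a' \<theta>) (fder g p b *s \<nu>))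
        (at \<theta> within {0..1})"
      by (rule bf_has_vector_derivative[OF dM da dbb])
    moreover have "bf (dmat \<delta> (F \<theta> p) (g p *s \<nu>)) (a' \<theta>) (b' \<theta>) + bf (\<delta> (F \<theta> p)) (fder g p a *s \<nu>) (b' \<theta>) + bf (\<delta> (F \<theta> p)) (a' \<theta>) (fder g p b *s \<nu>) = I \<theta>"
      using closed_mat_onD(3)[OF \<delta> Fp, of \<nu> "a' \<theta>" "b' \<theta>"]
      unfolding gn bf_linear(5,8,9) s1 s2 s3 I_def by algebra
    ultimately show "((\<lambda>\<theta>. bf (\<delta> (F \<theta> p)) (a' \<theta>) (b' \<theta>)) has_vector_derivative I \<theta>) (at \<theta> within {0..1})"
      by simp
  qed simp
  moreover have "bf (\<delta> (F 0 p)) (a' 0) (b' 0) = 0"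
    using z[OF p, of a b] by (simp add: rF(4) a'_def b'_def)
  moreover have "a' 1 = a" "b' 1 = b" by (simp_all add: a'_def b'_def)
  ultimately show "fder (\<lambda>q. g q * \<beta> q b) p a - fder (\<lambda>q. g q * \<beta> q a) p b = bf (\<delta> p) a b"
    by (simp add: integral_unique rF(3))
qed

text \<open>The pullback along the flow is constant in \<open>s\<close>: its derivative consists of
  the variation of the form, its transport along \<open>X\<close> and the two variational terms, and
  \<open>moser_infinitesimal\<close> sums these to 0.\<close>

lemma moser:
  fixes A \<delta> :: "complex^'m \<Rightarrow> complex^'m^'m" and X :: "real \<Rightarrow> complex^'m \<Rightarrow> complex^'m"
  assumes R: "R > 0" and A: "closed_mat_on (ball 0 R) A" and \<delta>: "closed_mat_on (ball 0 R) \<delta>"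
    and \<gamma>: "\<And>s. s \<in> {0..1} \<Longrightarrow> (\<gamma> has_vector_derivative \<gamma>' s) (at s within {0..1})" "\<gamma> 0 = 0"
    and X: "\<And>i. hol {0..1} (ball 0 R) (\<lambda>s p. X s p $ i)" "\<And>s. s \<in> {0..1} \<Longrightarrow> X s 0 = 0"
    and \<eta>: "\<And>b q. q \<in> ball 0 R \<Longrightarrow> cdiff (\<lambda>q. \<eta> q b) q"
    and AX: "\<And>s q b. s \<in> {0..1} \<Longrightarrow> q \<in> ball 0 R \<Longrightarrow>
       bf (\<chi> i j. A q $ i $ j + \<gamma> s * \<delta> q $ i $ j) (X s q) b = - \<gamma>' s * \<eta> q b"
    and d\<eta>: "\<And>q a b. q \<in> ball 0 R \<Longrightarrow> fder (\<lambda>q. \<eta> q b) q a - fder (\<lambda>q. \<eta> q a) q b = bf (\<delta> q) a b"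
  obtains r and \<Psi> :: "complex^'m \<Rightarrow> complex^'m" where "r > 0" "\<And>i p. p \<in> ball 0 r \<Longrightarrow> cdiff (\<lambda>p. \<Psi> p $ i) p"
    "\<Psi> 0 = 0" "\<And>p. p \<in> ball 0 r \<Longrightarrow> \<Psi> p \<in> ball 0 R" "\<And>v. vder \<Psi> 0 v = 0 \<Longrightarrow> v = 0"
    "\<And>p u v. p \<in> ball 0 r \<Longrightarrow>
       bf (\<chi> i j. A (\<Psi> p) $ i $ j + \<gamma> 1 * \<delta> (\<Psi> p) $ i $ j) (vder \<Psi> p u) (vder \<Psi> p v) = bf (A p) u v"
proof -
  obtain r and P :: "real \<Rightarrow> complex^'m \<Rightarrow> complex^'m" where r: "r > 0"
    and P: "\<And>i. hol {0..1} (ball 0 r) (\<lambda>s p. P s p $ i)"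
      "\<And>s p. s \<in> {0..1} \<Longrightarrow> p \<in> ball 0 r \<Longrightarrow> P s p \<in> ball 0 R"
      "\<And>s. s \<in> {0..1} \<Longrightarrow> P s 0 = 0" "\<And>p. p \<in> ball 0 r \<Longrightarrow> P 0 p = p"
      "\<And>s p. s \<in> {0..1} \<Longrightarrow> p \<in> ball 0 r \<Longrightarrow> ((\<lambda>s. P s p) has_vector_derivative X s (P s p)) (at s within {0..1})"
      "\<And>s p v. s \<in> {0..1} \<Longrightarrow> p \<in> ball 0 r \<Longrightarrow>
       ((\<lambda>s. vder (P s) p v) has_vector_derivative vder (X s) (P s p) (vder (P s) p v)) (at s within {0..1})"
    by (rule flow[OF R X], assumption, rule that; assumption)
  define M where "M s q = (\<chi> i j. A q $ i $ j + \<gamma> s * \<delta> q $ i $ j)" for s q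
  have M: "closed_mat_on (ball 0 R) (M s)"
    "q \<in> ball 0 R \<Longrightarrow> dmat (M s) q v = dmat A q v + (\<chi> i j. \<gamma> s * dmat \<delta> q v $ i $ j)" for s q v
    unfolding M_def by (rule closed_mat_on_lincomb[OF A \<delta>]; assumption)+
  have vder0: "vder (P 0) p v = v" if "p \<in> ball 0 r" for p v
  proof -
    have "fder (\<lambda>q. P 0 q $ i) p = fder (\<lambda>q. q $ i) p" for i
      by (rule cdiff_cong_open(2)[OF cdiff_fder_nth(1) open_ball that]) (simp only: P(4))
    then have "fder (\<lambda>q. P 0 q $ i) p = (\<lambda>v. v $ i)" for i by (simp only: cdiff_fder_nth(2))
    then show ?thesis by (simp add: vec_eq_iff)
  qed
  show ?thesis
  proof (rule that[OF r, of "P 1"])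
    show "cdiff (\<lambda>p. P 1 p $ i) p" if "p \<in> ball 0 r" for i p by (rule hol_cdiff[OF P(1) _ that]) simp
    show "P 1 0 = 0" by (rule P(3)) simp
    show "P 1 p \<in> ball 0 R" if "p \<in> ball 0 r" for p by (rule P(2)[OF _ that]) simp
    have 0: "0 \<in> ball (0::complex^'m) r" using r by simp
    show "v = 0" if v: "vder (P 1) 0 v = 0" for v
    proof -
      \<comment> \<open>The ball of radius 0 suffices: the flow fixes the origin, so the derivative
        of \<open>X\<close> is to be bounded at that point.\<close>
      have sub: "cball 0 0 \<subseteq> ball (0::complex^'m) R" using R by simp
      obtain L where L: "L \<ge> 0" "\<And>t p v. t \<in> {0..1} \<Longrightarrow> p \<in> cball 0 0 \<Longrightarrow> norm (vder (X t) p v) \<le> L * norm v"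
        by (rule hol_vec_lipschitz[OF X(1) open_ball sub compact_Icc]) (rule that; assumption)
      have "vder (P 0) 0 v = 0"
      proof (rule flow_derivative_injective)
        show "((\<lambda>s. vder (P s) 0 v) has_vector_derivative vder (X s) (P s 0) (vder (P s) 0 v)) (at s within {0..1})"
          if "s \<in> {0..1}" for s by (rule P(6)[OF that 0])
        show "vder (P 1) 0 v = 0" by (rule v)
        show "norm (vder (X s) (P s 0) (vder (P s) 0 v)) \<le> L * norm (vder (P s) 0 v)" if "s \<in> {0..1}" for s
          by (rule L(2)[OF that]) (simp add: P(3)[OF that])
      qed
      then show ?thesis using vder0[OF 0] by simp
    qed
    fix p u v assume p: "p \<in> ball (0::complex^'m) r"
    let ?a = "\<lambda>s. vder (P s) p u" and ?b = "\<lambda>s. vder (P s) p v"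
    have "\<exists>c. \<forall>s\<in>{0..1}. bf (M s (P s p)) (?a s) (?b s) = c"
    proof (rule has_vector_derivative_zero_constant[of "{0..1}"])
      fix s :: real assume s: "s \<in> {0..1}"
      note q = P(2)[OF s p]
      have dM: "((\<lambda>s. M s (P s p) $ i $ j) has_vector_derivative
         ((\<chi> i j. \<gamma>' s * \<delta> (P s p) $ i $ j) + dmat (M s) (P s p) (X s (P s p))) $ i $ j) (at s within {0..1})" for i j
      proof -
        have "((\<lambda>s. A (P s p) $ i $ j + \<gamma> s * \<delta> (P s p) $ i $ j) has_vector_derivative
          fder (\<lambda>q. A q $ i $ j) (P s p) (X s (P s p)) + (\<gamma> s * fder (\<lambda>q. \<delta> q $ i $ j) (P s p) (X s (P s p)) + \<gamma>' s * \<delta> (P s p) $ i $ j)) (at s within {0..1})"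
          by (intro has_vector_derivative_add has_vector_derivative_mult \<gamma>(1)[OF s]
              comp_has_vector_derivative[OF _ P(5)[OF s p]] closed_mat_onD(1)[OF A q] closed_mat_onD(1)[OF \<delta> q])
        then show ?thesis unfolding M(2)[OF q] by (simp add: M_def algebra_simps)
      qed
      have "((\<lambda>s. bf (M s (P s p)) (?a s) (?b s)) has_vector_derivative
         bf ((\<chi> i j. \<gamma>' s * \<delta> (P s p) $ i $ j) + dmat (M s) (P s p) (X s (P s p))) (?a s) (?b s)
         + bf (M s (P s p)) (vder (X s) (P s p) (?a s)) (?b s) + bf (M s (P s p)) (?a s) (vder (X s) (P s p) (?b s))) (at s within {0..1})"
        by (rule bf_has_vector_derivative[OF dM P(6)[OF s p] P(6)[OF s p]])
      moreover have "\<gamma>' s * bf (\<delta> (P s p)) (?a s) (?b s) + bf (dmat (M s) (P s p) (X s (P s p))) (?a s) (?b s)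
         + bf (M s (P s p)) (vder (X s) (P s p) (?a s)) (?b s) + bf (M s (P s p)) (?a s) (vder (X s) (P s p) (?b s)) = 0"
        by (rule moser_infinitesimal[OF open_ball q M(1) hol_cdiff[OF X(1) s q] \<eta>[OF q] AX[OF s, folded M_def] d\<eta>[OF q]])
      ultimately show "((\<lambda>s. bf (M s (P s p)) (?a s) (?b s)) has_vector_derivative 0) (at s within {0..1})"
        unfolding bf_linear(1,9) by simp
    qed (simp, blast)
    then have "bf (M 1 (P 1 p)) (?a 1) (?b 1) = bf (M 0 (P 0 p)) (?a 0) (?b 0)" by auto
    then show "bf (\<chi> i j. A (P 1 p) $ i $ j + \<gamma> 1 * \<delta> (P 1 p) $ i $ j) (?a 1) (?b 1) = bf (A p) u v"
      by (simp add: M_def \<gamma>(2) P(4)[OF p] vder0[OF p])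
  qed
qed

lemma cdiff_clinear_self:
  assumes "Vector_Spaces.linear (*s) (*) (l :: complex^'m \<Rightarrow> complex)"
  shows "cdiff l p" "fder l p = l"
  using bounded_linear_imp_has_derivative[OF clinear_imp_bounded_linear[OF assms], of "at p"] assms
  by (auto intro: cdiffI fder_eq)

text \<open>\<open>g\<close> is the coordinate along \<open>\<nu>\<close> measured from {f = 0}. The
  map \<open>G\<close> moves points only along \<open>\<nu>\<close> and satisfies l (G p) = f p, so
  it straightens \<open>f\<close> into its linear part. Its inverse \<open>H\<close> takes points
  with l = 0 to zeros of \<open>f\<close>; thus \<open>H (\<kappa> p)\<close> is a zero of
  \<open>f\<close> on the line through \<open>p\<close> in direction \<open>\<nu>\<close>.\<close>

lemma defining_function:
  fixes f :: "complex^'m \<Rightarrow> complex"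
  assumes U: "open U" "0 \<in> U" and f: "\<And>p. p \<in> U \<Longrightarrow> cdiff f p" "f 0 = 0" "fder f 0 \<noteq> (\<lambda>v. 0)"
  obtains \<rho> \<nu> and g :: "complex^'m \<Rightarrow> complex" where "\<rho> > 0" "ball 0 \<rho> \<subseteq> U" "\<And>p. p \<in> ball 0 \<rho> \<Longrightarrow> cdiff g p" "g 0 = 0"
    "\<And>p. p \<in> ball 0 \<rho> \<Longrightarrow> f (p - g p *s \<nu>) = 0"
proof -
  define l where "l = fder f 0"
  have l: "Vector_Spaces.linear (*s) (*) l" unfolding l_def by (rule cdiff_clinear[OF f(1)[OF U(2)]])
  obtain v where v: "l v \<noteq> 0" using f(3) unfolding l_def by auto
  define \<nu> where "\<nu> = inverse (l v) *s v"
  have l\<nu>: "l \<nu> = 1" using v by (simp add: \<nu>_def clinear_scale[OF l])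
  have l0: "l 0 = 0" by (rule clinear_0[OF l])
  define G where "G p = p + (f p - l p) *s \<nu>" for p
  have Gi: "G p $ i = p $ i + (f p - l p) * \<nu> $ i" for p i
    unfolding G_def vector_add_component vector_smult_component ..
  have cG: "cdiff (\<lambda>p. G p $ i) p" if "p \<in> U" for i p
    unfolding Gi by (intro cdiff_fder_add(1) cdiff_fder_nth cdiff_fder_mult(1) cdiff_fder_diff(1) f that
        cdiff_clinear_self(1)[OF l] cdiff_fder_const)
  have "fder (\<lambda>p. G p $ i) 0 v = v $ i" for i v
  proof -
    note c1 = cdiff_fder_diff[OF f(1)[OF U(2)] cdiff_clinear_self(1)[OF l]]
    note c2 = cdiff_fder_mult[OF c1(1) cdiff_fder_const(1)[of "\<nu> $ i"]]
    show ?thesis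
      unfolding Gi cdiff_fder_add(2)[OF cdiff_fder_nth(1) c2(1)] c2(2) c1(2) cdiff_clinear_self(2)[OF l] cdiff_fder_nth(2)
      by (simp add: l_def cdiff_fder_const)
  qed
  then have dG: "vder G 0 v = v" for v by (simp add: vec_eq_iff)
  have inj: "v = 0" if "vder G 0 v = 0" for v using that unfolding dG .
  obtain U' V and H :: "complex^'m \<Rightarrow> complex^'m" where H: "open U'" "U' \<subseteq> U" "0 \<in> U'" "open V" "G ` U' = V"
    "\<And>p. p \<in> U' \<Longrightarrow> H (G p) = p" "\<And>q. q \<in> V \<Longrightarrow> H q \<in> U'" "\<And>q. q \<in> V \<Longrightarrow> G (H q) = q"
    "\<And>i q. q \<in> V \<Longrightarrow> cdiff (\<lambda>q. H q $ i) q"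
    by (rule local_inverse[OF U cG inj], assumption, assumption, rule that; assumption)
  have G0: "G 0 = 0" by (simp add: G_def f(2) l0)
  then have V0: "0 \<in> V" using H(3,5) by (metis image_eqI)
  have H0: "H 0 = 0" using H(6)[OF H(3)] G0 by simp
  define \<kappa> where "\<kappa> p = p - l p *s \<nu>" for p
  have \<kappa>0: "\<kappa> 0 = 0" by (simp add: \<kappa>_def l0)
  have \<kappa>i: "\<kappa> p $ i = p $ i - l p * \<nu> $ i" for p i by (simp add: \<kappa>_def)
  have c\<kappa>: "cdiff (\<lambda>p. \<kappa> p $ i) p" for i p
    unfolding \<kappa>i by (intro cdiff_fder_diff(1) cdiff_fder_nth cdiff_fder_mult(1) cdiff_clinear_self(1)[OF l] cdiff_fder_const)
  define g where "g p = l (p - H (\<kappa> p))" for p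
  have cg: "cdiff g p" if "\<kappa> p \<in> V" for p
  proof -
    have "cdiff (\<lambda>p. (p - H (\<kappa> p)) $ i) p" for i
      unfolding vector_minus_component
      by (intro cdiff_fder_diff(1) cdiff_fder_nth cdiff_fder_compose(1)[where G = \<kappa> and f = "\<lambda>q. H q $ i"] H(9) that c\<kappa>)
    then show ?thesis unfolding g_def by (rule cdiff_fder_compose(1)[OF cdiff_clinear_self(1)[OF l]])
  qed
  have "isCont \<kappa> 0"
    using has_derivative_continuous[OF has_derivative_vec_comp[OF cdiff_has_derivative[OF c\<kappa>]]] .
  then have "(\<kappa> \<longlongrightarrow> \<kappa> 0) (nhds 0)"
    unfolding isCont_def by (simp only: tendsto_at_iff_tendsto_nhds)
  then have "\<forall>\<^sub>F p in nhds 0. \<kappa> p \<in> V"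
    by (rule topological_tendstoD[OF _ H(4)]) (simp only: \<kappa>0 V0)
  moreover have "\<forall>\<^sub>F p in nhds 0. p \<in> U'" using H(1,3) by (rule eventually_nhds_in_open)
  ultimately have "\<forall>\<^sub>F p in nhds 0. \<kappa> p \<in> V \<and> p \<in> U'" by eventually_elim simp
  then obtain \<rho> where \<rho>0: "\<rho> > 0" "\<forall>p. dist p 0 < \<rho> \<longrightarrow> \<kappa> p \<in> V \<and> p \<in> U'"
    unfolding eventually_nhds_metric by blast
  then have \<rho>: "\<rho> > 0" "\<And>p. p \<in> ball 0 \<rho> \<Longrightarrow> \<kappa> p \<in> V \<and> p \<in> U'" by simp_all
  show thesis
  proof (rule that[OF \<rho>(1)])
    show "ball 0 \<rho> \<subseteq> U" using \<rho>(2) H(2) by blast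
    show "cdiff g p" if "p \<in> ball 0 \<rho>" for p using cg \<rho>(2)[OF that] by blast
    show "g 0 = 0" by (simp add: g_def \<kappa>0 H0 l0)
    show "f (p - g p *s \<nu>) = 0" if p: "p \<in> ball 0 \<rho>" for p
    proof -
      define h where "h = H (\<kappa> p)"
      have Gh: "G h = \<kappa> p" unfolding h_def using H(8) \<rho>(2)[OF p] by blast
      have "l (G h) = l h + (f h - l h) * l \<nu>"
        unfolding G_def clinear_add[OF l] clinear_scale[OF l] ..
      moreover have "l (\<kappa> p) = 0"
        using clinear_add[OF l, of "\<kappa> p" "l p *s \<nu>"] by (simp add: \<kappa>_def clinear_scale[OF l] l\<nu>)
      ultimately have fh: "f h = 0" using Gh l\<nu> by simp
      have lp: "l p = g p + l h"
        using clinear_add[OF l, of "p - h" h] by (simp add: g_def h_def)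
      have "h - l h *s \<nu> = p - l p *s \<nu>" using Gh fh by (simp add: G_def \<kappa>_def)
      then have "p - g p *s \<nu> = h" unfolding lp by (simp add: vec_eq_iff algebra_simps)
      then show ?thesis using fh by simp
    qed
  qed
qed

section \<open>Bordered skew matrices and their Pfaffian, with the complex-bilinear pairing
  \<open>cdot\<close>\<close>

definition cdot :: "complex^'m \<Rightarrow> complex^'m \<Rightarrow> complex" where
  "cdot x y = (\<Sum>i\<in>UNIV. x $ i * y $ i)"

lemma cdot_linear:
  "cdot x y = cdot y x" "cdot (x + x') y = cdot x y + cdot x' y" "cdot (x - x') y = cdot x y - cdot x' y"
  "cdot (c *s x) y = c * cdot x y" "cdot x (y + y') = cdot x y + cdot x y'" "cdot x (y - y') = cdot x y - cdot x y'"
  "cdot x (c *s y) = c * cdot x y" "cdot 0 y = 0" "cdot x 0 = 0" "cdot x (- y) = - cdot x y"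
proof -
  show "cdot x y = cdot y x" by (simp add: cdot_def mult.commute)
  show "cdot (x + x') y = cdot x y + cdot x' y" by (simp add: cdot_def ring_distribs sum.distrib)
  show "cdot (x - x') y = cdot x y - cdot x' y" by (simp add: cdot_def ring_distribs sum_subtractf)
  show "cdot (c *s x) y = c * cdot x y" by (simp add: cdot_def sum_distrib_left mult_ac)
  show "cdot x (y + y') = cdot x y + cdot x y'" by (simp add: cdot_def ring_distribs sum.distrib)
  show "cdot x (y - y') = cdot x y - cdot x y'" by (simp add: cdot_def ring_distribs sum_subtractf)
  show "cdot x (c *s y) = c * cdot x y" by (simp add: cdot_def sum_distrib_left mult_ac)
  show "cdot 0 y = 0" "cdot x 0 = 0" by (simp_all add: cdot_def)
  show "cdot x (- y) = - cdot x y" by (simp add: cdot_def sum_negf)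
qed

lemma bf_eq_cdot: "bf M x y = cdot x (M *v y)"
  by (simp add: bf_def cdot_def matrix_vector_mult_def sum_distrib_left mult.assoc)

lemma cdot_axis: "cdot (axis i 1) y = y $ i"
  by (simp add: cdot_def axis_def if_distrib[of "\<lambda>x. x * _"] cong: if_cong)

lemma vec_eq_cdotI: "(\<And>b. cdot b x = cdot b y) \<Longrightarrow> x = y"
  using cdot_axis by (metis vec_eq_iff)

lemma dual_pair:
  fixes k1 k2 :: "complex^'m"
  assumes "k1 \<noteq> k2" "vec.independent {k1, k2}"
  obtains \<xi>1 \<xi>2 where "cdot \<xi>1 k1 = 1" "cdot \<xi>1 k2 = 0" "cdot \<xi>2 k1 = 0" "cdot \<xi>2 k2 = 1"
proof -
  interpret vp: vector_space_pair "(*s) :: complex \<Rightarrow> complex^'m \<Rightarrow> complex^'m" "(*) :: complex \<Rightarrow> complex \<Rightarrow> complex"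
    using vec_vs complex_vs by (rule vector_space_pair.intro)
  have "\<exists>\<xi>. \<forall>x\<in>{k1, k2}. cdot \<xi> x = F x" for F
  proof -
    obtain f where f: "Vector_Spaces.linear (*s) (*) f" "\<forall>x\<in>{k1, k2}. f x = F x"
      using vp.linear_independent_extend[OF assms(2), of F] by blast
    have "cdot (\<chi> i. f (axis i 1)) x = f x" for x
      using clinear_expand[OF f(1), of x] by (simp add: cdot_def mult.commute)
    then show ?thesis using f(2) by metis
  qed
  from this[of "\<lambda>x. if x = k1 then 1 else 0"] this[of "\<lambda>x. if x = k2 then 1 else 0"]
  show thesis using that assms(1) by auto
qed

text \<open>Matrix of the 2-form xi_1 wedge xi_2, the border that fills a kernel of dimension
  two.\<close>

definition wedge_mat :: "complex^'m \<Rightarrow> complex^'m \<Rightarrow> complex^'m^'m" where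
  "wedge_mat \<xi>1 \<xi>2 = (\<chi> i j. \<xi>1 $ i * \<xi>2 $ j - \<xi>2 $ i * \<xi>1 $ j)"

lemma wedge_mat_mult: "wedge_mat \<xi>1 \<xi>2 *v x = cdot \<xi>2 x *s \<xi>1 - cdot \<xi>1 x *s \<xi>2"
  by (simp add: vec_eq_iff wedge_mat_def matrix_vector_mult_def cdot_def ring_distribs sum_subtractf sum_distrib_left mult_ac)

lemma skew_wedge_mat: "skew (wedge_mat \<xi>1 \<xi>2)"
  by (auto simp: skew_def wedge_mat_def)

lemma skew_add: assumes "skew M" "skew N" shows "skew (M + N)"
  unfolding skew_def
proof (intro allI)
  fix i j
  have "M $ j $ i = - M $ i $ j" "N $ j $ i = - N $ i $ j" using assms unfolding skew_def by blast+
  then show "(M + N) $ j $ i = - (M + N) $ i $ j" by simp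
qed

text \<open>Cramer's quotients of determinants rather than an abstract inverse: they display the
  holomorphic dependence on the matrix and on the right-hand side.\<close>

definition cramer_sol :: "complex^'m^'m \<Rightarrow> complex^'m \<Rightarrow> complex^'m" where
  "cramer_sol M b = (\<chi> k. det (\<chi> i j. if j = k then b $ i else M $ i $ j) / det M)"

lemma cramer_sol: "det M \<noteq> 0 \<Longrightarrow> M *v cramer_sol M b = b" "det M \<noteq> 0 \<Longrightarrow> M *v x = b \<Longrightarrow> x = cramer_sol M b"
  unfolding cramer_sol_def using cramer[of M] by blast+

lemma hol_det: "(\<And>i j. hol T U (\<lambda>t p. M t p $ i $ j)) \<Longrightarrow> hol T U (\<lambda>t p. det (M t p))"
  unfolding det_def by (intro hol_sum hol_mult hol_const hol_prod)

lemma hol_cramer_sol: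
  assumes "\<And>i j. hol T U (\<lambda>t p. M t p $ i $ j)" "\<And>i. hol T U (\<lambda>t p. b t p $ i)"
    "\<And>t p. t \<in> T \<Longrightarrow> p \<in> U \<Longrightarrow> det (M t p) \<noteq> 0"
  shows "hol T U (\<lambda>t p. cramer_sol (M t p) (b t p) $ k)"
proof -
  have "hol T U (\<lambda>t p. (\<chi> i j. if j = k then b t p $ i else M t p $ i $ j) $ i $ j)" for i j
  proof (cases "j = k")
    case True
    then show ?thesis using assms(2)[of i] by simp
  next
    case False
    then show ?thesis using assms(1)[of i j] by simp
  qed
  from hol_divide[OF hol_det[OF this] hol_det[OF assms(1)] assms(3)]
  show ?thesis by (simp only: cramer_sol_def vec_lambda_beta)
qed

lemma det_nonzero_iff: "det (M :: complex^'m^'m) \<noteq> 0 \<longleftrightarrow> (\<forall>x. M *v x = 0 \<longrightarrow> x = 0)"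
  using invertible_det_nz[of M] invertible_left_inverse[of M] matrix_left_invertible_ker[of M] by blast

text \<open>\<open>1 + cdot \<xi>1 y2\<close> plays the role of the Pfaffian of \<open>A\<close>: up to the nonvanishing
  determinant of \<open>A + wedge_mat \<xi>1 \<xi>2\<close>, its square is \<open>det A\<close>, and it is given by an
  explicit formula which depends analytically on \<open>A\<close>.\<close>

locale skew_pencil =
  fixes A :: "complex^'m^'m" and \<xi>1 \<xi>2 k1 k2 y1 y2 :: "complex^'m"
  assumes A: "skew A" and dual: "cdot \<xi>1 k1 = 1" "cdot \<xi>1 k2 = 0" "cdot \<xi>2 k1 = 0" "cdot \<xi>2 k2 = 1"
    and det: "det (A + wedge_mat \<xi>1 \<xi>2) \<noteq> 0"
    and y: "y1 = cramer_sol (A + wedge_mat \<xi>1 \<xi>2) \<xi>1" "y2 = cramer_sol (A + wedge_mat \<xi>1 \<xi>2) \<xi>2"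
begin

abbreviation "At \<equiv> A + wedge_mat \<xi>1 \<xi>2"
abbreviation "pf \<equiv> 1 + cdot \<xi>1 y2"

lemma skew_cdot: "cdot x (A *v z) = - cdot z (A *v x)" "cdot x (At *v z) = - cdot z (At *v x)"
  using bf_skew[OF A] bf_skew[OF skew_add[OF A skew_wedge_mat]] unfolding bf_eq_cdot by blast+

lemma At_y: "At *v y1 = \<xi>1" "At *v y2 = \<xi>2"
  unfolding y by (rule cramer_sol(1)[OF det])+

lemma At_mult: "At *v x = A *v x + (cdot \<xi>2 x *s \<xi>1 - cdot \<xi>1 x *s \<xi>2)"
  by (simp add: matrix_vector_mult_add_rdistrib wedge_mat_mult)

lemma inj: "At *v x = At *v z \<Longrightarrow> x = z"
  using cramer_sol(2)[OF det] by metis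

lemma y_cdot: "cdot \<xi>1 y1 = 0" "cdot \<xi>2 y2 = 0" "cdot \<xi>2 y1 = - cdot \<xi>1 y2"
  using skew_cdot(2)[of y1 y1] skew_cdot(2)[of y2 y2] skew_cdot(2)[of y1 y2]
  by (simp_all add: At_y cdot_linear(1)[of \<xi>1] cdot_linear(1)[of \<xi>2])

text \<open>Skewness of the bordered matrix gives xi_i(y_i) = 0 and xi_2(y_1) = - xi_1(y_2), which
  is why the same scalar \<open>pf\<close> occurs in both equations.\<close>

lemma A_y: "A *v y1 = pf *s \<xi>1" "A *v y2 = pf *s \<xi>2"
proof -
  have "A *v y1 = \<xi>1 - (cdot \<xi>2 y1 *s \<xi>1 - cdot \<xi>1 y1 *s \<xi>2)" using At_mult[of y1, symmetric] unfolding At_y by (simp only: eq_diff_eq)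
  then show "A *v y1 = pf *s \<xi>1" by (simp add: y_cdot vec_eq_iff algebra_simps)
  have "A *v y2 = \<xi>2 - (cdot \<xi>2 y2 *s \<xi>1 - cdot \<xi>1 y2 *s \<xi>2)" using At_mult[of y2, symmetric] unfolding At_y by (simp only: eq_diff_eq)
  then show "A *v y2 = pf *s \<xi>2" by (simp add: y_cdot vec_eq_iff algebra_simps)
qed

lemma dual_zero: assumes "a *s \<xi>1 + b *s \<xi>2 = 0" shows "a = 0" "b = 0"
proof -
  have "cdot (a *s \<xi>1 + b *s \<xi>2) k1 = 0" "cdot (a *s \<xi>1 + b *s \<xi>2) k2 = 0"
    unfolding assms by (simp_all add: cdot_linear(8))
  then show "a = 0" "b = 0" by (simp_all add: cdot_linear(2,4) dual)
qed

text \<open>On a kernel vector only the border acts, so \<open>x\<close> is a combination of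
  \<open>y1\<close> and \<open>y2\<close>. Applying \<open>A\<close> multiplies the corresponding
  combination of \<open>\<xi>1\<close> and \<open>\<xi>2\<close> by \<open>pf\<close>, and a nonzero
  \<open>pf\<close> would make the coefficients 0.\<close>

lemma degenerate_pf:
  assumes "A *v x = 0" "x \<noteq> 0" shows "pf = 0"
proof (rule ccontr)
  assume nz: "pf \<noteq> 0"
  have "At *v x = cdot \<xi>2 x *s \<xi>1 - cdot \<xi>1 x *s \<xi>2" using At_mult[of x] assms(1) by simp
  also have "\<dots> = At *v (cdot \<xi>2 x *s y1 - cdot \<xi>1 x *s y2)"
    by (simp add: matrix_vector_mult_diff_distrib vector_scalar_commute At_y)
  finally have x: "x = cdot \<xi>2 x *s y1 - cdot \<xi>1 x *s y2" by (rule inj)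
  have "0 = A *v (cdot \<xi>2 x *s y1 - cdot \<xi>1 x *s y2)" using assms(1) x by simp
  also have "\<dots> = (cdot \<xi>2 x * pf) *s \<xi>1 + (- cdot \<xi>1 x * pf) *s \<xi>2"
    by (simp add: matrix_vector_mult_diff_distrib vector_scalar_commute A_y vec_eq_iff algebra_simps)
  finally have "cdot \<xi>2 x * pf = 0" "- cdot \<xi>1 x * pf = 0" using dual_zero by metis+
  then have "cdot \<xi>2 x = 0" "cdot \<xi>1 x = 0" using nz by auto
  then show False using x assms(2) by simp
qed

text \<open>If \<open>pf\<close> vanishes, \<open>y1\<close> and \<open>y2\<close> are independent
  kernel vectors, and a linear functional annihilates some nonzero vector of their span. With
  \<open>l\<close> the derivative of \<open>g\<close> this yields kernel vectors tangent to the
  hypersurface.\<close>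

lemma kernel_in_hyperplane:
  assumes pf: "pf = 0" and l: "Vector_Spaces.linear (*s) (*) l"
  obtains x where "x \<noteq> 0" "A *v x = 0" "l x = 0"
proof -
  have ind: "a = 0 \<and> b = 0" if "a *s y1 + b *s y2 = 0" for a b
  proof -
    have "At *v (a *s y1 + b *s y2) = a *s \<xi>1 + b *s \<xi>2"
      by (simp add: matrix_vector_right_distrib vector_scalar_commute At_y)
    then have "a *s \<xi>1 + b *s \<xi>2 = 0" using that by simp
    then show ?thesis using dual_zero by blast
  qed
  have ker: "A *v (a *s y1 + b *s y2) = 0" for a b
    using pf by (simp add: matrix_vector_right_distrib vector_scalar_commute A_y)
  show thesis
  proof (cases "l y1 = 0 \<and> l y2 = 0")
    case True
    have "1 *s y1 + 0 *s y2 \<noteq> 0" using ind[of 1 0] by (metis one_neq_zero)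
    moreover have "l (1 *s y1 + 0 *s y2) = 0" using True by (simp only: clinear_add[OF l] clinear_scale[OF l]) simp
    ultimately show thesis using that ker by blast
  next
    case False
    have "l y2 *s y1 + (- l y1) *s y2 \<noteq> 0" using ind[of "l y2" "- l y1"] False by (metis neg_equal_0_iff_equal)
    moreover have "l (l y2 *s y1 + (- l y1) *s y2) = 0" by (simp only: clinear_add[OF l] clinear_scale[OF l]) simp
    ultimately show thesis using that ker by blast
  qed
qed

text \<open>On \<open>z\<close> the matrix \<open>A\<close> differs from the bordered one by
  multiples of \<open>\<xi>1\<close> and \<open>\<xi>2\<close>, while A y_i = g h xi_i. After
  multiplication by \<open>g\<close> these multiples are corrected with coefficients divided by
  \<open>h\<close> only, so no division by \<open>g\<close> takes place.\<close>

lemma solution: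
  assumes z: "At *v z = \<beta>" and g: "pf = g * h" "h \<noteq> 0"
  shows "A *v (g *s z + (cdot \<xi>2 z / h) *s y1 - (cdot \<xi>1 z / h) *s y2) = g *s \<beta>"
proof -
  have "A *v z = \<beta> - (cdot \<xi>2 z *s \<xi>1 - cdot \<xi>1 z *s \<xi>2)" using At_mult[of z, symmetric] unfolding z by (simp only: eq_diff_eq)
  then show ?thesis
    using g(2)
    by (simp add: matrix_vector_right_distrib matrix_vector_mult_diff_distrib vector_scalar_commute A_y g(1))
       (simp add: vec_eq_iff field_simps)
qed

text \<open>On kernel vectors the border alone acts, and duality makes it send \<open>k2\<close> to
  \<open>\<xi>1\<close> and \<open>- k1\<close> to \<open>\<xi>2\<close>.\<close>

lemma y_at_kernel:
  assumes "A *v k1 = 0" "A *v k2 = 0"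
  shows "y1 = k2" "y2 = - k1" "pf = 0"
proof -
  have "A *v (- k1) = 0" using matrix_vector_mult_diff_distrib[of A 0 k1] assms by simp
  then have "At *v k2 = \<xi>1" "At *v (- k1) = \<xi>2"
    unfolding At_mult using assms by (simp_all add: dual cdot_linear(10))
  then show k: "y1 = k2" "y2 = - k1" using inj At_y by metis+
  show "pf = 0" unfolding k by (simp add: cdot_linear(10) dual)
qed

text \<open>Pair the bordered image A k2 + xi_1 of \<open>k2\<close> with \<open>y2\<close>. Where A
  k2 = 0 and y2 = - k1, as at the origin, this form shows that the derivative of \<open>pf\<close>
  is just the derivative of \<open>A\<close> on (k1, k2).\<close>

lemma pf_alt: "pf = - bf A y2 k2"
proof -
  have "cdot y2 (At *v k2) = - cdot k2 \<xi>2" using skew_cdot(2)[of y2 k2] At_y by simp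
  then have "cdot y2 (A *v k2) + cdot y2 \<xi>1 = - 1"
    by (simp add: At_mult cdot_linear(5,6,7) dual cdot_linear(1)[of k2])
  then show ?thesis by (simp add: bf_eq_cdot cdot_linear(1)[of y2 \<xi>1] algebra_simps eq_neg_iff_add_eq_0)
qed

end

text \<open>By skewness the kernel vectors pair to 0 with A x, so the border applied to
  \<open>x\<close> pairs to 0 with \<open>k1\<close> and \<open>k2\<close>, and duality gives
  xi_1(x) = xi_2(x) = 0. Then A x = 0, and \<open>x\<close> is a combination of \<open>k1\<close>
  and \<open>k2\<close> with zero coefficients.\<close>

lemma det_pencil_nonzero:
  assumes A: "skew A" and dual: "cdot \<xi>1 k1 = 1" "cdot \<xi>1 k2 = 0" "cdot \<xi>2 k1 = 0" "cdot \<xi>2 k2 = 1"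
    and ker: "\<And>x. A *v x = 0 \<longleftrightarrow> x \<in> vec.span {k1, k2}"
  shows "det (A + wedge_mat \<xi>1 \<xi>2) \<noteq> 0"
  unfolding det_nonzero_iff
proof (intro allI impI)
  fix x assume x: "(A + wedge_mat \<xi>1 \<xi>2) *v x = 0"
  then have e: "A *v x + (cdot \<xi>2 x *s \<xi>1 - cdot \<xi>1 x *s \<xi>2) = 0"
    by (simp add: matrix_vector_mult_add_rdistrib wedge_mat_mult)
  have "cdot k (A *v x) = 0" if "k \<in> {k1, k2}" for k
  proof -
    have "A *v k = 0" using ker vec.span_base that by blast
    then show ?thesis using bf_skew[OF A, of x k] unfolding bf_eq_cdot by (simp add: cdot_linear(9))
  qed
  moreover have "cdot k (A *v x + (cdot \<xi>2 x *s \<xi>1 - cdot \<xi>1 x *s \<xi>2)) = 0" for k unfolding e by (simp add: cdot_linear(9))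
  ultimately have "cdot \<xi>2 x * cdot k \<xi>1 - cdot \<xi>1 x * cdot k \<xi>2 = 0" if "k \<in> {k1, k2}" for k
    using that by (simp only: cdot_linear(5,6,7)) (metis add_0)
  from this[of k1] this[of k2] have z: "cdot \<xi>2 x = 0" "cdot \<xi>1 x = 0"
    by (simp_all add: cdot_linear(1)[of k1] cdot_linear(1)[of k2] dual)
  then have "x \<in> vec.span {k1, k2}" using e ker by simp
  then obtain a b where "x = a *s k1 + b *s k2"
    unfolding vec.span_insert[of k1] vec.span_insert[of k2] by (auto simp: algebra_simps)
  then show "x = 0" using z by (simp add: cdot_linear(5,7) dual)
qed

text \<open>One radius for all parameters: |u t 0| has a positive minimum over the compact
  \<open>T\<close>, and uniform continuity keeps \<open>u t p\<close> closer than that to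
  \<open>u t 0\<close>.\<close>

lemma nonzero_near_zero:
  fixes u :: "real \<Rightarrow> complex^'m \<Rightarrow> complex"
  assumes T: "compact T" and u: "hol T (ball 0 R) u" and R: "R > 0" and nz: "\<And>t. t \<in> T \<Longrightarrow> u t 0 \<noteq> 0"
  obtains r where "r > 0" "r \<le> R" "\<And>t p. t \<in> T \<Longrightarrow> p \<in> ball 0 r \<Longrightarrow> u t p \<noteq> 0"
proof (cases "T = {}")
  case True
  then show ?thesis using that[of R] R by auto
next
  case False
  have c0: "continuous_on T (\<lambda>t. cmod (u t 0))"
    by (intro continuous_on_norm hol_cont2[OF u] continuous_intros) (use R in auto)
  obtain t0 where t0: "t0 \<in> T" "\<And>t. t \<in> T \<Longrightarrow> cmod (u t0 0) \<le> cmod (u t 0)"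
    using continuous_attains_inf[OF T False c0] by blast
  have "compact (T \<times> cball (0::complex^'m) (R/2))" by (intro compact_Times T compact_cball)
  moreover have "continuous_on (T \<times> cball 0 (R/2)) (\<lambda>x. u (fst x) (snd x))"
    by (rule continuous_on_subset[OF hol_cont[OF u]]) (use R in auto)
  ultimately have "uniformly_continuous_on (T \<times> cball 0 (R/2)) (\<lambda>x. u (fst x) (snd x))"
    by (rule compact_uniformly_continuous[rotated])
  moreover have "cmod (u t0 0) > 0" using nz[OF t0(1)] by simp
  ultimately obtain d where d: "d > 0" "\<And>x x'. x \<in> T \<times> cball 0 (R/2) \<Longrightarrow> x' \<in> T \<times> cball 0 (R/2) \<Longrightarrow> dist x' x < d \<Longrightarrow>
      dist (u (fst x') (snd x')) (u (fst x) (snd x)) < cmod (u t0 0)"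
    unfolding uniformly_continuous_on_def by metis
  show ?thesis
  proof (rule that[of "min d (R/2)"])
    show "min d (R/2) > 0" "min d (R/2) \<le> R" using d R by auto
    fix t and p :: "complex^'m" assume tp: "t \<in> T" "p \<in> ball 0 (min d (R/2))"
    have "dist (t, p) (t, 0) < d" using tp by (simp add: dist_Pair_Pair)
    then have "dist (u t p) (u t 0) < cmod (u t0 0)"
      using d(2)[of "(t, 0)" "(t, p)"] tp R by simp
    then show "u t p \<noteq> 0" using t0(2)[OF tp(1)] by (auto simp: dist_norm)
  qed
qed

text \<open>Since g 0 = 0, points near the origin are displaced little, at all times of the slide at
  once.\<close>

lemma retraction_small:
  fixes g :: "complex^'m \<Rightarrow> complex"
  assumes g: "cdiff g 0" "g 0 = 0" and R: "R > 0" and \<rho>: "\<rho> > 0"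
  obtains r where "r > 0" "r \<le> \<rho>" "\<And>\<theta> p. \<theta> \<in> {0..1} \<Longrightarrow> p \<in> ball 0 r \<Longrightarrow> p - (of_real (1 - \<theta>) * g p) *s \<nu> \<in> ball 0 R"
proof -
  have "isCont (\<lambda>p. norm p + cmod (g p) * norm \<nu>) 0"
    by (intro continuous_intros cdiff_isCont g)
  then obtain d where d: "d > 0" "\<And>p. dist p 0 < d \<Longrightarrow> dist (norm p + cmod (g p) * norm \<nu>) (norm (0::complex^'m) + cmod (g 0) * norm \<nu>) < R"
    using R unfolding continuous_at_eps_delta by blast
  show thesis
  proof (rule that[of "min d \<rho>"])
    fix \<theta> :: real and p :: "complex^'m" assume th: "\<theta> \<in> {0..1}" and p: "p \<in> ball 0 (min d \<rho>)"
    have "cmod (of_real (1 - \<theta>)) \<le> 1" using th unfolding norm_of_real by auto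
    then have "cmod (of_real (1 - \<theta>) * g p) \<le> 1 * cmod (g p)"
      unfolding norm_mult by (intro mult_right_mono) auto
    then have "norm ((of_real (1 - \<theta>) * g p) *s \<nu>) \<le> cmod (g p) * norm \<nu>"
      unfolding norm_cscale by (intro mult_right_mono) auto
    then have "norm (p - (of_real (1 - \<theta>) * g p) *s \<nu>) \<le> norm p + cmod (g p) * norm \<nu>"
      using norm_triangle_ineq4[of p "(of_real (1 - \<theta>) * g p) *s \<nu>"] by linarith
    also have "\<dots> < R" using d(2)[of p] p g(2) by (simp add: dist_norm)
    finally show "p - (of_real (1 - \<theta>) * g p) *s \<nu> \<in> ball 0 R" by simp
  qed (use d \<rho> in auto)
qed

lemma closed_mat_on_subset: "closed_mat_on U M \<Longrightarrow> V \<subseteq> U \<Longrightarrow> closed_mat_on V M"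
  unfolding closed_mat_on_def by blast

text \<open>\<open>pf\<close> vanishes at the points p - g p * nu, where \<open>A\<close>
  degenerates, so \<open>hadamard\<close> divides it by \<open>g\<close>. The last two conclusions
  express the derivative of \<open>pf\<close> at 0 through the quotient: its value in direction
  \<open>\<nu>\<close> is the quotient itself, and its value in a general direction is the quotient
  times the derivative of \<open>g\<close>.\<close>

lemma pfaffian_division:
  fixes A :: "real \<Rightarrow> complex^'m \<Rightarrow> complex^'m^'m" and g :: "complex^'m \<Rightarrow> complex"
  assumes T: "compact T" and R: "R > 0" and A: "\<And>i j. hol T (ball 0 R) (\<lambda>t p. A t p $ i $ j)"
    and sk: "\<And>t p. t \<in> T \<Longrightarrow> p \<in> ball 0 R \<Longrightarrow> skew (A t p)"
    and dual: "cdot \<xi>1 k1 = 1" "cdot \<xi>1 k2 = 0" "cdot \<xi>2 k1 = 0" "cdot \<xi>2 k2 = 1"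
    and ker: "\<And>t. t \<in> T \<Longrightarrow> A t 0 *v k1 = 0" "\<And>t. t \<in> T \<Longrightarrow> A t 0 *v k2 = 0"
    and det: "\<And>t. t \<in> T \<Longrightarrow> det (A t 0 + wedge_mat \<xi>1 \<xi>2) \<noteq> 0"
    and \<rho>: "\<rho> > 0" and g: "\<And>p. p \<in> ball 0 \<rho> \<Longrightarrow> cdiff g p" "g 0 = 0"
    and deg: "\<And>t p. t \<in> T \<Longrightarrow> p \<in> ball 0 \<rho> \<Longrightarrow> \<exists>x. x \<noteq> 0 \<and> A t (p - g p *s \<nu>) *v x = 0"
  obtains r k where "r > 0" "r \<le> \<rho>" "r \<le> R" "\<And>t p. t \<in> T \<Longrightarrow> p \<in> ball 0 r \<Longrightarrow> det (A t p + wedge_mat \<xi>1 \<xi>2) \<noteq> 0"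
    "hol T (ball 0 r) k"
    "\<And>t p. t \<in> T \<Longrightarrow> p \<in> ball 0 r \<Longrightarrow> 1 + cdot \<xi>1 (cramer_sol (A t p + wedge_mat \<xi>1 \<xi>2) \<xi>2) = g p * k t p"
    "\<And>t. t \<in> T \<Longrightarrow> k t 0 = bf (dmat (A t) 0 \<nu>) k1 k2"
    "\<And>t w. t \<in> T \<Longrightarrow> bf (dmat (A t) 0 w) k1 k2 = fder g 0 w * k t 0"
proof -
  let ?W = "wedge_mat \<xi>1 \<xi>2"
  have hAt: "hol T (ball 0 R) (\<lambda>t p. (A t p + ?W) $ i $ j)" for i j
    unfolding vector_add_component by (intro hol_add A hol_const)
  obtain R1 where R1: "R1 > 0" "R1 \<le> R" "\<And>t p. t \<in> T \<Longrightarrow> p \<in> ball 0 R1 \<Longrightarrow> det (A t p + ?W) \<noteq> 0"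
    using nonzero_near_zero[OF T hol_det[OF hAt] R det] by blast
  have sub: "ball 0 R1 \<subseteq> ball (0::complex^'m) R" using R1(2) by auto
  define y where "y t p = cramer_sol (A t p + ?W) \<xi>2" for t p
  have sp: "skew_pencil (A t p) \<xi>1 \<xi>2 k1 k2 (cramer_sol (A t p + ?W) \<xi>1) (y t p)" if "t \<in> T" "p \<in> ball 0 R1" for t p
    by unfold_locales (use that sub sk dual R1(3) in \<open>auto simp: y_def subset_iff\<close>)
  have hy: "hol T (ball 0 R1) (\<lambda>t p. y t p $ i)" for i
    unfolding y_def by (intro hol_cramer_sol hol_subset[OF hAt subset_refl sub] hol_const R1(3))
  define h where "h t p = 1 + cdot \<xi>1 (y t p)" for t p
  have hh: "hol T (ball 0 R1) h"
    unfolding h_def cdot_def by (intro hol_add hol_const hol_sum hol_mult hy)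
  have g0: "cdiff g 0" using g(1) \<rho> by simp
  obtain r where r: "r > 0" "r \<le> min \<rho> R" "\<And>\<theta> p. \<theta> \<in> {0..1} \<Longrightarrow> p \<in> ball 0 r \<Longrightarrow> p - (of_real (1 - \<theta>) * g p) *s \<nu> \<in> ball 0 (min R1 R1)"
    using retraction_small[OF g0 g(2), of R1 "min \<rho> R" \<nu>] R1(1) \<rho> R by auto
  have z: "h t (p - g p *s \<nu>) = 0" if tp: "t \<in> T" "p \<in> ball 0 r" for t p
  proof -
    have "p - g p *s \<nu> \<in> ball 0 R1" using r(3)[of 0 p] tp by simp
    then show ?thesis
      using deg[OF tp(1), of p] tp(2) r(2) skew_pencil.degenerate_pf[OF sp[OF tp(1)]] unfolding h_def by auto
  qed
  define k where "k t p = integral {0..1} (\<lambda>\<theta>. fder (h t) (p - (of_real (1 - \<theta>) * g p) *s \<nu>) \<nu>)" for t p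
  have cg: "cdiff g p" if "p \<in> ball 0 r" for p using g(1) that r(2) by simp
  have Fr: "p - (of_real (1 - \<theta>) * g p) *s \<nu> \<in> ball 0 R1" if "\<theta> \<in> {0..1}" "p \<in> ball 0 r" for \<theta> p
    using r(3)[OF that] by simp
  have k: "hol T (ball 0 r) k" "\<And>t p. t \<in> T \<Longrightarrow> p \<in> ball 0 r \<Longrightarrow> h t p = g p * k t p"
    unfolding k_def by (rule hadamard[OF hh open_ball open_ball cg Fr z]; assumption)+
  have rR1: "ball 0 r \<subseteq> ball (0::complex^'m) R1"
    using r(3)[of 1] by auto
  have z1: "0 \<in> ball (0::complex^'m) R1" "0 \<in> ball (0::complex^'m) r" "0 \<in> ball (0::complex^'m) R" using R1 r R by auto
  have dh: "fder (h t) 0 w = bf (dmat (A t) 0 w) k1 k2" if t: "t \<in> T" for t w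
  proof -
    note s0 = sp[OF t z1(1)]
    have y0: "y t 0 = - k1" by (rule skew_pencil.y_at_kernel(2)[OF s0 ker[OF t]])
    have cA: "cdiff (\<lambda>q. A t q $ i $ j) 0" for i j by (rule hol_cdiff[OF A t z1(3)])
    have cy: "cdiff (\<lambda>q. y t q $ i) 0" for i by (rule hol_cdiff[OF hy t z1(1)])
    note cb = cdiff_bf[OF cA cy, where y = k2]
    \<comment> \<open>In the form of \<open>pf_alt\<close> the product rule leaves the derivative of
      \<open>y\<close> paired with A k2, which is 0 at the origin; so that derivative never has to
      be computed.\<close>
    have "fder (h t) 0 = fder (\<lambda>p. - bf (A t p) (y t p) k2) 0"
    proof (rule cdiff_cong_open(2)[OF cdiff_fder_minus(1)[OF cb(1)] open_ball z1(1)])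
      fix q :: "complex^'m" assume q: "q \<in> ball 0 R1"
      show "- bf (A t q) (y t q) k2 = h t q"
        using skew_pencil.pf_alt[OF sp[OF t q]] unfolding h_def by simp
    qed
    then have "fder (h t) 0 w = - (bf (dmat (A t) 0 w) (- k1) k2 + cdot (vder (y t) 0 w) (A t 0 *v k2))"
      unfolding cdiff_fder_minus(2)[OF cb(1)] cb(2) y0 bf_eq_cdot[of "A t 0"] by (simp only:)
    moreover have "bf M (- k1) k2 = - bf M k1 k2" for M
      using bf_linear(4)[of M 0 k1 k2] bf_linear(5)[of M 0 0 k2] by simp
    ultimately show ?thesis using ker(2)[OF t] by (simp add: cdot_linear(9))
  qed
  show thesis
  proof (rule that[OF r(1)])
    show "r \<le> \<rho>" "r \<le> R" using r(2) by auto
    show "det (A t p + ?W) \<noteq> 0" if "t \<in> T" "p \<in> ball 0 r" for t p using R1(3) that rR1 by blast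
    show "hol T (ball 0 r) k" by (rule k(1))
    show "1 + cdot \<xi>1 (cramer_sol (A t p + ?W) \<xi>2) = g p * k t p" if "t \<in> T" "p \<in> ball 0 r" for t p
      using k(2)[OF that] by (simp add: h_def y_def)
    show "k t 0 = bf (dmat (A t) 0 \<nu>) k1 k2" if "t \<in> T" for t
      by (simp add: k_def g(2) dh[OF that])
    show "bf (dmat (A t) 0 w) k1 k2 = fder g 0 w * k t 0" if t: "t \<in> T" for t w
    proof -
      have "fder (h t) 0 = fder (\<lambda>p. g p * k t p) 0"
        by (rule cdiff_cong_open(2)[OF cdiff_fder_mult(1)[OF g0 hol_cdiff[OF k(1) t z1(2)]] open_ball z1(2)])
           (simp only: k(2)[OF t])
      then have "fder (h t) 0 w = fder g 0 w * k t 0"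
        unfolding cdiff_fder_mult(2)[OF g0 hol_cdiff[OF k(1) t z1(2)]] by (simp add: g(2))
      then show ?thesis using dh[OF t] by simp
    qed
  qed
qed

text \<open>On vectors of the form a - l a * nu the two forms, and with them the pencil, agree.
  Contracting the pencil with \<open>x0\<close> or \<open>x1\<close> therefore leaves a multiple of
  \<open>l\<close>, and two multiples of one functional are dependent; this gives a combination of
  \<open>x0\<close> and \<open>x1\<close> in the kernel. Were that combination 0 itself, the two
  vectors would be proportional and \<open>x0\<close> would lie in both kernels.\<close>

lemma degenerate_pencil:
  fixes B0 B1 :: "complex^'m^'m" and t :: complex
  defines "Bt \<equiv> \<chi> i j. B0 $ i $ j + t * (B1 $ i $ j - B0 $ i $ j)"
  assumes sk: "skew B0" "skew B1" and x0: "x0 \<noteq> 0" "B0 *v x0 = 0" "l x0 = 0" and x1: "x1 \<noteq> 0" "B1 *v x1 = 0" "l x1 = 0"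
    and eq: "\<And>a b. bf B0 (a - l a *s \<nu>) (b - l b *s \<nu>) = bf B1 (a - l a *s \<nu>) (b - l b *s \<nu>)"
  shows "\<exists>x. x \<noteq> 0 \<and> Bt *v x = 0"
proof -
  have Bt: "bf Bt x y = bf B0 x y + t * (bf B1 x y - bf B0 x y)" for x y
  proof -
    have "Bt = B0 + (\<chi> i j. t * (B1 - B0) $ i $ j)" by (simp add: Bt_def vec_eq_iff)
    then show ?thesis by (simp only: bf_linear(1,2,9))
  qed
  have skt: "bf Bt x y = - bf Bt y x" for x y
    unfolding Bt using bf_skew[OF sk(1), of x y] bf_skew[OF sk(2), of x y] by (simp add: algebra_simps)
  have kl: "bf B0 x0 b = 0" "bf B1 x1 b = 0" for b
    using bf_skew[OF sk(1), of b x0] bf_skew[OF sk(2), of b x1] x0(2) x1(2) unfolding bf_eq_cdot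
    by (metis cdot_linear(9) neg_equal_0_iff_equal)+
  have w: "bf Bt x0 (b - l b *s \<nu>) = 0" "bf Bt x1 (b - l b *s \<nu>) = 0" for b
    unfolding Bt using eq[of x0 b] eq[of x1 b] kl x0(3) x1(3) by simp_all
  have v: "bf Bt x0 b = l b * bf Bt x0 \<nu>" "bf Bt x1 b = l b * bf Bt x1 \<nu>" for b
    using w(1)[of b] w(2)[of b] by (simp_all only: bf_linear(7,8) right_minus_eq)
  have fin: "Bt *v x = 0" if "\<And>b. bf Bt x b = 0" for x
  proof (rule vec_eq_cdotI)
    fix b show "cdot b (Bt *v x) = cdot b 0"
      using skt[of b x] that[of b] by (simp add: bf_eq_cdot cdot_linear(9))
  qed
  \<comment> \<open>Coefficients for which the two contractions cancel at
    \<open>\<nu>\<close>.\<close>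
  define c0 where "c0 = - bf Bt x1 \<nu>"
  define c1 where "c1 = bf Bt x0 \<nu>"
  show ?thesis
  proof (cases "c1 = 0")
    case True
    then have "bf Bt x0 b = 0" for b using v(1)[of b] by (simp add: c1_def)
    then show ?thesis using fin x0(1) by blast
  next
    case False
    let ?x = "c0 *s x0 + c1 *s x1"
    have z: "bf Bt ?x b = 0" for b
    proof -
      have "bf Bt ?x b = c0 * bf Bt x0 b + c1 * bf Bt x1 b" by (simp only: bf_linear)
      also have "\<dots> = 0" unfolding v[of b] c0_def c1_def by (simp add: algebra_simps)
      finally show ?thesis .
    qed
    show ?thesis
    proof (cases "?x = 0")
      case True
      have x1e: "x1 = (- (c0 / c1)) *s x0"
        using True \<open>c1 \<noteq> 0\<close> by (simp add: vec_eq_iff field_simps add_eq_0_iff)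
      then have "c0 \<noteq> 0" using x1(1) by auto
      have "bf B1 x0 b = 0" for b
      proof -
        have "0 = - (c0 / c1) * bf B1 x0 b" using kl(2)[of b] unfolding x1e bf_linear by simp
        then show ?thesis using \<open>c0 \<noteq> 0\<close> \<open>c1 \<noteq> 0\<close> by simp
      qed
      then have "bf Bt x0 b = 0" for b unfolding Bt using kl by simp
      then show ?thesis using fin x0(1) by blast
    next
      case False
      then show ?thesis using fin[OF z] by blast
    qed
  qed
qed

text \<open>The zeros of an entire function that is not identically 0 are countable, so the plane
  without them is open and connected, whereas a real segment might meet them. A polynomial path
  provides the continuous velocity that enters the vector field.\<close>

lemma complex_path:
  fixes q :: "complex \<Rightarrow> complex"
  assumes q: "q holomorphic_on UNIV" "q 0 \<noteq> 0" "q 1 \<noteq> 0"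
  obtains \<gamma> \<gamma>' :: "real \<Rightarrow> complex" where "\<gamma> 0 = 0" "\<gamma> 1 = 1" "\<And>s. s \<in> {0..1} \<Longrightarrow> q (\<gamma> s) \<noteq> 0"
    "\<And>s. (\<gamma> has_vector_derivative \<gamma>' s) (at s within {0..1})" "continuous_on {0..1} \<gamma>" "continuous_on {0..1} \<gamma>'"
proof -
  let ?Z = "{z. q z = 0}"
  have "countable ?Z"
  proof (cases "q constant_on UNIV")
    case True
    then have "?Z = {}" using q(2) unfolding constant_on_def by auto
    then show ?thesis by simp
  next
    case False
    then show ?thesis
      using holomorphic_countable_zeros[OF q(1) open_UNIV connected_UNIV] by (simp add: fsigma_UNIV)
  qed
  then have "connected (UNIV - ?Z)" by (intro connected_open_diff_countable) auto
  moreover have "open (UNIV - ?Z)"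
  proof -
    have "UNIV - ?Z = {z. q z \<noteq> 0}" by auto
    then show ?thesis
      using holomorphic_on_imp_continuous_on[OF q(1)] by (simp add: open_Collect_neq)
  qed
  ultimately obtain \<gamma> where \<gamma>: "polynomial_function \<gamma>" "path_image \<gamma> \<subseteq> UNIV - ?Z" "pathstart \<gamma> = 0" "pathfinish \<gamma> = 1"
    using connected_open_polynomial_connected[of "UNIV - ?Z" 0 1] q(2,3) by auto
  obtain \<gamma>' where \<gamma>': "polynomial_function \<gamma>'" "\<And>x. (\<gamma> has_vector_derivative \<gamma>' x) (at x)"
    by (rule has_vector_derivative_polynomial_function[OF \<gamma>(1)]) (rule that; assumption)
  show thesis
  proof (rule that[of \<gamma> \<gamma>'])
    show "\<gamma> 0 = 0" "\<gamma> 1 = 1" using \<gamma>(3,4) by (simp_all add: pathstart_def pathfinish_def)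
    show "q (\<gamma> s) \<noteq> 0" if "s \<in> {0..1}" for s using \<gamma>(2) that unfolding path_image_def by blast
    show "(\<gamma> has_vector_derivative \<gamma>' s) (at s within {0..1})" for s
      using \<gamma>'(2) by (rule has_vector_derivative_at_within)
    show "continuous_on {0..1} \<gamma>" "continuous_on {0..1} \<gamma>'"
      using \<gamma>(1) \<gamma>'(1) by (auto intro: continuous_on_polymonial_function)
  qed
qed

text \<open>Written with the summand (-1) * B0 so that it is literally the pencil obtained by
  applying \<open>closed_mat_on_lincomb\<close> twice.\<close>

abbreviation interp :: "complex^'m^'m \<Rightarrow> complex^'m^'m \<Rightarrow> complex \<Rightarrow> complex^'m^'m" where
  "interp B0 B1 t \<equiv> \<chi> i j. B0 $ i $ j + t * (\<chi> i j. B1 $ i $ j + (-1) * B0 $ i $ j) $ i $ j"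

lemma interp_mult: "interp B0 B1 t *v x = B0 *v x + t *s (B1 *v x - B0 *v x)"
proof -
  have "(interp B0 B1 t *v x) $ i = (\<Sum>j\<in>UNIV. B0 $ i $ j * x $ j + t * (B1 $ i $ j * x $ j - B0 $ i $ j * x $ j))" for i
    unfolding matrix_vector_mult_def vec_lambda_beta by (rule sum.cong) (simp_all add: ring_distribs mult_ac)
  also have "(\<Sum>j\<in>UNIV. B0 $ i $ j * x $ j + t * (B1 $ i $ j * x $ j - B0 $ i $ j * x $ j)) =
      (B0 *v x + t *s (B1 *v x - B0 *v x)) $ i" for i
    by (simp add: matrix_vector_mult_def sum.distrib sum_distrib_left[symmetric] sum_subtractf right_diff_distrib)
  finally have "(interp B0 B1 t *v x) $ i = (B0 *v x + t *s (B1 *v x - B0 *v x)) $ i" for i .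
  then show ?thesis unfolding vec_eq_iff by blast
qed

lemma interp_eq: "interp B0 B1 t = (\<chi> i j. B0 $ i $ j + t * (B1 $ i $ j - B0 $ i $ j))"
  by (simp add: vec_eq_iff)

lemma holomorphic_det_pencil:
  fixes B :: "complex^'m^'m"
  shows "(\<lambda>t. det (interp B0 B1 t + B)) holomorphic_on S"
  unfolding det_def vector_add_component vec_lambda_beta
  by (intro holomorphic_on_sum holomorphic_on_mult holomorphic_on_prod holomorphic_on_add holomorphic_on_const
      holomorphic_on_ident)

text \<open>With a one-point parameter set, \<open>pfaffian_division\<close> shows that the
  derivative of the form on the kernel is the derivative of \<open>g\<close> times a quotient. One
  nonzero value makes the quotient nonzero, and the quotient is the derivative in direction
  \<open>\<nu>\<close>. On the hypersurface \<open>pf\<close> vanishes, which provides the tangent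
  kernel vector that \<open>degenerate_pencil\<close> requires.\<close>

lemma single_pencil:
  fixes A :: "complex^'m \<Rightarrow> complex^'m^'m" and g :: "complex^'m \<Rightarrow> complex"
  assumes R: "R > 0" and A: "closed_mat_on (ball 0 R) A"
    and dual: "cdot \<xi>1 k1 = 1" "cdot \<xi>1 k2 = 0" "cdot \<xi>2 k1 = 0" "cdot \<xi>2 k2 = 1"
    and ker: "\<And>x. A 0 *v x = 0 \<longleftrightarrow> x \<in> vec.span {k1, k2}"
    and nz: "bf (dmat A 0 w) k1 k2 \<noteq> 0"
    and \<rho>: "\<rho> > 0" and g: "\<And>p. p \<in> ball 0 \<rho> \<Longrightarrow> cdiff g p" "g 0 = 0"
    and deg: "\<And>p. p \<in> ball 0 \<rho> \<Longrightarrow> \<exists>x. x \<noteq> 0 \<and> A (p - g p *s \<nu>) *v x = 0"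
  obtains r where "r > 0" "r \<le> \<rho>" "bf (dmat A 0 \<nu>) k1 k2 \<noteq> 0"
    "\<And>p. p \<in> ball 0 r \<Longrightarrow> \<exists>x. x \<noteq> 0 \<and> A (p - g p *s \<nu>) *v x = 0 \<and> fder g p x = 0"
proof -
  have kk: "A 0 *v k1 = 0" "A 0 *v k2 = 0" using ker by (auto intro: vec.span_base)
  have 0: "0 \<in> ball (0::complex^'m) R" using R by simp
  have det0: "det (A 0 + wedge_mat \<xi>1 \<xi>2) \<noteq> 0"
    by (rule det_pencil_nonzero[OF closed_mat_onD(2)[OF A 0] dual ker])
  obtain r k where r: "r > 0" "r \<le> \<rho>" "r \<le> R" and det: "\<And>t p. t \<in> {0::real} \<Longrightarrow> p \<in> ball 0 r \<Longrightarrow> det (A p + wedge_mat \<xi>1 \<xi>2) \<noteq> 0"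
    and "hol {0::real} (ball 0 r) k"
    "\<And>t p. t \<in> {0} \<Longrightarrow> p \<in> ball 0 r \<Longrightarrow> 1 + cdot \<xi>1 (cramer_sol (A p + wedge_mat \<xi>1 \<xi>2) \<xi>2) = g p * k t p"
    and k: "\<And>t. t \<in> {0} \<Longrightarrow> k t 0 = bf (dmat A 0 \<nu>) k1 k2"
    "\<And>t w. t \<in> {0} \<Longrightarrow> bf (dmat A 0 w) k1 k2 = fder g 0 w * k t 0"
    by (rule pfaffian_division[where T = "{0::real}" and A = "\<lambda>_. A", OF compact_sing R hol_indep[OF closed_mat_onD(1)[OF A]]
          closed_mat_onD(2)[OF A] dual kk det0 \<rho> g deg], assumption+, rule that; assumption)
  have "fder g 0 w * k 0 0 \<noteq> 0" using nz k(2)[of 0 w] by simp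
  then have a: "bf (dmat A 0 \<nu>) k1 k2 \<noteq> 0" using k(1)[of 0] by simp
  have g0: "cdiff g 0" using g(1) \<rho> by simp
  obtain r' where r': "r' > 0" "r' \<le> \<rho>" "\<And>\<theta> p. \<theta> \<in> {0..1} \<Longrightarrow> p \<in> ball 0 r' \<Longrightarrow> p - (of_real (1 - \<theta>) * g p) *s \<nu> \<in> ball 0 r"
    by (rule retraction_small[OF g0 g(2) r(1) \<rho>, where \<nu> = \<nu>]) (rule that; assumption)
  show thesis
  proof (rule that[OF r'(1,2) a])
    fix p :: "complex^'m" assume p: "p \<in> ball 0 r'"
    let ?q = "p - g p *s \<nu>"
    have q: "?q \<in> ball 0 r" using r'(3)[of 0 p] p by simp
    then have qR: "?q \<in> ball 0 R" using r(3) by auto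
    have p\<rho>: "p \<in> ball 0 \<rho>" using p r'(2) by simp
    have d: "det (A ?q + wedge_mat \<xi>1 \<xi>2) \<noteq> 0" by (rule det[OF _ q]) simp
    interpret skew_pencil "A ?q" \<xi>1 \<xi>2 k1 k2 "cramer_sol (A ?q + wedge_mat \<xi>1 \<xi>2) \<xi>1" "cramer_sol (A ?q + wedge_mat \<xi>1 \<xi>2) \<xi>2"
      by unfold_locales (use closed_mat_onD(2)[OF A qR] dual d in auto)
    have "pf = 0" using deg[OF p\<rho>] degenerate_pf by blast
    then show "\<exists>x. x \<noteq> 0 \<and> A ?q *v x = 0 \<and> fder g p x = 0"
      using kernel_in_hyperplane[OF _ cdiff_clinear[OF g(1)[OF p\<rho>]]] by metis
  qed
qed

theorem matrix_equivalence:
  fixes A0 A1 :: "complex^'m \<Rightarrow> complex^'m^'m" and g :: "complex^'m \<Rightarrow> complex"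
  assumes R: "R > 0" and A0: "closed_mat_on (ball 0 R) A0" and A1: "closed_mat_on (ball 0 R) A1"
    and k: "k1 \<noteq> k2" "vec.independent {k1, k2}"
    and ker0: "\<And>x. A0 0 *v x = 0 \<longleftrightarrow> x \<in> vec.span {k1, k2}" and ker1: "\<And>x. A1 0 *v x = 0 \<longleftrightarrow> x \<in> vec.span {k1, k2}"
    and nz: "bf (dmat A0 0 w0) k1 k2 \<noteq> 0" "bf (dmat A1 0 w1) k1 k2 \<noteq> 0"
    and \<rho>: "\<rho> > 0" and g: "\<And>p. p \<in> ball 0 \<rho> \<Longrightarrow> cdiff g p" "g 0 = 0"
    and deg0: "\<And>p. p \<in> ball 0 \<rho> \<Longrightarrow> \<exists>x. x \<noteq> 0 \<and> A0 (p - g p *s \<nu>) *v x = 0"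
    and deg1: "\<And>p. p \<in> ball 0 \<rho> \<Longrightarrow> \<exists>x. x \<noteq> 0 \<and> A1 (p - g p *s \<nu>) *v x = 0"
    and tang: "\<And>p a b. p \<in> ball 0 \<rho> \<Longrightarrow>
       bf (A0 (p - g p *s \<nu>)) (a - fder g p a *s \<nu>) (b - fder g p b *s \<nu>) =
       bf (A1 (p - g p *s \<nu>)) (a - fder g p a *s \<nu>) (b - fder g p b *s \<nu>)"
  obtains r and \<Psi> :: "complex^'m \<Rightarrow> complex^'m" where "r > 0" "\<And>i p. p \<in> ball 0 r \<Longrightarrow> cdiff (\<lambda>p. \<Psi> p $ i) p"
    "\<Psi> 0 = 0" "\<And>p. p \<in> ball 0 r \<Longrightarrow> \<Psi> p \<in> ball 0 R" "\<And>v. vder \<Psi> 0 v = 0 \<Longrightarrow> v = 0"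
    "\<And>p u v. p \<in> ball 0 r \<Longrightarrow> bf (A1 (\<Psi> p)) (vder \<Psi> p u) (vder \<Psi> p v) = bf (A0 p) u v"
proof -
  have z0: "0 \<in> ball (0::complex^'m) R" using R by simp
  obtain \<xi>1 \<xi>2 where dual: "cdot \<xi>1 k1 = 1" "cdot \<xi>1 k2 = 0" "cdot \<xi>2 k1 = 0" "cdot \<xi>2 k2 = 1"
    by (rule dual_pair[OF k]) (rule that; assumption)
  let ?W = "wedge_mat \<xi>1 \<xi>2"
  define a0 where "a0 = bf (dmat A0 0 \<nu>) k1 k2"
  define a1 where "a1 = bf (dmat A1 0 \<nu>) k1 k2"
  obtain r0 where r0: "r0 > 0" "r0 \<le> \<rho>" "bf (dmat A0 0 \<nu>) k1 k2 \<noteq> 0"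
    "\<And>p. p \<in> ball 0 r0 \<Longrightarrow> \<exists>x. x \<noteq> 0 \<and> A0 (p - g p *s \<nu>) *v x = 0 \<and> fder g p x = 0"
    by (rule single_pencil[OF R A0 dual ker0 nz(1) \<rho> g deg0], assumption+, rule that; assumption)
  obtain r1 where r1: "r1 > 0" "r1 \<le> \<rho>" "bf (dmat A1 0 \<nu>) k1 k2 \<noteq> 0"
    "\<And>p. p \<in> ball 0 r1 \<Longrightarrow> \<exists>x. x \<noteq> 0 \<and> A1 (p - g p *s \<nu>) *v x = 0 \<and> fder g p x = 0"
    by (rule single_pencil[OF R A1 dual ker1 nz(2) \<rho> g deg1], assumption+, rule that; assumption)
  \<comment> \<open>Its zeros are the parameters to avoid: the first factor keeps the bordered
    matrix invertible at 0, and the second is the value at 0 of the quotient pf / g, affine in the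
    parameter.\<close>
  define q where "q t = det (interp (A0 0) (A1 0) t + ?W) * (a0 + t * (a1 - a0))" for t
  have i01: "interp (A0 0) (A1 0) 0 = A0 0" "interp (A0 0) (A1 0) 1 = A1 0" by (simp_all add: vec_eq_iff)
  have q0: "q 0 \<noteq> 0" unfolding q_def i01
    using det_pencil_nonzero[OF closed_mat_onD(2)[OF A0 z0] dual ker0] r0(3) by (simp add: a0_def)
  have q1: "q 1 \<noteq> 0" unfolding q_def i01
    using det_pencil_nonzero[OF closed_mat_onD(2)[OF A1 z0] dual ker1] r1(3) by (simp add: a1_def)
  have qh: "q holomorphic_on UNIV" unfolding q_def by (intro holomorphic_intros holomorphic_det_pencil)
  obtain \<gamma> \<gamma>' :: "real \<Rightarrow> complex" where \<gamma>: "\<gamma> 0 = 0" "\<gamma> 1 = 1" "\<And>s. s \<in> {0..1} \<Longrightarrow> q (\<gamma> s) \<noteq> 0"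
    "\<And>s. (\<gamma> has_vector_derivative \<gamma>' s) (at s within {0..1})" "continuous_on {0..1} \<gamma>" "continuous_on {0..1} \<gamma>'"
    by (rule complex_path[OF qh q0 q1]) (rule that; assumption)
  define \<delta> where "\<delta> p = (\<chi> i j. A1 p $ i $ j + (-1) * A0 p $ i $ j)" for p
  have \<delta>: "closed_mat_on (ball 0 R) \<delta>" "\<And>p v. p \<in> ball 0 R \<Longrightarrow> dmat \<delta> p v = dmat A1 p v + (\<chi> i j. (-1) * dmat A0 p v $ i $ j)"
    unfolding \<delta>_def by (rule closed_mat_on_lincomb[OF A1 A0]; assumption)+
  define A where "A s p = (\<chi> i j. A0 p $ i $ j + \<gamma> s * \<delta> p $ i $ j)" for s p
  have Ai: "A s p = interp (A0 p) (A1 p) (\<gamma> s)" for s p unfolding A_def \<delta>_def ..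
  have A: "closed_mat_on (ball 0 R) (A s)" "\<And>p v. p \<in> ball 0 R \<Longrightarrow> dmat (A s) p v = dmat A0 p v + (\<chi> i j. \<gamma> s * dmat \<delta> p v $ i $ j)" for s
    unfolding A_def by (rule closed_mat_on_lincomb[OF A0 \<delta>(1)]; assumption)+
  have hA: "hol {0..1} (ball 0 R) (\<lambda>s p. A s p $ i $ j)" for i j
    unfolding A_def vec_lambda_beta
    by (intro hol_add hol_mult hol_param \<gamma>(5) hol_indep closed_mat_onD(1)[OF A0] closed_mat_onD(1)[OF \<delta>(1)])
  have kk: "A0 0 *v x = 0" "A1 0 *v x = 0" if "x \<in> {k1, k2}" for x
    using ker0 ker1 vec.span_base[OF that] by blast+
  have kA: "A s 0 *v k1 = 0" "A s 0 *v k2 = 0" for s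
    unfolding Ai interp_mult using kk by simp_all
  have detA: "det (A s 0 + ?W) \<noteq> 0" if "s \<in> {0..1}" for s
    using \<gamma>(3)[OF that] unfolding q_def Ai by auto
  have r01: "min r0 r1 > 0" using r0 r1 by simp
  have g0: "cdiff g 0" using g(1) \<rho> by simp
  have g': "cdiff g p" if "p \<in> ball 0 (min r0 r1)" for p using g(1) that r0(2) by simp
  obtain r2 where r2: "r2 > 0" "r2 \<le> min r0 r1" "\<And>\<theta> p. \<theta> \<in> {0..1} \<Longrightarrow> p \<in> ball 0 r2 \<Longrightarrow> p - (of_real (1 - \<theta>) * g p) *s \<nu> \<in> ball 0 R"
    by (rule retraction_small[OF g0 g(2) R r01, where \<nu> = \<nu>]) (rule that; assumption)
  have g2: "cdiff g p" if "p \<in> ball 0 r2" for p using g' that r2(2) by simp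
  \<comment> \<open>Every form of the pencil degenerates on the hypersurface, because the two ends
    have kernel vectors annihilated by the derivative of \<open>g\<close>. This makes the Pfaffian
    divisible by \<open>g\<close>.\<close>
  have degA: "\<exists>x. x \<noteq> 0 \<and> A s (p - g p *s \<nu>) *v x = 0" if p: "p \<in> ball 0 r2" for s p
  proof -
    have p': "p \<in> ball 0 r0" "p \<in> ball 0 r1" "p \<in> ball 0 \<rho>" using p r2(2) r0(2) by auto
    have qR: "p - g p *s \<nu> \<in> ball 0 R" using r2(3)[of 0 p] p by simp
    obtain x0 where x0: "x0 \<noteq> 0" "A0 (p - g p *s \<nu>) *v x0 = 0" "fder g p x0 = 0" using r0(4)[OF p'(1)] by blast
    obtain x1 where x1: "x1 \<noteq> 0" "A1 (p - g p *s \<nu>) *v x1 = 0" "fder g p x1 = 0" using r1(4)[OF p'(2)] by blast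
    show ?thesis unfolding Ai interp_eq
      by (rule degenerate_pencil[OF closed_mat_onD(2)[OF A0 qR] closed_mat_onD(2)[OF A1 qR] x0 x1 tang[OF p'(3)]])
  qed
  obtain r3 K where r3: "r3 > 0" "r3 \<le> r2" "r3 \<le> R"
    and det: "\<And>s p. s \<in> {0..1} \<Longrightarrow> p \<in> ball 0 r3 \<Longrightarrow> det (A s p + ?W) \<noteq> 0"
    and K: "hol {0..1} (ball 0 r3) K"
    "\<And>s p. s \<in> {0..1} \<Longrightarrow> p \<in> ball 0 r3 \<Longrightarrow> 1 + cdot \<xi>1 (cramer_sol (A s p + ?W) \<xi>2) = g p * K s p"
    "\<And>s. s \<in> {0..1} \<Longrightarrow> K s 0 = bf (dmat (A s) 0 \<nu>) k1 k2"
    "\<And>s w. s \<in> {0..1} \<Longrightarrow> bf (dmat (A s) 0 w) k1 k2 = fder g 0 w * K s 0"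
    by (rule pfaffian_division[OF compact_Icc R hA closed_mat_onD(2)[OF A(1)] dual kA detA r2(1) g2 g(2) degA], assumption+, rule that; assumption)
  have K0: "K s 0 \<noteq> 0" if s: "s \<in> {0..1}" for s
  proof -
    have "K s 0 = a0 + \<gamma> s * (a1 - a0)"
      unfolding K(3)[OF s] A(2)[OF z0] \<delta>(2)[OF z0] bf_linear(1,9) a0_def a1_def by simp
    then show ?thesis using \<gamma>(3)[OF s] unfolding q_def by auto
  qed
  obtain r where r: "r > 0" "r \<le> r3" "\<And>s p. s \<in> {0..1} \<Longrightarrow> p \<in> ball 0 r \<Longrightarrow> K s p \<noteq> 0"
    by (rule nonzero_near_zero[OF compact_Icc K(1) r3(1) K0], assumption, rule that; assumption)
  have rR: "ball 0 r \<subseteq> ball (0::complex^'m) R" and rr3: "ball 0 r \<subseteq> ball (0::complex^'m) r3"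
    and r\<rho>: "ball 0 r \<subseteq> ball (0::complex^'m) \<rho>" and rr2: "ball 0 r \<subseteq> ball (0::complex^'m) r2"
    using r r3 r2 r0 by (auto intro!: subset_ball)
  have zr: "0 \<in> ball (0::complex^'m) r" using r by simp
  have gr: "cdiff g p" if "p \<in> ball 0 r" for p using g2 rr2 that by blast
  have Fr: "p - (of_real (1 - \<theta>) * g p) *s \<nu> \<in> ball 0 R" if "\<theta> \<in> {0..1}" "p \<in> ball 0 r" for \<theta> p
    using r2(3) rr2 that by blast
  have tan\<delta>: "bf (\<delta> (p - g p *s \<nu>)) (a - fder g p a *s \<nu>) (b - fder g p b *s \<nu>) = 0" if "p \<in> ball 0 r" for p a b
  proof -
    have "\<delta> q = A1 q - A0 q" for q by (simp add: \<delta>_def vec_eq_iff)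
    then show ?thesis using tang[of p a b] that r\<rho> by (simp add: bf_linear(2) subset_iff)
  qed
  define \<beta> where "\<beta> p b = integral {0..1} (\<lambda>\<theta>. bf (\<delta> (p - (of_real (1 - \<theta>) * g p) *s \<nu>)) \<nu> b)" for p b
  have \<beta>: "hol {0..1} (ball 0 r) (\<lambda>(t::real) p. \<beta> p b)"
    "p \<in> ball 0 r \<Longrightarrow> \<beta> p b = (\<Sum>j\<in>UNIV. b $ j * \<beta> p (axis j 1))"
    "p \<in> ball 0 r \<Longrightarrow> fder (\<lambda>q. g q * \<beta> q b) p a - fder (\<lambda>q. g q * \<beta> q a) p b = bf (\<delta> p) a b" for p a b
    unfolding \<beta>_def by (rule relative_poincare[OF \<delta>(1) open_ball open_ball gr Fr tan\<delta>]; assumption)+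
  define \<beta>v where "\<beta>v p = (\<chi> j. \<beta> p (axis j 1))" for p
  have \<beta>v: "cdot b (\<beta>v p) = \<beta> p b" if "p \<in> ball 0 r" for p b
    using \<beta>(2)[OF that, of b] by (simp add: cdot_def \<beta>v_def)
  define y1 where "y1 s p = cramer_sol (A s p + ?W) \<xi>1" for s p
  define y2 where "y2 s p = cramer_sol (A s p + ?W) \<xi>2" for s p
  define z where "z s p = cramer_sol (A s p + ?W) (\<beta>v p)" for s p
  have detr: "det (A s p + ?W) \<noteq> 0" if "s \<in> {0..1}" "p \<in> ball 0 r" for s p using det rr3 that by blast
  have sp: "skew_pencil (A s p) \<xi>1 \<xi>2 k1 k2 (y1 s p) (y2 s p)" if "s \<in> {0..1}" "p \<in> ball 0 r" for s p
    by unfold_locales (use closed_mat_onD(2)[OF A(1), of p s] that rR dual detr in \<open>auto simp: y1_def y2_def subset_iff\<close>)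
  have hAW: "hol {0..1} (ball 0 r) (\<lambda>s p. (A s p + ?W) $ i $ j)" for i j
    unfolding vector_add_component by (intro hol_add hol_const hol_subset[OF hA subset_refl rR])
  have h\<beta>: "hol {0..1::real} (ball 0 r) (\<lambda>s p. \<beta>v p $ i)" for i
    unfolding \<beta>v_def vec_lambda_beta by (rule \<beta>(1))
  have hy: "hol {0..1} (ball 0 r) (\<lambda>s p. y1 s p $ i)" "hol {0..1} (ball 0 r) (\<lambda>s p. y2 s p $ i)"
    "hol {0..1} (ball 0 r) (\<lambda>s p. z s p $ i)" for i
    unfolding y1_def y2_def z_def by (intro hol_cramer_sol hAW hol_const h\<beta> detr; assumption)+
  \<comment> \<open>The vector from \<open>solution\<close> for the right-hand side
    \<open>\<beta>v\<close>, scaled by \<open>\<gamma>'\<close>. The denominator is the quotient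
    \<open>K\<close>, which has no zeros on the ball of radius \<open>r\<close>.\<close>
  define X where "X s p = \<gamma>' s *s (g p *s z s p + (cdot \<xi>2 (z s p) / K s p) *s y1 s p - (cdot \<xi>1 (z s p) / K s p) *s y2 s p)" for s p
  have X: "hol {0..1} (ball 0 r) (\<lambda>s p. X s p $ i)" for i
    unfolding X_def vector_add_component vector_minus_component vector_smult_component cdot_def
    by (intro hol_mult hol_diff hol_add hol_divide hol_sum hol_const hy hol_param \<gamma>(6) hol_indep gr r(3)
        hol_subset[OF K(1) subset_refl rr3])
  \<comment> \<open>At the origin y1 = k2 and y2 = - k1, so by skewness xi_1(z) and xi_2(z) are, up
    to sign, the values of beta on \<open>k2\<close> and \<open>k1\<close>. These vanish since both
    matrices kill the common kernel, and the first term vanishes with \<open>g\<close>.\<close>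
  have X0: "X s 0 = 0" if s: "s \<in> {0..1}" for s
  proof -
    interpret skew_pencil "A s 0" \<xi>1 \<xi>2 k1 k2 "y1 s 0" "y2 s 0" by (rule sp[OF s zr])
    have Z: "At *v z s 0 = \<beta>v 0" unfolding z_def by (rule cramer_sol(1)[OF det])
    have "\<beta> 0 x = 0" if x: "x \<in> {k1, k2}" for x
    proof -
      have "\<delta> 0 = A1 0 - A0 0" by (simp add: \<delta>_def vec_eq_iff)
      then have "bf (\<delta> 0) \<nu> x = 0"
        using kk[OF x] by (simp only: bf_linear(2)) (simp add: bf_eq_cdot cdot_linear(9))
      then show ?thesis by (simp add: \<beta>_def g(2))
    qed
    then have "cdot k1 (\<beta>v 0) = 0" "cdot k2 (\<beta>v 0) = 0" using \<beta>v[OF zr] by simp_all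
    moreover have "cdot \<xi>1 (z s 0) = - cdot k2 (\<beta>v 0)"
      using skew_cdot(2)[of "z s 0" "y1 s 0"] At_y Z y_at_kernel(1)[OF kA] by (simp add: cdot_linear(1)[of \<xi>1])
    moreover have "cdot \<xi>2 (z s 0) = - cdot (- k1) (\<beta>v 0)"
      using skew_cdot(2)[of "z s 0" "y2 s 0"] At_y Z y_at_kernel(2)[OF kA] by (simp add: cdot_linear(1)[of \<xi>2])
    ultimately show ?thesis by (simp add: X_def g(2) cdot_linear(1)[of "- k1"] cdot_linear(10) cdot_linear(1)[of k1])
  qed
  have AX: "bf (\<chi> i j. A0 q $ i $ j + \<gamma> s * \<delta> q $ i $ j) (X s q) b = - \<gamma>' s * (g q * \<beta> q b)"
    if s: "s \<in> {0..1}" and q: "q \<in> ball 0 r" for s q b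
  proof -
    interpret skew_pencil "A s q" \<xi>1 \<xi>2 k1 k2 "y1 s q" "y2 s q" by (rule sp[OF s q])
    have Z: "At *v z s q = \<beta>v q" unfolding z_def by (rule cramer_sol(1)[OF det])
    have pfq: "pf = g q * K s q" unfolding y2_def by (rule K(2)[OF s]) (use q rr3 in blast)
    have "A s q *v X s q = \<gamma>' s *s (g q *s \<beta>v q)"
      unfolding X_def vector_scalar_commute solution[OF Z pfq r(3)[OF s q]] ..
    \<comment> \<open>Skewness moves \<open>A\<close> to the other argument and thereby produces the
      minus sign of Moser's equation.\<close>
    then have "cdot (X s q) (A s q *v b) = - cdot b (\<gamma>' s *s (g q *s \<beta>v q))" using skew_cdot(1)[of "X s q" b] by simp
    then show ?thesis unfolding A_def[symmetric] bf_eq_cdot by (simp add: cdot_linear(7) \<beta>v[OF q])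
  qed
  have \<eta>: "cdiff (\<lambda>q. g q * \<beta> q b) p" if "p \<in> ball 0 r" for b p
    by (rule cdiff_fder_mult(1)[OF gr[OF that] hol_cdiff[OF \<beta>(1) _ that, of 0]]) simp
  obtain r' and \<Psi> :: "complex^'m \<Rightarrow> complex^'m" where \<Psi>: "r' > 0" "\<And>i p. p \<in> ball 0 r' \<Longrightarrow> cdiff (\<lambda>p. \<Psi> p $ i) p"
    "\<Psi> 0 = 0" "\<And>p. p \<in> ball 0 r' \<Longrightarrow> \<Psi> p \<in> ball 0 r" "\<And>v. vder \<Psi> 0 v = 0 \<Longrightarrow> v = 0"
    "\<And>p u v. p \<in> ball 0 r' \<Longrightarrow>
       bf (\<chi> i j. A0 (\<Psi> p) $ i $ j + \<gamma> 1 * \<delta> (\<Psi> p) $ i $ j) (vder \<Psi> p u) (vder \<Psi> p v) = bf (A0 p) u v"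
    by (rule moser[OF r(1) closed_mat_on_subset[OF A0 rR] closed_mat_on_subset[OF \<delta>(1) rR] \<gamma>(4) \<gamma>(1) X X0 \<eta> AX \<beta>(3)],
        assumption+, rule that; assumption)
  have "(\<chi> i j. A0 p $ i $ j + \<gamma> 1 * \<delta> p $ i $ j) = A1 p" for p by (simp add: \<gamma>(2) \<delta>_def vec_eq_iff)
  then show thesis using that[of r' \<Psi>] \<Psi> rR by (simp add: subset_iff)
qed

section \<open>From germs of forms to matrices\<close>

definition fmat :: "'m::finite form \<Rightarrow> complex^'m^'m" where
  "fmat \<alpha> = (\<chi> i j. bil \<alpha> (axis i 1) (axis j 1))"

lemma bil_eq_bf:
  assumes "alternating_form 2 \<alpha>" shows "bil \<alpha> x y = bf (fmat \<alpha>) x y"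
proof -
  have "bil \<alpha> x y = (\<Sum>i\<in>UNIV. x $ i * bil \<alpha> (axis i 1) y)"
    by (rule clinear_expand[OF bil_linear(1)[OF assms]])
  also have "\<dots> = (\<Sum>i\<in>UNIV. x $ i * (\<Sum>j\<in>UNIV. y $ j * bil \<alpha> (axis i 1) (axis j 1)))"
    by (rule sum.cong[OF refl], subst clinear_expand[OF bil_linear(2)[OF assms], of _ y]) (rule refl)
  finally show ?thesis by (simp add: bf_def fmat_def sum_distrib_left mult_ac)
qed

lemma skew_fmat: assumes "alternating_form 2 \<alpha>" shows "skew (fmat \<alpha>)"
  unfolding skew_def fmat_def vec_lambda_beta using alt_bil_swap[OF alt_bil_bil[OF assms]] by blast

lemma fmat_kernel:
  assumes "alternating_form 2 \<alpha>" shows "fmat \<alpha> *v x = 0 \<longleftrightarrow> x \<in> bil_ker (bil \<alpha>)"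
proof
  have s: "bil \<alpha> x y = - cdot y (fmat \<alpha> *v x)" for y
    using bf_skew[OF skew_fmat[OF assms], of x y] unfolding bil_eq_bf[OF assms] by (simp only: bf_eq_cdot)
  show "x \<in> bil_ker (bil \<alpha>)" if "fmat \<alpha> *v x = 0"
    unfolding bil_ker_def using s that by (simp add: cdot_linear(9))
  show "fmat \<alpha> *v x = 0" if "x \<in> bil_ker (bil \<alpha>)"
  proof (rule vec_eq_cdotI)
    fix b show "cdot b (fmat \<alpha> *v x) = cdot b 0" using s[of b] that by (simp add: bil_ker_def cdot_linear(9))
  qed
qed

text \<open>With trivial kernel a maximal symplectic family spans the space, so it consists of n
  pairs, and the n-th power is nonzero on it.\<close>

lemma wedge_power_zero_degenerate:
  fixes \<alpha> :: "'m::finite form"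
  assumes \<alpha>: "alternating_form 2 \<alpha>" and card: "CARD('m) = 2 * n" and z: "wedge_power \<alpha> n = (\<lambda>v. 0)"
  shows "\<exists>x. x \<noteq> 0 \<and> fmat \<alpha> *v x = 0"
proof (rule ccontr)
  assume "\<not> ?thesis"
  then have ker: "x = 0" if "x \<in> bil_ker (bil \<alpha>)" for x using that fmat_kernel[OF \<alpha>] by blast
  note B = alt_bil_bil[OF \<alpha>]
  have "sympl_family (bil \<alpha>) (\<lambda>_. 0) 0" by (simp add: sympl_family_def)
  from sympl_family_maximal[OF B this] obtain r b where b: "sympl_family (bil \<alpha>) b r"
    "\<And>x. (\<And>j. j < 2 * r \<Longrightarrow> bil \<alpha> x (b j) = 0) \<Longrightarrow> x \<in> bil_ker (bil \<alpha>)" by metis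
  have "vec.span (b ` {..<2 * r} \<union> {}) = UNIV"
    by (rule sympl_family_span[OF B b]) (use ker in \<open>auto simp: vec.span_zero\<close>)
  then have "CARD('m) \<le> card (b ` {..<2 * r})"
    using vec.dim_le_card[of UNIV "b ` {..<2 * r}"] by (simp add: card_cart_basis)
  also have "\<dots> \<le> 2 * r" using card_image_le[of "{..<2 * r}" b] by simp
  finally have "n \<le> r" using card by simp
  moreover have "2 * r + card ({} :: (complex^'m) set) \<le> CARD('m)"
    by (rule sympl_family_card(3)[OF B b(1)]) (auto simp: vec.independent_empty)
  ultimately have "r = n" using card by simp
  then have "wedge_power \<alpha> n b \<noteq> 0"
    using b(1) by (intro wedge_power_sympl_nonzero[OF \<alpha>]) (auto simp: sympl_family_def)
  with z show False by simp
qed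

lemma closed_form_matrix:
  fixes \<omega> :: "'m::finite diff_form"
  assumes U: "open U" and \<omega>: "analytic_diff_form_on 2 \<omega> U" and d: "\<And>p. p \<in> U \<Longrightarrow> ext_deriv 2 \<omega> p = (\<lambda>v. 0)"
  shows "closed_mat_on U (\<lambda>p. fmat (\<omega> p))"
  unfolding closed_mat_on_def
proof (intro ballI conjI allI)
  have alt: "alternating_form 2 (\<omega> p)" if "p \<in> U" for p using \<omega> that by (simp add: analytic_diff_form_on_def)
  have cd: "cdiff (\<lambda>p. \<omega> p v) p" if "p \<in> U" for p v
    using \<omega> that analytic_fun_on_open[OF U] by (simp add: analytic_diff_form_on_def)
  fix p assume p: "p \<in> U"
  show c: "cdiff (\<lambda>q. fmat (\<omega> q) $ i $ j) p" for i j
    unfolding fmat_def vec_lambda_beta bil_def by (rule cd[OF p])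
  show "skew (fmat (\<omega> p))" by (rule skew_fmat[OF alt[OF p]])
  fix a b c' :: "complex^'m"
  have f: "fder (\<lambda>q. \<omega> q v) p w = bf (dmat (\<lambda>q. fmat (\<omega> q)) p w) (v 0) (v 1)" for v w
  proof -
    have "fder (\<lambda>q. \<omega> q v) p = fder (\<lambda>q. bf (fmat (\<omega> q)) (v 0) (v 1)) p"
      by (rule cdiff_cong_open(2)[OF cdiff_bf_const(1)[OF c] U p])
         (simp only: two_form_eq_bil[OF alt] bil_eq_bf[OF alt])
    then show ?thesis by (simp only: cdiff_bf_const(2)[OF c])
  qed
  define v where "v = (\<lambda>i::nat. if i = 0 then a else if i = 1 then b else c')"
  have v: "v 0 = a" "v (Suc 0) = b" "v (Suc (Suc 0)) = c'" by (simp_all add: v_def)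
  have "ext_deriv 2 \<omega> p v = 0" using d[OF p] by simp
  then show "bf (dmat (\<lambda>q. fmat (\<omega> q)) p a) b c' - bf (dmat (\<lambda>q. fmat (\<omega> q)) p b) a c' + bf (dmat (\<lambda>q. fmat (\<omega> q)) p c') a b = 0"
    unfolding ext_deriv_def f by (simp add: numeral_2_eq_2 v)
qed

text \<open>The map p - g p * nu carries the complex line p + t a to an analytic curve in
  \<open>S\<close> whose velocity is the required vector. Only tangent vectors of this kind are used
  to compare the restrictions of the two forms.\<close>

lemma tangent_retraction:
  fixes g :: "complex^'m \<Rightarrow> complex"
  assumes V: "open V" "p \<in> V" and g: "\<And>p. p \<in> V \<Longrightarrow> cdiff g p" and S: "\<And>p. p \<in> V \<Longrightarrow> p - g p *s \<nu> \<in> S"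
  shows "a - fder g p a *s \<nu> \<in> tangent_space S (p - g p *s \<nu>)"
proof -
  define F where "F = (\<lambda>\<theta> p. p - (of_real (1 - \<theta>) * g p) *s \<nu>)"
  have F0: "F 0 p = p - g p *s \<nu>" for p by (simp add: F_def)
  have cF: "cdiff (\<lambda>p. F 0 p $ i) p" if "p \<in> V" for i p
    using hol_cdiff[OF retraction(1)[OF g V(1), where T = "UNIV :: real set" and \<nu> = \<nu> and i = i] UNIV_I that, of 0] unfolding F_def by simp
  have vF: "vder (F 0) p a = a - fder g p a *s \<nu>"
    using retraction(2)[OF g V(1,2), of 0 \<nu> a] unfolding F_def by simp
  define \<gamma> where "\<gamma> t = F 0 (p + t *s a)" for t
  have "((\<lambda>t. p + t *s a) \<longlongrightarrow> p + 0 *s a) (nhds 0)"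
  proof -
    have "isCont (\<lambda>t. p + t *s a) 0"
      by (intro continuous_add continuous_const linear_continuous_at bounded_linear_cscale_left)
    then show ?thesis
      unfolding isCont_def tendsto_at_iff_tendsto_nhds[of "\<lambda>t. p + t *s a"] .
  qed
  then have ev: "\<forall>\<^sub>F t in nhds 0. p + t *s a \<in> V"
    by (rule topological_tendstoD[OF _ V(1)]) (simp add: V(2))
  then obtain e where e: "e > 0" "\<And>t. dist t 0 < e \<Longrightarrow> p + t *s a \<in> V"
    unfolding eventually_nhds_metric by blast
  have d: "((\<lambda>t. \<gamma> t $ i) has_field_derivative fder (\<lambda>p. F 0 p $ i) (p + t *s a) a) (at t)" if "dist t 0 < e" for t i
    unfolding \<gamma>_def by (rule slice_derivative[OF cF[OF e(2)[OF that]]])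
  have h: "(\<lambda>t. \<gamma> t $ i) holomorphic_on ball 0 e" for i
    by (rule holomorphic_onI, rule field_differentiable_at_within, unfold field_differentiable_def)
       (rule exI, rule d, simp add: dist_commute)
  show ?thesis
    unfolding tangent_space_def
  proof (intro CollectI exI[of _ \<gamma>] conjI allI)
    show "(\<lambda>t. \<gamma> t $ i) analytic_on {0}" for i
      using h e(1) unfolding analytic_on_def by blast
    show "\<gamma> 0 = p - g p *s \<nu>" by (simp add: \<gamma>_def F0)
    show "\<forall>\<^sub>F t in nhds 0. \<gamma> t \<in> S"
      using ev by eventually_elim (simp add: \<gamma>_def F0 S)
    have "deriv (\<lambda>t. \<gamma> t $ i) 0 = fder (\<lambda>p. F 0 p $ i) p a" for i
      using DERIV_imp_deriv[OF d[of 0 i]] e(1) by simp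
    then show "a - fder g p a *s \<nu> = (\<chi> i. deriv (\<lambda>t. \<gamma> t $ i) 0)"
      using vF by simp
  qed
qed

lemma diffeo_germI:
  fixes \<Psi> :: "complex^'m \<Rightarrow> complex^'m"
  assumes r: "r > 0" and \<Psi>: "\<And>i p. p \<in> ball 0 r \<Longrightarrow> cdiff (\<lambda>p. \<Psi> p $ i) p" "\<Psi> 0 = 0"
    "\<And>v. vder \<Psi> 0 v = 0 \<Longrightarrow> v = 0"
  shows "diffeo_germ \<Psi>"
proof -
  have 0: "0 \<in> ball (0::complex^'m) r" using r by simp
  obtain U' V and H :: "complex^'m \<Rightarrow> complex^'m" where H: "open U'" "U' \<subseteq> ball 0 r" "0 \<in> U'" "open V" "\<Psi> ` U' = V"
    "\<And>p. p \<in> U' \<Longrightarrow> H (\<Psi> p) = p" "\<And>q. q \<in> V \<Longrightarrow> H q \<in> U'" "\<And>q. q \<in> V \<Longrightarrow> \<Psi> (H q) = q"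
    "\<And>i q. q \<in> V \<Longrightarrow> cdiff (\<lambda>q. H q $ i) q"
    by (rule local_inverse[OF open_ball 0 \<Psi>(1,3)], assumption, assumption, rule that; assumption)
  have "\<Psi> analytic_map_on U'"
    unfolding analytic_map_on_def analytic_fun_on_open[OF H(1)] using \<Psi>(1) H(2) by blast
  moreover have "H analytic_map_on V"
    unfolding analytic_map_on_def analytic_fun_on_open[OF H(4)] using H(9) by blast
  ultimately show ?thesis
    unfolding diffeo_germ_def using \<Psi>(2) H(1,3,4,5,6) by blast
qed

lemma smooth_germ:
  fixes \<omega> :: "'m::finite diff_form"
  assumes card: "CARD('m) = 2 * n" and sing: "singular_symplectic_germ n \<omega>" and smooth: "structurally_smooth n \<omega>"
  obtains U f \<Omega> where "open U" "0 \<in> U" "analytic_diff_form_on 2 \<omega> U" "\<And>p. p \<in> U \<Longrightarrow> ext_deriv 2 \<omega> p = (\<lambda>v. 0)"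
    "\<And>p. p \<in> U \<Longrightarrow> cdiff f p" "f 0 = 0" "fder f 0 \<noteq> (\<lambda>v. 0)"
    "\<And>p. p \<in> U \<Longrightarrow> f p = 0 \<Longrightarrow> wedge_power (\<omega> p) n = (\<lambda>v. 0)" "smooth_martinet n \<omega> \<Omega> f U"
proof -
  obtain U1 where U1: "open U1" "0 \<in> U1" "analytic_diff_form_on 2 \<omega> U1" "\<And>p. p \<in> U1 \<Longrightarrow> ext_deriv 2 \<omega> p = (\<lambda>v. 0)"
    using sing unfolding singular_symplectic_germ_def by blast
  obtain U2 \<Omega> f where U2: "open U2" "0 \<in> U2" "analytic_diff_form_on (2 * n) \<Omega> U2" "\<And>p. p \<in> U2 \<Longrightarrow> \<Omega> p \<noteq> (\<lambda>v. 0)"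
    "f analytic_fun_on U2" "\<And>p. p \<in> U2 \<Longrightarrow> wedge_power (\<omega> p) n = (\<lambda>v. f p * \<Omega> p v)" "f 0 = 0" "fder f 0 \<noteq> (\<lambda>v. 0)"
    using smooth unfolding structurally_smooth_def by blast
  have 1: "alternating_form 2 (\<omega> p)" "cdiff (\<lambda>p. \<omega> p v) p" if "p \<in> U1" for p v
    using U1(3) that analytic_fun_on_open[OF U1(1)] by (simp_all add: analytic_diff_form_on_def)
  have 2: "alternating_form (2 * n) (\<Omega> p)" "cdiff (\<lambda>p. \<Omega> p v) p" "cdiff f p" if "p \<in> U2" for p v
    using U2(3,5) that analytic_fun_on_open[OF U2(1)] by (simp_all add: analytic_diff_form_on_def)
  show thesis
  proof (rule that[of "U1 \<inter> U2" f \<Omega>])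
    show "smooth_martinet n \<omega> \<Omega> f (U1 \<inter> U2)"
    proof unfold_locales
      show "wedge_power (\<omega> p) n v = f p * \<Omega> p v" if "p \<in> U1 \<inter> U2" for p v
        using U2(6)[of p] that by simp
    qed (use card U1(1,2) U2(1,2,4,7,8) 1 2 in auto)
    show "analytic_diff_form_on 2 \<omega> (U1 \<inter> U2)"
      unfolding analytic_diff_form_on_def analytic_fun_on_open[OF open_Int[OF U1(1) U2(1)]] using 1 by blast
  qed (use U1 U2 2 in auto)
qed

text \<open>Sets and forms represent germs, so the common hypersurface and the equality of the
  restrictions are asked near 0 by \<open>eventually\<close>. The rank bound is stated additively
  because 2 * n - 4 would be truncated on the naturals.\<close>

theorem theorem2p2:
  fixes n :: nat
    and \<omega>\<^sub>0 \<omega>\<^sub>1 :: "'m::finite diff_form"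
    and \<Sigma>\<^sub>2 :: "(complex^'m) set"
  assumes "CARD('m) = 2 * n"
    and "singular_symplectic_germ n \<omega>\<^sub>0"
    and "singular_symplectic_germ n \<omega>\<^sub>1"
    and "\<forall>\<^sub>F p in nhds 0. p \<in> \<Sigma>\<^sub>2 \<longleftrightarrow> p \<in> martinet n \<omega>\<^sub>0"
    and "\<forall>\<^sub>F p in nhds 0. p \<in> \<Sigma>\<^sub>2 \<longleftrightarrow> p \<in> martinet n \<omega>\<^sub>1"
    and "structurally_smooth n \<omega>\<^sub>0"
    and "structurally_smooth n \<omega>\<^sub>1"
    and "form_rank (tangent_space \<Sigma>\<^sub>2 0) (incl_pullback 2 \<Sigma>\<^sub>2 \<omega>\<^sub>0 0) =
         form_rank (tangent_space \<Sigma>\<^sub>2 0) (incl_pullback 2 \<Sigma>\<^sub>2 \<omega>\<^sub>1 0)"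
    and "form_rank (tangent_space \<Sigma>\<^sub>2 0) (incl_pullback 2 \<Sigma>\<^sub>2 \<omega>\<^sub>1 0) + 4 \<le> 2 * n"
    and "\<forall>\<^sub>F p in nhds 0. p \<in> \<Sigma>\<^sub>2 \<longrightarrow> incl_pullback 2 \<Sigma>\<^sub>2 \<omega>\<^sub>0 p = incl_pullback 2 \<Sigma>\<^sub>2 \<omega>\<^sub>1 p"
    and "form_ker (wedge_power (\<omega>\<^sub>0 0) (n - 1)) = form_ker (wedge_power (\<omega>\<^sub>1 0) (n - 1))"
  shows "\<exists>\<Psi> :: complex^'m \<Rightarrow> complex^'m. diffeo_germ \<Psi> \<and>
           (\<forall>\<^sub>F p in nhds 0. pullback \<Psi> \<omega>\<^sub>1 p = \<omega>\<^sub>0 p)"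
proof -
  \<comment> \<open>The rank bound gives n >= 2, the range in which \<open>kernel\<close> identifies
    the kernel of the (n - 1)-st power with that of the form.\<close>
  have n: "n \<ge> 2" using assms(9) by simp
  obtain U f \<Omega> where U: "open U" "0 \<in> U" "analytic_diff_form_on 2 \<omega>\<^sub>0 U" "\<And>p. p \<in> U \<Longrightarrow> ext_deriv 2 \<omega>\<^sub>0 p = (\<lambda>v. 0)"
    "\<And>p. p \<in> U \<Longrightarrow> cdiff f p" "f 0 = 0" "fder f 0 \<noteq> (\<lambda>v. 0)"
    "\<And>p. p \<in> U \<Longrightarrow> f p = 0 \<Longrightarrow> wedge_power (\<omega>\<^sub>0 p) n = (\<lambda>v. 0)" "smooth_martinet n \<omega>\<^sub>0 \<Omega> f U"
    by (rule smooth_germ[OF assms(1,2,6)]) (rule that; assumption)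
  obtain U' f' \<Omega>' where U': "open U'" "0 \<in> U'" "analytic_diff_form_on 2 \<omega>\<^sub>1 U'" "\<And>p. p \<in> U' \<Longrightarrow> ext_deriv 2 \<omega>\<^sub>1 p = (\<lambda>v. 0)"
    "\<And>p. p \<in> U' \<Longrightarrow> cdiff f' p" "f' 0 = 0" "fder f' 0 \<noteq> (\<lambda>v. 0)"
    "\<And>p. p \<in> U' \<Longrightarrow> f' p = 0 \<Longrightarrow> wedge_power (\<omega>\<^sub>1 p) n = (\<lambda>v. 0)" "smooth_martinet n \<omega>\<^sub>1 \<Omega>' f' U'"
    by (rule smooth_germ[OF assms(1,3,7)]) (rule that; assumption)
  have "\<forall>\<^sub>F p in nhds 0. p \<in> U" "\<forall>\<^sub>F p in nhds 0. p \<in> U'"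
    using U(1,2) U'(1,2) by (auto intro: eventually_nhds_in_open)
  with assms(4,5,10) have "\<forall>\<^sub>F p in nhds 0. p \<in> U \<and> p \<in> U' \<and> (p \<in> \<Sigma>\<^sub>2 \<longleftrightarrow> p \<in> martinet n \<omega>\<^sub>0) \<and>
     (p \<in> \<Sigma>\<^sub>2 \<longleftrightarrow> p \<in> martinet n \<omega>\<^sub>1) \<and> (p \<in> \<Sigma>\<^sub>2 \<longrightarrow> incl_pullback 2 \<Sigma>\<^sub>2 \<omega>\<^sub>0 p = incl_pullback 2 \<Sigma>\<^sub>2 \<omega>\<^sub>1 p)"
    by eventually_elim blast
  then obtain R where R: "R > 0" and "\<forall>p. dist p 0 < R \<longrightarrow> p \<in> U \<and> p \<in> U' \<and> (p \<in> \<Sigma>\<^sub>2 \<longleftrightarrow> p \<in> martinet n \<omega>\<^sub>0) \<and>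
     (p \<in> \<Sigma>\<^sub>2 \<longleftrightarrow> p \<in> martinet n \<omega>\<^sub>1) \<and> (p \<in> \<Sigma>\<^sub>2 \<longrightarrow> incl_pullback 2 \<Sigma>\<^sub>2 \<omega>\<^sub>0 p = incl_pullback 2 \<Sigma>\<^sub>2 \<omega>\<^sub>1 p)"
    unfolding eventually_nhds_metric by blast
  then have RU: "ball 0 R \<subseteq> U" "ball 0 R \<subseteq> U'"
    and mart: "\<And>p. p \<in> ball 0 R \<Longrightarrow> p \<in> \<Sigma>\<^sub>2 \<longleftrightarrow> p \<in> martinet n \<omega>\<^sub>0" "\<And>p. p \<in> ball 0 R \<Longrightarrow> p \<in> \<Sigma>\<^sub>2 \<longleftrightarrow> p \<in> martinet n \<omega>\<^sub>1"
    and incl: "\<And>p. p \<in> ball 0 R \<Longrightarrow> p \<in> \<Sigma>\<^sub>2 \<Longrightarrow> incl_pullback 2 \<Sigma>\<^sub>2 \<omega>\<^sub>0 p = incl_pullback 2 \<Sigma>\<^sub>2 \<omega>\<^sub>1 p"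
    by auto
  have z: "0 \<in> ball (0::complex^'m) R" using R by simp
  have alt: "alternating_form 2 (\<omega>\<^sub>0 p)" "alternating_form 2 (\<omega>\<^sub>1 p)" if "p \<in> ball 0 R" for p
    using U(3) U'(3) RU that by (auto simp: analytic_diff_form_on_def)
  interpret w0: smooth_martinet n \<omega>\<^sub>0 \<Omega> f U by (rule U(9))
  interpret w1: smooth_martinet n \<omega>\<^sub>1 \<Omega>' f' U' by (rule U'(9))
  obtain k1 k2 where k: "k1 \<noteq> k2" "vec.independent {k1, k2}" "w0.K = vec.span {k1, k2}"
    and nz0: "\<And>k1 k2. k1 \<noteq> k2 \<Longrightarrow> vec.independent {k1, k2} \<Longrightarrow> w0.K = vec.span {k1, k2} \<Longrightarrow>
       \<exists>w. fder (\<lambda>p. bil (\<omega>\<^sub>0 p) k1 k2) 0 w \<noteq> 0"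
    and fk0: "n \<ge> 2 \<Longrightarrow> form_ker (wedge_power (\<omega>\<^sub>0 0) (n - 1)) = w0.K"
    by (rule w0.kernel) (rule that; assumption)
  have nz1: "\<And>k1 k2. k1 \<noteq> k2 \<Longrightarrow> vec.independent {k1, k2} \<Longrightarrow> w1.K = vec.span {k1, k2} \<Longrightarrow>
       \<exists>w. fder (\<lambda>p. bil (\<omega>\<^sub>1 p) k1 k2) 0 w \<noteq> 0"
    and fk1: "n \<ge> 2 \<Longrightarrow> form_ker (wedge_power (\<omega>\<^sub>1 0) (n - 1)) = w1.K"
    by (rule w1.kernel; assumption)+
  \<comment> \<open>The hypothesis on the (n - 1)-st powers becomes equality of the kernels of the
    two forms, so one basis serves both.\<close>
  have K1: "w1.K = vec.span {k1, k2}" using fk0 fk1 n assms(11) k(3) by simp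
  let ?A0 = "\<lambda>p. fmat (\<omega>\<^sub>0 p)" and ?A1 = "\<lambda>p. fmat (\<omega>\<^sub>1 p)"
  have A0: "closed_mat_on (ball 0 R) ?A0"
    by (rule closed_mat_on_subset[OF closed_form_matrix[OF U(1,3,4)] RU(1)])
  have A1: "closed_mat_on (ball 0 R) ?A1"
    by (rule closed_mat_on_subset[OF closed_form_matrix[OF U'(1,3,4)] RU(2)])
  have ker0: "?A0 0 *v x = 0 \<longleftrightarrow> x \<in> vec.span {k1, k2}" for x using fmat_kernel[OF alt(1)[OF z]] k(3) by simp
  have ker1: "?A1 0 *v x = 0 \<longleftrightarrow> x \<in> vec.span {k1, k2}" for x using fmat_kernel[OF alt(2)[OF z]] K1 by simp
  have fb0: "fder (\<lambda>p. bil (\<omega>\<^sub>0 p) k1 k2) 0 w = bf (dmat ?A0 0 w) k1 k2" for w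
    using cdiff_cong_open(2)[OF cdiff_bf_const(1)[OF closed_mat_onD(1)[OF A0 z]] open_ball z bil_eq_bf[OF alt(1), symmetric]]
      cdiff_bf_const(2)[OF closed_mat_onD(1)[OF A0 z]] by metis
  have fb1: "fder (\<lambda>p. bil (\<omega>\<^sub>1 p) k1 k2) 0 w = bf (dmat ?A1 0 w) k1 k2" for w
    using cdiff_cong_open(2)[OF cdiff_bf_const(1)[OF closed_mat_onD(1)[OF A1 z]] open_ball z bil_eq_bf[OF alt(2), symmetric]]
      cdiff_bf_const(2)[OF closed_mat_onD(1)[OF A1 z]] by metis
  obtain v0 where v0: "bf (dmat ?A0 0 v0) k1 k2 \<noteq> 0" using nz0[OF k] unfolding fb0 by blast
  obtain v1 where v1: "bf (dmat ?A1 0 v1) k1 k2 \<noteq> 0" using nz1[OF k(1,2) K1] unfolding fb1 by blast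
  have fR: "cdiff f p" if "p \<in> ball 0 R" for p using U(5) RU(1) that by blast
  \<comment> \<open>\<open>g\<close> is built from the equation \<open>f\<close> of omega_0; omega_1
    degenerates at the same points because the Martinet hypersurfaces coincide near 0.\<close>
  obtain \<rho>1 \<nu> and g :: "complex^'m \<Rightarrow> complex" where g: "\<rho>1 > 0" "ball (0::complex^'m) \<rho>1 \<subseteq> ball 0 R" "\<And>p. p \<in> ball 0 \<rho>1 \<Longrightarrow> cdiff g p" "g 0 = 0"
    "\<And>p. p \<in> ball 0 \<rho>1 \<Longrightarrow> f (p - g p *s \<nu>) = 0"
    by (rule defining_function[OF open_ball z _ U(6,7)], erule fR) (rule that)
  have g0: "cdiff g 0" using g(1,3) by simp
  obtain \<rho> where \<rho>: "\<rho> > 0" "\<rho> \<le> \<rho>1" "\<And>\<theta> p. \<theta> \<in> {0..1} \<Longrightarrow> p \<in> ball 0 \<rho> \<Longrightarrow> p - (of_real (1 - \<theta>) * g p) *s \<nu> \<in> ball 0 R"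
    by (rule retraction_small[OF g0 g(4) R g(1), where \<nu> = \<nu>]) (rule that; assumption)
  have g\<rho>: "cdiff g p" if "p \<in> ball 0 \<rho>" for p using g(3) that \<rho>(2) by simp
  have qR: "p - g p *s \<nu> \<in> ball 0 R" if "p \<in> ball 0 \<rho>" for p using \<rho>(3)[of 0 p] that by simp
  have wp0: "wedge_power (\<omega>\<^sub>0 (p - g p *s \<nu>)) n = (\<lambda>v. 0)" if p: "p \<in> ball 0 \<rho>" for p
    by (rule U(8)) (use qR[OF p] RU(1) g(5)[of p] p \<rho>(2) in auto)
  then have q\<Sigma>: "p - g p *s \<nu> \<in> \<Sigma>\<^sub>2" if "p \<in> ball 0 \<rho>" for p
    using mart(1)[OF qR[OF that]] that by (simp add: martinet_def)
  then have wp1: "wedge_power (\<omega>\<^sub>1 (p - g p *s \<nu>)) n = (\<lambda>v. 0)" if "p \<in> ball 0 \<rho>" for p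
    using mart(2)[OF qR[OF that]] that by (simp add: martinet_def)
  have deg0: "\<exists>x. x \<noteq> 0 \<and> ?A0 (p - g p *s \<nu>) *v x = 0" if "p \<in> ball 0 \<rho>" for p
    by (rule wedge_power_zero_degenerate[OF alt(1)[OF qR[OF that]] assms(1) wp0[OF that]])
  have deg1: "\<exists>x. x \<noteq> 0 \<and> ?A1 (p - g p *s \<nu>) *v x = 0" if "p \<in> ball 0 \<rho>" for p
    by (rule wedge_power_zero_degenerate[OF alt(2)[OF qR[OF that]] assms(1) wp1[OF that]])
  have tang: "bf (?A0 (p - g p *s \<nu>)) (a - fder g p a *s \<nu>) (b - fder g p b *s \<nu>) =
     bf (?A1 (p - g p *s \<nu>)) (a - fder g p a *s \<nu>) (b - fder g p b *s \<nu>)" if p: "p \<in> ball 0 \<rho>" for p a b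
  proof -
    let ?q = "p - g p *s \<nu>" and ?a = "a - fder g p a *s \<nu>" and ?b = "b - fder g p b *s \<nu>"
    have t: "?a \<in> tangent_space \<Sigma>\<^sub>2 ?q" "?b \<in> tangent_space \<Sigma>\<^sub>2 ?q"
      by (rule tangent_retraction[OF open_ball p g\<rho> q\<Sigma>]; assumption)+
    then have m: "\<forall>i<2. (case_nat ?a (\<lambda>_. ?b) i) \<in> tangent_space \<Sigma>\<^sub>2 ?q" by (auto split: nat.split)
    have "incl_pullback 2 \<Sigma>\<^sub>2 \<omega>\<^sub>0 ?q (case_nat ?a (\<lambda>_. ?b)) = incl_pullback 2 \<Sigma>\<^sub>2 \<omega>\<^sub>1 ?q (case_nat ?a (\<lambda>_. ?b))"
      using incl[OF qR[OF p] q\<Sigma>[OF p]] by simp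
    then have "bil (\<omega>\<^sub>0 ?q) ?a ?b = bil (\<omega>\<^sub>1 ?q) ?a ?b"
      unfolding incl_pullback_def restrict_form_def bil_def if_P[OF m] .
    then show ?thesis unfolding bil_eq_bf[OF alt(1)[OF qR[OF p]]] bil_eq_bf[OF alt(2)[OF qR[OF p]]] .
  qed
  obtain r and \<Psi> :: "complex^'m \<Rightarrow> complex^'m" where r: "r > 0" and \<Psi>: "\<And>i p. p \<in> ball 0 r \<Longrightarrow> cdiff (\<lambda>p. \<Psi> p $ i) p"
    "\<Psi> 0 = 0" "\<And>p. p \<in> ball 0 r \<Longrightarrow> \<Psi> p \<in> ball 0 R" "\<And>v. vder \<Psi> 0 v = 0 \<Longrightarrow> v = 0"
    "\<And>p u v. p \<in> ball 0 r \<Longrightarrow> bf (?A1 (\<Psi> p)) (vder \<Psi> p u) (vder \<Psi> p v) = bf (?A0 p) u v"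
    by (rule matrix_equivalence[OF R A0 A1 k(1,2) ker0 ker1 v0 v1 \<rho>(1) g\<rho> g(4) deg0 deg1 tang], assumption+, rule that; assumption)
  \<comment> \<open>The bound \<open>R\<close> is present because omega_0 is known to be alternating
    on that ball, hence determined there by its matrix.\<close>
  have "pullback \<Psi> \<omega>\<^sub>1 p = \<omega>\<^sub>0 p" if p: "p \<in> ball 0 (min r R)" for p
  proof
    fix v
    have pr: "p \<in> ball 0 r" "p \<in> ball 0 R" using p by auto
    have "frechet_derivative \<Psi> (at p) = vder \<Psi> p"
      by (rule frechet_derivative_at[symmetric], intro has_derivative_vec_comp cdiff_has_derivative \<Psi>(1) pr)
    then show "pullback \<Psi> \<omega>\<^sub>1 p v = \<omega>\<^sub>0 p v"
      unfolding pullback_def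
      by (simp only: two_form_eq_bil[OF alt(2)[OF \<Psi>(3)[OF pr(1)]]] two_form_eq_bil[OF alt(1)[OF pr(2)]]
          bil_eq_bf[OF alt(2)[OF \<Psi>(3)[OF pr(1)]]] bil_eq_bf[OF alt(1)[OF pr(2)]] \<Psi>(5)[OF pr(1)])
  qed
  then have "\<forall>\<^sub>F p in nhds 0. pullback \<Psi> \<omega>\<^sub>1 p = \<omega>\<^sub>0 p"
    unfolding eventually_nhds_metric using r R by (intro exI[of _ "min r R"]) (simp add: dist_commute)
  then show ?thesis using diffeo_germI[OF r \<Psi>(1,2,4)] by blast
qed

end
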